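(* Let $0<\alpha<\beta<1$ and let $p$ be a $1$-periodic measurable function on $\mathbb{R}$ with $p>0$ and $p,p^{-1}\in L^\infty(0,1)$. For $\varepsilon>0$ let $A^\varepsilon$ be the self-adjoint operator in $L^2(\mathbb{R})$ associated with the closed form $$(u,v)\mapsto\int_{\mathbb{R}}p(x/\varepsilon)\bigl(\varepsilon^2\chi_0(x/\varepsilon)+\chi_1(x/\varepsilon)\bigr)u'(x)\overline{v'(x)}\,dx,\qquad u,v\in H^1(\mathbb{R}),$$ and let $S^\varepsilon=\sigma(A^\varepsilon)$. Let $\Lambda:=\bigcup_{\theta\in[0,1)}\sigma(A(\theta))$. Then $S^\varepsilon$ converges to $\Lambda$ as $\varepsilon\to0$, i.e. (i) for every $\lambda\in\Lambda$ there exist $\lambda_\varepsilon\in S^\varepsilon$ with $\lambda_\varepsilon\to\lambda$ as $\varepsilon\to0$, and (ii) whenever $\varepsilon_n\to0$, $\lambda_n\in S^{\varepsilon_n}$ and $\lambda_n\to\lambda$, one has $\lambda\in\Lambda$. In particular, when $p\equiv1$, $\Lambda$ is the set of all $\lambda$ for which there exists $\theta\in[0,1)$ with $$\tfrac12(\alpha-\beta+1)\sqrt{\lambda}\,\sin\bigl(\sqrt{\lambda}(\alpha-\beta)\bigr)+\cos\bigl(\sqrt{\lambda}(\alpha-\beta)\bigr)=\cos(2\pi\theta)$$ (the left-hand side does not depend on the choice of square root).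
   Context: $\chi_0,\chi_1$ are the indicator functions of the $1$-periodic open sets $F_0=\bigcup_{n\in\mathbb{Z}}(\alpha+n,\beta+n)$ and $F_1=\bigcup_{n\in\mathbb{Z}}(\beta+n,\alpha+n+1)$. Write $Q=(0,1)$, $Q_0=(\alpha,\beta)$, $Q_1=(0,\alpha)\cup(\beta,1)$. For $\theta\in[0,1)$, $H^1_\theta(Q)=\{u\in H^1(0,1):u(1)=e^{2\pi i\theta}u(0)\}$ (continuous representatives), and $V(\theta)=\{v\in H^1_\theta(Q): p(y)v'(y)=0 \text{ for a.e. } y\in Q_1\}$. $A(\theta)$ denotes the self-adjoint operator in the $L^2(Q)$-closure of $V(\theta)$ associated with the closed form $(u,\varphi)\mapsto\int_{Q_0}p(y)u'(y)\overline{\varphi'(y)}\,dy$ on $V(\theta)$; it has discrete spectrum $\sigma(A(\theta))$. *)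

theory Defs
  imports "HOL-Analysis.Analysis"
begin

section \<open>L^2 spaces of complex functions (elements are representatives; equality is a.e.)\<close>

definition L2 :: "real measure \<Rightarrow> (real \<Rightarrow> complex) set" where
  "L2 M = {u. u \<in> borel_measurable M \<and> integrable M (\<lambda>x. (cmod (u x))\<^sup>2)}"

definition L2inner :: "real measure \<Rightarrow> (real \<Rightarrow> complex) \<Rightarrow> (real \<Rightarrow> complex) \<Rightarrow> complex" where
  "L2inner M u v = (\<integral>x. u x * cnj (v x) \<partial>M)"

definition L2norm :: "real measure \<Rightarrow> (real \<Rightarrow> complex) \<Rightarrow> real" where
  "L2norm M u = sqrt (\<integral>x. (cmod (u x))\<^sup>2 \<partial>M)"

definition test_fn :: "real set \<Rightarrow> (real \<Rightarrow> real) \<Rightarrow> bool" where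
  "test_fn I \<phi> \<longleftrightarrow> (\<forall>n x. ((deriv ^^ n) \<phi>) differentiable (at x))
      \<and> compact (closure {x. \<phi> x \<noteq> 0}) \<and> closure {x. \<phi> x \<noteq> 0} \<subseteq> I"

definition has_weak_deriv :: "real set \<Rightarrow> (real \<Rightarrow> complex) \<Rightarrow> (real \<Rightarrow> complex) \<Rightarrow> bool" where
  "has_weak_deriv I u g \<longleftrightarrow> (\<forall>\<phi>. test_fn I \<phi> \<longrightarrow>
      (\<integral>x. u x * of_real (deriv \<phi> x) \<partial>lebesgue_on I) = - (\<integral>x. g x * of_real (\<phi> x) \<partial>lebesgue_on I))"

definition H1 :: "real set \<Rightarrow> (real \<Rightarrow> complex) set" where
  "H1 I = {u \<in> L2 (lebesgue_on I). \<exists>g \<in> L2 (lebesgue_on I). has_weak_deriv I u g}"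

definition weak_deriv :: "real set \<Rightarrow> (real \<Rightarrow> complex) \<Rightarrow> real \<Rightarrow> complex" where
  "weak_deriv I u = (SOME g. g \<in> L2 (lebesgue_on I) \<and> has_weak_deriv I u g)"

text \<open>The operator A in the Hilbert space H (a closed subspace of L2 M) associated with the
 form a on the form domain D: u in dom A with A u = f iff u in D, f in H and
 a(u,phi) = <f,phi> for all phi in D.  The resolvent set consists of the lambda for which
 A - lambda is a bijection of dom A onto H with bounded inverse; unfolded below.\<close>

definition form_resolvent ::
  "real measure \<Rightarrow> (real \<Rightarrow> complex) set \<Rightarrow> (real \<Rightarrow> complex) set
     \<Rightarrow> ((real \<Rightarrow> complex) \<Rightarrow> (real \<Rightarrow> complex) \<Rightarrow> complex) \<Rightarrow> complex \<Rightarrow> bool" where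
  "form_resolvent M H D a lam \<longleftrightarrow>
     (\<exists>C. \<forall>f \<in> H. \<exists>u \<in> D.
        (\<forall>\<phi> \<in> D. a u \<phi> - lam * L2inner M u \<phi> = L2inner M f \<phi>)
      \<and> L2norm M u \<le> C * L2norm M f
      \<and> (\<forall>w \<in> D. (\<forall>\<phi> \<in> D. a w \<phi> - lam * L2inner M w \<phi> = L2inner M f \<phi>)
              \<longrightarrow> (AE x in M. w x = u x)))"

definition form_spectrum ::
  "real measure \<Rightarrow> (real \<Rightarrow> complex) set \<Rightarrow> (real \<Rightarrow> complex) set
     \<Rightarrow> ((real \<Rightarrow> complex) \<Rightarrow> (real \<Rightarrow> complex) \<Rightarrow> complex) \<Rightarrow> complex set" where
  "form_spectrum M H D a = {lam. \<not> form_resolvent M H D a lam}"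

definition F0 :: "real \<Rightarrow> real \<Rightarrow> real set" where
  "F0 \<alpha> \<beta> = (\<Union>n::int. {\<alpha> + of_int n <..< \<beta> + of_int n})"

definition F1 :: "real \<Rightarrow> real \<Rightarrow> real set" where
  "F1 \<alpha> \<beta> = (\<Union>n::int. {\<beta> + of_int n <..< \<alpha> + of_int n + 1})"

definition chi0 :: "real \<Rightarrow> real \<Rightarrow> real \<Rightarrow> real" where
  "chi0 \<alpha> \<beta> = indicator (F0 \<alpha> \<beta>)"

definition chi1 :: "real \<Rightarrow> real \<Rightarrow> real \<Rightarrow> real" where
  "chi1 \<alpha> \<beta> = indicator (F1 \<alpha> \<beta>)"

definition form_eps :: "real \<Rightarrow> real \<Rightarrow> (real \<Rightarrow> real) \<Rightarrow> real
     \<Rightarrow> (real \<Rightarrow> complex) \<Rightarrow> (real \<Rightarrow> complex) \<Rightarrow> complex" where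
  "form_eps \<alpha> \<beta> p \<epsilon> u v =
     (\<integral>x. of_real (p (x / \<epsilon>) * (\<epsilon>\<^sup>2 * chi0 \<alpha> \<beta> (x / \<epsilon>) + chi1 \<alpha> \<beta> (x / \<epsilon>)))
           * weak_deriv UNIV u x * cnj (weak_deriv UNIV v x) \<partial>lebesgue)"

definition S_eps :: "real \<Rightarrow> real \<Rightarrow> (real \<Rightarrow> real) \<Rightarrow> real \<Rightarrow> complex set" where
  "S_eps \<alpha> \<beta> p \<epsilon> = form_spectrum (lebesgue_on UNIV) (L2 (lebesgue_on UNIV)) (H1 UNIV)
       (form_eps \<alpha> \<beta> p \<epsilon>)"

definition H1_theta :: "real \<Rightarrow> (real \<Rightarrow> complex) set" where
  "H1_theta \<theta> = {u \<in> H1 {0<..<1}. continuous_on {0..1} u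
                     \<and> u 1 = cis (2 * pi * \<theta>) * u 0}"

definition V_theta :: "real \<Rightarrow> real \<Rightarrow> (real \<Rightarrow> real) \<Rightarrow> real \<Rightarrow> (real \<Rightarrow> complex) set" where
  "V_theta \<alpha> \<beta> p \<theta> = {v \<in> H1_theta \<theta>.
      AE y in lebesgue_on {0<..<1}. y \<in> {0<..<\<alpha>} \<union> {\<beta><..<1}
          \<longrightarrow> of_real (p y) * weak_deriv {0<..<1} v y = 0}"

definition Hspace_theta :: "real \<Rightarrow> real \<Rightarrow> (real \<Rightarrow> real) \<Rightarrow> real \<Rightarrow> (real \<Rightarrow> complex) set" where
  "Hspace_theta \<alpha> \<beta> p \<theta> = {f \<in> L2 (lebesgue_on {0<..<1}).
      \<forall>e>0. \<exists>v \<in> V_theta \<alpha> \<beta> p \<theta>. L2norm (lebesgue_on {0<..<1}) (\<lambda>y. f y - v y) < e}"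

definition form_theta :: "real \<Rightarrow> real \<Rightarrow> (real \<Rightarrow> real)
     \<Rightarrow> (real \<Rightarrow> complex) \<Rightarrow> (real \<Rightarrow> complex) \<Rightarrow> complex" where
  "form_theta \<alpha> \<beta> p u v =
     (\<integral>y. of_real (p y) * weak_deriv {0<..<1} u y * cnj (weak_deriv {0<..<1} v y)
        \<partial>lebesgue_on {\<alpha><..<\<beta>})"

definition spec_A_theta :: "real \<Rightarrow> real \<Rightarrow> (real \<Rightarrow> real) \<Rightarrow> real \<Rightarrow> complex set" where
  "spec_A_theta \<alpha> \<beta> p \<theta> = form_spectrum (lebesgue_on {0<..<1}) (Hspace_theta \<alpha> \<beta> p \<theta>)
       (V_theta \<alpha> \<beta> p \<theta>) (form_theta \<alpha> \<beta> p)"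

definition Lambda_set :: "real \<Rightarrow> real \<Rightarrow> (real \<Rightarrow> real) \<Rightarrow> complex set" where
  "Lambda_set \<alpha> \<beta> p = (\<Union>\<theta> \<in> {0..<1}. spec_A_theta \<alpha> \<beta> p \<theta>)"

end

theory Submission
  imports Defs "HOL-Complex_Analysis.Complex_Analysis"
begin

text \<open>
  With \<open>q = 1 / a\<close> the equation \<open>- (a u')' = \<lambda> u\<close> becomes the first order system \<open>u' = q w\<close>, \<open>w' = - \<lambda> u\<close>,
  which still makes sense where \<open>q = 0\<close>, that is, where the coefficient is infinite. After rescaling to unit period,
  the operator \<open>A\<^sup>\<epsilon>\<close> has \<open>q\<^sub>\<epsilon> = (\<chi>\<^sub>0 + \<epsilon>\<^sup>2 \<chi>\<^sub>1) / p\<close>, and the limit operators \<open>A(\<theta>)\<close> are exactly the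
  quasi-periodic problems for \<open>q\<^sub>0 = \<chi>\<^sub>0 / p\<close>. In both cases Floquet theory identifies the spectrum through the trace
  \<open>D\<^sub>\<epsilon>(\<lambda>)\<close> of the monodromy matrix: \<open>\<lambda> \<in> S\<^sup>\<epsilon>\<close> iff \<open>D\<^sub>\<epsilon>(\<lambda>) \<in> [-2, 2]\<close>, and
  \<open>\<lambda> \<in> \<sigma>(A(\<theta>))\<close> iff \<open>D\<^sub>0(\<lambda>) = 2 cos (2 \<pi> \<theta>)\<close>. The \<open>D\<^sub>\<epsilon>\<close> are entire functions that converge to
  \<open>D\<^sub>0\<close> locally uniformly, so limits of spectral points lie in \<open>\<Lambda>\<close>; conversely \<open>D\<^sub>\<epsilon>\<close> takes the value
  \<open>D\<^sub>0(\<lambda>)\<close> near \<open>\<lambda>\<close> by Hurwitz's theorem, as \<open>D\<^sub>0\<close> cannot be constant because eigenvalues are real.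
\<close>

section \<open>Locally absolutely continuous functions\<close>

text \<open>On the stiff part the limit form imposes \<open>u' = 0\<close>, so \<open>p * u'\<close>
  carries no information there; the flux \<open>w\<close> survives as a Lagrange multiplier of this
  constraint, which is why it is kept as a second unknown. After rescaling, the weights for
  \<epsilon> and for 0 differ by a multiple of \<open>\<epsilon>\<^sup>2\<close> uniformly, and the
  power series in \<lambda> depend on the weight in a Lipschitz way. Spectra are defined through
  resolvents, so each Floquet statement consists of two constructions. Off the spectrum the
  inhomogeneous problem is solved with a norm bound: by variation of parameters on the cell, by a
  Green kernel decaying like \<open>exp (- k * \<bar>x - t\<bar>)\<close> on the line. On the
  spectrum a quasi-periodic solution is an eigenfunction on the cell; on the line it is not square
  integrable and has to be cut off. All \<lambda> are complex, so the point that Hurwitz's theorem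
  finds near a given \<lambda> is covered by the trace criterion wherever it lies. Members of L2 are
  bare representatives and \<open>weak_deriv\<close> is an arbitrary choice, so functions in H1 are
  first exchanged for absolutely continuous ones.\<close>

definition loc_int :: "(real \<Rightarrow> complex) \<Rightarrow> bool" where
  "loc_int f \<longleftrightarrow> (\<forall>a b. set_integrable lebesgue {a..b} f)"

text \<open>Local absolute continuity with derivative \<open>g\<close>, in integrated form; \<open>g\<close> matters only up to null sets.\<close>

definition has_ac_deriv :: "(real \<Rightarrow> complex) \<Rightarrow> (real \<Rightarrow> complex) \<Rightarrow> bool" where
  "has_ac_deriv u g \<longleftrightarrow>
     loc_int g \<and> (\<forall>a b. a \<le> b \<longrightarrow> u b - u a = (LINT t:{a..b}|lebesgue. g t))"

lemma loc_intD: "loc_int f \<Longrightarrow> set_integrable lebesgue {a..b} f"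
  by (simp add: loc_int_def)

lemma loc_int_continuous: "continuous_on UNIV f \<Longrightarrow> loc_int f"
  unfolding loc_int_def
  by (blast intro: absolutely_integrable_continuous_real continuous_on_subset)

lemma loc_int_integrable_on: "loc_int f \<Longrightarrow> f integrable_on {a..b}"
  by (simp add: loc_int_def set_lebesgue_integral_eq_integral)

lemma loc_int_measurable: "loc_int f \<Longrightarrow> f \<in> borel_measurable lebesgue"
  using integrable_subintervals_imp_measurable[of f] loc_int_integrable_on[of f]
  by (simp add: cbox_interval measurable_on_iff_borel_measurable lebesgue_on_UNIV_eq)

lemma loc_int_mult_bounded:
  assumes u: "u \<in> borel_measurable lebesgue" and g: "loc_int g"
    and b: "\<And>a b. bounded (u ` {a..b})"
  shows "loc_int (\<lambda>x. u x * g x)"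
  unfolding loc_int_def
proof (intro allI)
  fix a b :: real
  show "set_integrable lebesgue {a..b} (\<lambda>x. u x * g x)"
    by (rule absolutely_integrable_bounded_measurable_product)
       (use u b g in \<open>auto simp: loc_int_def bilinear_times intro: measurable_restrict_space1\<close>)
qed

lemma loc_int_mult:
  assumes u: "continuous_on UNIV u" and g: "loc_int g"
  shows "loc_int (\<lambda>x. u x * g x)"
proof (rule loc_int_mult_bounded)
  show "u \<in> borel_measurable lebesgue"
    by (rule loc_int_measurable) (use u in \<open>simp add: loc_int_continuous\<close>)
  show "bounded (u ` {a..b})" for a b
    by (intro compact_imp_bounded compact_continuous_image continuous_on_subset[OF u]) auto
qed (fact g)

lemma loc_int_add: "loc_int f \<Longrightarrow> loc_int g \<Longrightarrow> loc_int (\<lambda>x. f x + g x)"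
  by (auto simp: loc_int_def)

lemma loc_int_diff: "loc_int f \<Longrightarrow> loc_int g \<Longrightarrow> loc_int (\<lambda>x. f x - g x)"
  by (auto simp: loc_int_def)

lemma loc_int_cmult: "loc_int f \<Longrightarrow> loc_int (\<lambda>x. c * f x)"
  by (auto simp: loc_int_def)

lemma set_integrable_cnj: "set_integrable M A f \<Longrightarrow> set_integrable M A (\<lambda>x. cnj (f x))"
  unfolding set_integrable_def using complex_integrable_cnj[of M "\<lambda>x. indicat_real A x *\<^sub>R f x"]
  by simp

lemma set_integral_cnj:
  fixes f :: "_ \<Rightarrow> complex"
  shows "(LINT t:A|M. cnj (f t)) = cnj (LINT t:A|M. f t)"
  unfolding set_lebesgue_integral_def using Bochner_Integration.integral_cnj[of M "\<lambda>x. indicat_real A x *\<^sub>R f x"] by simp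

lemma loc_int_cnj: "loc_int f \<Longrightarrow> loc_int (\<lambda>x. cnj (f x))"
  by (simp add: loc_int_def set_integrable_cnj)

lemma ac_loc_int: "has_ac_deriv u g \<Longrightarrow> loc_int g"
  by (simp add: has_ac_deriv_def)

lemma ac_integral: "has_ac_deriv u g \<Longrightarrow> a \<le> b \<Longrightarrow> (LINT t:{a..b}|lebesgue. g t) = u b - u a"
  by (simp add: has_ac_deriv_def)

lemma ac_integral_HK: "has_ac_deriv u g \<Longrightarrow> a \<le> b \<Longrightarrow> integral {a..b} g = u b - u a"
  by (simp add: has_ac_deriv_def loc_int_def set_lebesgue_integral_eq_integral)

lemma ac_continuous:
  assumes "has_ac_deriv u g" shows "continuous_on UNIV u"
proof -
  have "continuous (at x) u" for x
  proof -
    have "continuous_on {x-1..x+1} (\<lambda>t. u (x-1) + integral {x-1..t} g)"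
      using loc_int_integrable_on[OF ac_loc_int[OF assms]]
      by (intro continuous_intros indefinite_integral_continuous_1)
    moreover have "u (x-1) + integral {x-1..t} g = u t" if "t \<in> {x-1..x+1}" for t
      using ac_integral_HK[OF assms, of "x-1" t] that by simp
    ultimately have "continuous_on {x-1..x+1} u"
      using continuous_on_cong[of "{x-1..x+1}" "{x-1..x+1}" u "\<lambda>t. u (x-1) + integral {x-1..t} g"]
      by simp
    then have "continuous_on {x-1<..<x+1} u"
      by (rule continuous_on_subset) auto
    then show ?thesis
      by (simp add: continuous_on_eq_continuous_at)
  qed
  then show ?thesis by (simp add: continuous_at_imp_continuous_on)
qed

lemma ac_measurable: "has_ac_deriv u g \<Longrightarrow> u \<in> borel_measurable lebesgue"
  by (simp add: ac_continuous loc_int_continuous loc_int_measurable)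

lemma acI_HK:
  assumes "loc_int g" "\<And>a b. a \<le> b \<Longrightarrow> integral {a..b} g = u b - u a"
  shows "has_ac_deriv u g"
  using assms unfolding has_ac_deriv_def
  by (simp add: loc_int_def set_lebesgue_integral_eq_integral)

lemma ac_const: "has_ac_deriv (\<lambda>_. c) (\<lambda>_. 0)"
  by (simp add: has_ac_deriv_def loc_int_def set_integrable_def)

lemma ac_add:
  assumes "has_ac_deriv u g" "has_ac_deriv v h"
  shows "has_ac_deriv (\<lambda>x. u x + v x) (\<lambda>x. g x + h x)"
  using assms unfolding has_ac_deriv_def by (auto simp: loc_int_def set_integral_add(2) algebra_simps)

lemma ac_cmult:
  assumes "has_ac_deriv u g" shows "has_ac_deriv (\<lambda>x. c * u x) (\<lambda>x. c * g x)"
  using assms unfolding has_ac_deriv_def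
  by (auto simp: loc_int_def simp flip: right_diff_distrib)

lemma ac_diff:
  assumes "has_ac_deriv u g" "has_ac_deriv v h"
  shows "has_ac_deriv (\<lambda>x. u x - v x) (\<lambda>x. g x - h x)"
  using ac_add[OF assms(1) ac_cmult[OF assms(2), of "-1"]] by simp

lemma ac_cnj:
  assumes "has_ac_deriv u g" shows "has_ac_deriv (\<lambda>x. cnj (u x)) (\<lambda>x. cnj (g x))"
  using assms unfolding has_ac_deriv_def
  by (auto simp: loc_int_cnj set_integral_cnj simp flip: complex_cnj_diff)

lemma ac_cong: "has_ac_deriv u g \<Longrightarrow> (\<And>x. u x = v x) \<Longrightarrow> (\<And>x. g x = h x) \<Longrightarrow> has_ac_deriv v h"
  by (metis ext)

lemma ac_C1:
  assumes "\<And>x. (u has_vector_derivative g x) (at x)" "continuous_on UNIV g"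
  shows "has_ac_deriv u g"
proof (rule acI_HK[OF loc_int_continuous[OF assms(2)]])
  fix a b :: real assume "a \<le> b"
  then show "integral {a..b} g = u b - u a"
    by (intro integral_unique fundamental_theorem_of_calculus)
       (auto intro: has_vector_derivative_at_within assms(1))
qed

lemma ac_const_diff:
  assumes "has_ac_deriv u (\<lambda>_. 0)" shows "u x = u y"
  using ac_integral[OF assms, of x y] ac_integral[OF assms, of y x] by (cases "x \<le> y") auto

lemma ac_unique:
  assumes "has_ac_deriv u g" "has_ac_deriv v g" shows "u x - v x = u y - v y"
  using ac_const_diff[of "\<lambda>x. u x - v x"] ac_diff[OF assms] by simp

lemma ac_affine:
  assumes u: "has_ac_deriv u g" and m: "m > 0"
  shows "has_ac_deriv (\<lambda>x. u (c + m * x)) (\<lambda>x. of_real m * g (c + m * x))"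
proof -
  have ind: "indicat_real {c + m * a..c + m * b} (c + m * x) = indicat_real {a..b} x" for a b x
    using m by (auto simp: indicator_def)
  have 1: "loc_int (\<lambda>x. g (c + m * x))"
    unfolding loc_int_def
  proof (intro allI)
    fix a b
    have "integrable lebesgue (\<lambda>x. indicat_real {c + m * a..c + m * b} x *\<^sub>R g x)"
      using ac_loc_int[OF u] by (simp add: loc_int_def set_integrable_def)
    from lebesgue_integrable_real_affine[OF this, of m c] m
    show "set_integrable lebesgue {a..b} (\<lambda>x. g (c + m * x))"
      by (simp add: set_integrable_def ind)
  qed
  show ?thesis unfolding has_ac_deriv_def
  proof (intro conjI allI impI)
    show "loc_int (\<lambda>x. of_real m * g (c + m * x))" by (rule loc_int_cmult[OF 1])
    fix a b :: real assume "a \<le> b"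
    then have "u (c + m * b) - u (c + m * a) = (LINT t:{c + m * a..c + m * b}|lebesgue. g t)"
      using ac_integral[OF u, of "c + m * a" "c + m * b"] m by simp
    also have "\<dots> = of_real m * (LINT t:{a..b}|lebesgue. g (c + m * t))"
      unfolding set_lebesgue_integral_def
      by (subst lebesgue_integral_real_affine[of m _ c]) (use m in \<open>auto simp: ind scaleR_conv_of_real\<close>)
    finally show "u (c + m * b) - u (c + m * a) = (LINT t:{a..b}|lebesgue. of_real m * g (c + m * t))"
      by simp
  qed
qed

lemma ac_shift:
  assumes "has_ac_deriv u g" shows "has_ac_deriv (\<lambda>x. u (x + T)) (\<lambda>x. g (x + T))"
  using ac_affine[OF assms, of 1 T] by (simp add: add.commute)

text \<open>By Lebesgue differentiation the averages of \<open>g\<close> over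
  \<open>[x, x + h]\<close> converge to \<open>g x\<close> for almost every \<open>x\<close>; inside
  the open set \<open>I\<close> these averages are difference quotients of a constant.\<close>

lemma ac_unique_deriv_AE:
  assumes u: "has_ac_deriv u (g :: real \<Rightarrow> complex)" and I: "open I" "is_interval I" and c: "\<And>x. x \<in> I \<Longrightarrow> u x = c"
  shows "AE x in lebesgue. x \<in> I \<longrightarrow> g x = 0"
proof -
  have "\<And>a b. g integrable_on cbox a b"
    using loc_int_integrable_on[OF ac_loc_int[OF u]] by (simp add: cbox_interval)
  from integrable_ccontinuous_explicit[OF this] obtain N where N: "negligible N"
    and lim: "\<And>x e. \<lbrakk>x \<notin> N; 0 < e\<rbrakk> \<Longrightarrow> \<exists>d>0. \<forall>h. 0 < h \<and> h < d \<longrightarrow>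
        norm (integral (cbox x (x + h *\<^sub>R One)) g /\<^sub>R h ^ DIM(real) - g x) < e"
    by metis
  have "g x = 0" if "x \<in> I" "x \<notin> N" for x
  proof (rule ccontr)
    assume "g x \<noteq> 0"
    then obtain d where d: "d > 0" and dd: "\<And>h. 0 < h \<Longrightarrow> h < d \<Longrightarrow>
        norm (integral (cbox x (x + h *\<^sub>R One)) g /\<^sub>R h ^ DIM(real) - g x) < norm (g x)"
      using lim[OF \<open>x \<notin> N\<close>, of "norm (g x)"] by auto
    obtain r where r: "r > 0" "ball x r \<subseteq> I" using openE[OF I(1) \<open>x \<in> I\<close>] by metis
    define h where "h = min d r / 2"
    have h: "0 < h" "h < d" "h < r" using r d unfolding h_def by linarith+
    then have "x + h \<in> ball x r" by (simp add: dist_real_def)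
    with r have xh: "x + h \<in> I" by blast
    have "integral (cbox x (x + h *\<^sub>R One)) g = 0"
      using ac_integral_HK[OF u, of x "x + h"] c[OF \<open>x \<in> I\<close>] c[OF xh] h by (simp add: cbox_interval)
    with dd[OF h(1,2)] show False by simp
  qed
  moreover have "AE x in lebesgue. x \<notin> N"
    using N by (simp add: negligible_iff_null_sets AE_not_in)
  ultimately show ?thesis by auto
qed

text \<open>The integral over a reversed interval is 0, so at most one of the two terms is nonzero
  and the difference is the signed integral from 0 to \<open>x\<close>.\<close>

definition primitive :: "(real \<Rightarrow> complex) \<Rightarrow> real \<Rightarrow> complex" where
  "primitive f x = integral {0..x} f - integral {x..0} f"

lemma primitive_0 [simp]: "primitive f 0 = 0"
  by (simp add: primitive_def)

lemma ac_primitive: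
  assumes f: "loc_int f" shows "has_ac_deriv (primitive f) f"
proof (rule acI_HK[OF f])
  fix a b :: real assume "a \<le> b"
  note i = loc_int_integrable_on[OF f]
  have c: "integral {x..y} f + integral {y..z} f = integral {x..z} f" if "x \<le> y" "y \<le> z" for x y z
    using Henstock_Kurzweil_Integration.integral_combine[OF that i] .
  have z: "integral {x..y} f = 0" if "y \<le> x" for x y
    using that by (metis integral_null content_real_eq_0 interval_cbox)
  show "integral {a..b} f = primitive f b - primitive f a"
    using c[of a b 0] c[of a 0 b] c[of 0 a b] z[of a 0] z[of 0 a] z[of 0 b] z[of b 0] \<open>a \<le> b\<close>
    unfolding primitive_def by (cases "a \<le> 0"; cases "b \<le> 0"; simp add: algebra_simps)
qed

text \<open>Completion keeps the exhausting sets of the Borel version. This opens Fubini's theorem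
  for the product of Lebesgue measure with itself.\<close>

lemma sigma_finite_lebesgue: "sigma_finite_measure (lebesgue :: real measure)"
proof
  obtain A :: "real set set" where A: "countable A" "A \<subseteq> sets lborel" "\<Union>A = space lborel"
    "\<forall>a\<in>A. emeasure lborel a \<noteq> \<infinity>"
    using lborel.sigma_finite_countable by blast
  then show "\<exists>A. countable A \<and> A \<subseteq> sets (lebesgue :: real measure) \<and> \<Union>A = space lebesgue \<and>
      (\<forall>a\<in>A. emeasure lebesgue a \<noteq> \<infinity>)"
    by (intro exI[of _ A]) (auto simp: subset_iff)
qed

text \<open>Fubini for \<open>g x * h y\<close> on the triangle
  \<open>a \<le> y \<le> x \<le> b\<close>. In \<open>ac_mult\<close> it stands in for a pointwise
  product rule.\<close>

lemma triangle_Fubini: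
  assumes g: "loc_int g" and h: "loc_int h"
  shows "(LINT x:{a..b}|lebesgue. g x * (LINT y:{a..x}|lebesgue. h y)) =
         (LINT y:{a..b}|lebesgue. h y * (LINT x:{y..b}|lebesgue. g x))"
proof -
  interpret L: sigma_finite_measure "lebesgue :: real measure" by (rule sigma_finite_lebesgue)
  interpret P: pair_sigma_finite "lebesgue :: real measure" "lebesgue :: real measure" ..
  define G where "G = (\<lambda>x. indicat_real {a..b} x *\<^sub>R g x)"
  define H where "H = (\<lambda>x. indicat_real {a..b} x *\<^sub>R h x)"
  have G: "integrable lebesgue G" and H: "integrable lebesgue H"
    using g h by (simp_all add: loc_int_def G_def H_def set_integrable_def)
  note [measurable] = borel_measurable_integrable[OF G] borel_measurable_integrable[OF H]
  have idm [measurable]: "(\<lambda>x. x) \<in> measurable (lebesgue :: real measure) borel"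
    by (metis measurable_completion measurable_ident_sets sets_lborel)
  define K where "K = (\<lambda>(x, y). (if y \<le> x then 1 else 0) * (G x * H y))"
  have Km [measurable]: "K \<in> borel_measurable (lebesgue \<Otimes>\<^sub>M lebesgue)"
    unfolding K_def by measurable
  have K: "integrable (lebesgue \<Otimes>\<^sub>M lebesgue) K"
  proof (rule P.Fubini_integrable[OF Km])
    have ii: "integrable lebesgue (\<lambda>y. norm (G x * H y))" for x
      using H by (intro integrable_norm) simp
    have le: "norm (K (x, y)) \<le> norm (G x * H y)" for x y by (simp add: K_def norm_mult)
    show "AE x in lebesgue. integrable lebesgue (\<lambda>y. K (x, y))"
      by (rule AE_I2, rule Bochner_Integration.integrable_bound[OF ii]) (use le in auto)
    show "integrable lebesgue (\<lambda>x. \<integral>y. norm (K (x, y)) \<partial>lebesgue)"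
    proof (rule Bochner_Integration.integrable_bound)
      show "integrable lebesgue (\<lambda>x. norm (G x) * (\<integral>y. norm (H y) \<partial>lebesgue))"
        using G by simp
      show "AE x in lebesgue. norm (\<integral>y. norm (K (x, y)) \<partial>lebesgue)
          \<le> norm (norm (G x) * (\<integral>y. norm (H y) \<partial>lebesgue))"
      proof (rule AE_I2)
        fix x
        have "(\<integral>y. norm (K (x, y)) \<partial>lebesgue) \<le> (\<integral>y. norm (G x * H y) \<partial>lebesgue)"
          by (rule integral_mono[OF Bochner_Integration.integrable_bound[OF ii] ii]) (use le in auto)
        also have "\<dots> = norm (G x) * (\<integral>y. norm (H y) \<partial>lebesgue)"
          by (simp add: norm_mult)
        finally show "norm (\<integral>y. norm (K (x, y)) \<partial>lebesgue)
          \<le> norm (norm (G x) * (\<integral>y. norm (H y) \<partial>lebesgue))" by simp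
      qed
    qed measurable
  qed
  have "(\<integral>x. \<integral>y. K (x, y) \<partial>lebesgue \<partial>lebesgue) = (\<integral>y. \<integral>x. K (x, y) \<partial>lebesgue \<partial>lebesgue)"
    using P.Fubini_integral[of "\<lambda>x y. K (x, y)"] K by simp
  moreover have "(\<integral>y. K (x, y) \<partial>lebesgue) = indicat_real {a..b} x *\<^sub>R (g x * (LINT y:{a..x}|lebesgue. h y))" for x
  proof -
    have "K (x, y) = (indicat_real {a..b} x *\<^sub>R g x) * (indicat_real {a..x} y *\<^sub>R h y)" for y
      by (auto simp: K_def G_def H_def indicator_def)
    then have "(\<integral>y. K (x, y) \<partial>lebesgue) =
        (\<integral>y. (indicat_real {a..b} x *\<^sub>R g x) * (indicat_real {a..x} y *\<^sub>R h y) \<partial>lebesgue)"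
      by presburger
    then show ?thesis
      by (simp only: integral_mult_right_zero set_lebesgue_integral_def, simp)
  qed
  moreover have "(\<integral>x. K (x, y) \<partial>lebesgue) = indicat_real {a..b} y *\<^sub>R (h y * (LINT x:{y..b}|lebesgue. g x))" for y
  proof -
    have "K (x, y) = (indicat_real {a..b} y *\<^sub>R h y) * (indicat_real {y..b} x *\<^sub>R g x)" for x
      by (auto simp: K_def G_def H_def indicator_def)
    then have "(\<integral>x. K (x, y) \<partial>lebesgue) =
        (\<integral>x. (indicat_real {a..b} y *\<^sub>R h y) * (indicat_real {y..b} x *\<^sub>R g x) \<partial>lebesgue)"
      by presburger
    then show ?thesis
      by (simp only: integral_mult_right_zero set_lebesgue_integral_def, simp)
  qed
  ultimately show ?thesis by (simp add: set_lebesgue_integral_def)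
qed

text \<open>In \<open>triangle_Fubini\<close> the inner integral of \<open>h\<close> is
  \<open>v x - v a\<close> and that of \<open>g\<close> is \<open>u b - u y\<close>; inserting both
  turns the identity into integration by parts.\<close>

lemma ac_mult:
  assumes u: "has_ac_deriv u g" and v: "has_ac_deriv v h"
  shows "has_ac_deriv (\<lambda>x. u x * v x) (\<lambda>x. g x * v x + u x * h x)"
proof -
  note g = ac_loc_int[OF u] and h = ac_loc_int[OF v]
  have gv: "loc_int (\<lambda>x. g x * v x)" using loc_int_mult[OF ac_continuous[OF v] g] by (simp add: mult.commute)
  have uh: "loc_int (\<lambda>x. u x * h x)" using loc_int_mult[OF ac_continuous[OF u] h] by simp
  show ?thesis unfolding has_ac_deriv_def
  proof (intro conjI allI impI loc_int_add gv uh)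
    fix a b :: real assume ab: "a \<le> b"
    note s = loc_intD[OF g] loc_intD[OF h] loc_intD[OF gv] loc_intD[OF uh]
    have "(LINT x:{a..b}|lebesgue. g x * (LINT y:{a..x}|lebesgue. h y)) =
          (LINT x:{a..b}|lebesgue. g x * v x - v a * g x)"
      by (rule set_lebesgue_integral_cong) (auto simp: ac_integral[OF v] algebra_simps)
    also have "\<dots> = (LINT x:{a..b}|lebesgue. g x * v x) - v a * (u b - u a)"
      by (subst set_integral_diff(2)) (use s in \<open>auto simp: ac_integral[OF u ab]\<close>)
    finally have 1: "(LINT x:{a..b}|lebesgue. g x * (LINT y:{a..x}|lebesgue. h y)) =
      (LINT x:{a..b}|lebesgue. g x * v x) - v a * (u b - u a)" .
    have "(LINT y:{a..b}|lebesgue. h y * (LINT x:{y..b}|lebesgue. g x)) =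
          (LINT y:{a..b}|lebesgue. u b * h y - u y * h y)"
      by (rule set_lebesgue_integral_cong) (auto simp: ac_integral[OF u] algebra_simps)
    also have "\<dots> = u b * (v b - v a) - (LINT x:{a..b}|lebesgue. u x * h x)"
      by (subst set_integral_diff(2)) (use s in \<open>auto simp: ac_integral[OF v ab]\<close>)
    finally have 2: "(LINT y:{a..b}|lebesgue. h y * (LINT x:{y..b}|lebesgue. g x)) =
      u b * (v b - v a) - (LINT x:{a..b}|lebesgue. u x * h x)" .
    have "(LINT x:{a..b}|lebesgue. g x * v x + u x * h x) =
      (LINT x:{a..b}|lebesgue. g x * v x) + (LINT x:{a..b}|lebesgue. u x * h x)"
      by (rule set_integral_add(2)) (use s in auto)
    with 1 2 triangle_Fubini[OF g h, of a b]
    show "u b * v b - u a * v a = (LINT x:{a..b}|lebesgue. g x * v x + u x * h x)"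
      by (simp add: algebra_simps)
  qed
qed

section \<open>Test functions and weak derivatives\<close>

text \<open>Peels derivatives off one at a time for an arbitrary function, so that closure under
  sums and products goes by induction on the order. \<open>smooth_imp_differentiable_all\<close> and
  \<open>smooth_test_fn\<close> translate to and from the iterates of \<open>deriv\<close> in
  \<open>test_fn\<close>.\<close>

primrec nsmooth :: "nat \<Rightarrow> (real \<Rightarrow> real) \<Rightarrow> bool" where
  "nsmooth 0 f \<longleftrightarrow> True"
| "nsmooth (Suc n) f \<longleftrightarrow> (\<forall>x. f differentiable (at x)) \<and> nsmooth n (deriv f)"

definition smooth :: "(real \<Rightarrow> real) \<Rightarrow> bool" where
  "smooth f \<longleftrightarrow> (\<forall>n. nsmooth n f)"

lemma nsmooth_SucI:
  assumes "\<And>x. (f has_real_derivative g x) (at x)" "nsmooth n g"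
  shows "nsmooth (Suc n) f"
proof -
  have "deriv f = g" using assms(1) by (intro ext DERIV_imp_deriv)
  with assms show ?thesis by (auto simp: real_differentiable_def)
qed

lemma nsmooth_mono: "nsmooth (Suc n) f \<Longrightarrow> nsmooth n f"
  by (induction n arbitrary: f) auto

lemma smooth_DERIV: "smooth f \<Longrightarrow> (f has_real_derivative deriv f x) (at x)"
  unfolding smooth_def
  by (metis nsmooth.simps(2) DERIV_deriv_iff_real_differentiable)

lemma smooth_deriv: "smooth f \<Longrightarrow> smooth (deriv f)"
  unfolding smooth_def by (metis nsmooth.simps(2))

lemma smooth_imp_differentiable_all:
  assumes "smooth f" shows "(deriv ^^ n) f differentiable (at x)"
proof -
  have "smooth ((deriv ^^ n) f)"
    by (induction n) (use assms smooth_deriv in auto)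
  then show ?thesis using smooth_DERIV real_differentiable_def by blast
qed

lemma smooth_test_fn: "test_fn I f \<Longrightarrow> smooth f"
proof -
  assume t: "test_fn I f"
  have "nsmooth n ((deriv ^^ m) f)" for n m
  proof (induction n arbitrary: m)
    case (Suc n)
    from Suc[of "Suc m"] t show ?case by (simp add: test_fn_def)
  qed simp
  from this[of _ 0] show ?thesis by (simp add: smooth_def)
qed

lemma smooth_continuous: "smooth f \<Longrightarrow> continuous_on UNIV f"
  by (meson DERIV_isCont smooth_DERIV continuous_at_imp_continuous_on)

text \<open>Each differentiation stays inside the family \<open>S\<close>, so any number of them is
  possible. This replaces explicit formulas for higher derivatives.\<close>

lemma smooth_coinduct:
  assumes "S f" and step: "\<And>f. S f \<Longrightarrow> \<exists>g. (\<forall>x. (f has_real_derivative g x) (at x)) \<and> S g"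
  shows "smooth f"
proof -
  have "\<forall>f. S f \<longrightarrow> nsmooth n f" for n
  proof (induction n)
    case (Suc n)
    show ?case
    proof (intro allI impI)
      fix f assume "S f"
      then obtain g where "\<forall>x. (f has_real_derivative g x) (at x)" "S g" using step by blast
      with Suc show "nsmooth (Suc n) f" by (intro nsmooth_SucI) auto
    qed
  qed simp
  with assms(1) show ?thesis by (simp add: smooth_def)
qed

lemma smooth_antideriv:
  assumes "\<And>x. (f has_real_derivative g x) (at x)" "smooth g" shows "smooth f"
  unfolding smooth_def
proof
  fix n
  have "nsmooth (Suc n) f" by (rule nsmooth_SucI[of f g]) (use assms in \<open>auto simp: smooth_def\<close>)
  then show "nsmooth n f" by (rule nsmooth_mono)
qed

lemma nsmooth_add: "nsmooth n f \<Longrightarrow> nsmooth n g \<Longrightarrow> nsmooth n (\<lambda>x. f x + g x)"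
proof (induction n arbitrary: f g)
  case (Suc n)
  have "((\<lambda>x. f x + g x) has_real_derivative deriv f x + deriv g x) (at x)" for x
    using Suc.prems by (intro derivative_intros) (auto simp: DERIV_deriv_iff_real_differentiable)
  then show ?case by (rule nsmooth_SucI) (use Suc in auto)
qed simp

lemma nsmooth_mult: "nsmooth n f \<Longrightarrow> nsmooth n g \<Longrightarrow> nsmooth n (\<lambda>x. f x * g x)"
proof (induction n arbitrary: f g)
  case (Suc n)
  have "((\<lambda>x. f x * g x) has_real_derivative deriv f x * g x + deriv g x * f x) (at x)" for x
    using Suc.prems by (intro DERIV_mult) (auto simp: DERIV_deriv_iff_real_differentiable)
  then show ?case
    by (rule nsmooth_SucI) (use Suc nsmooth_mono in \<open>auto intro!: nsmooth_add\<close>)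
qed simp

lemma smooth_add: "smooth f \<Longrightarrow> smooth g \<Longrightarrow> smooth (\<lambda>x. f x + g x)"
  by (simp add: smooth_def nsmooth_add)

lemma smooth_mult: "smooth f \<Longrightarrow> smooth g \<Longrightarrow> smooth (\<lambda>x. f x * g x)"
  by (simp add: smooth_def nsmooth_mult)

lemma smooth_const: "smooth (\<lambda>_. c)"
  by (rule smooth_coinduct[where S = "\<lambda>f. \<exists>c. f = (\<lambda>_. c)"]) (auto intro!: exI[of _ "\<lambda>_. 0"])

lemma smooth_affine:
  assumes "smooth f" shows "smooth (\<lambda>x. f (a * x + b))"
proof (rule smooth_coinduct[where S = "\<lambda>h. \<exists>f c. smooth f \<and> h = (\<lambda>x. c * f (a * x + b))"])
  fix h assume "\<exists>f c. smooth f \<and> h = (\<lambda>x. c * f (a * x + b))"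
  then obtain f c where f: "smooth f" and h: "h = (\<lambda>x. c * f (a * x + b))" by blast
  have "(h has_real_derivative c * a * deriv f (a * x + b)) (at x)" for x
    unfolding h
    by (rule derivative_eq_intros DERIV_chain2[OF smooth_DERIV[OF f]] refl | simp)+
  then show "\<exists>g. (\<forall>x. (h has_real_derivative g x) (at x)) \<and> (\<exists>f c. smooth f \<and> g = (\<lambda>x. c * f (a * x + b)))"
    by (intro exI[of _ "\<lambda>x. c * a * deriv f (a * x + b)"]) (use smooth_deriv[OF f] in auto)
qed (use assms in \<open>auto intro!: exI[of _ f] exI[of _ 1]\<close>)

text \<open>The classical flat function \<open>exp (- (1 / x))\<close>, with a polynomial in
  \<open>1 / x\<close> in front so that the family is closed under differentiation.\<close>

definition flat_exp :: "real poly \<Rightarrow> real \<Rightarrow> real" where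
  "flat_exp p x = (if x > 0 then poly p (1 / x) * exp (- (1 / x)) else 0)"

lemma poly_div_exp_tendsto_0: "((\<lambda>x::real. poly p x / exp x) \<longlongrightarrow> 0) at_top"
proof -
  have "((\<lambda>x. \<Sum>i\<le>degree p. coeff p i * (x ^ i / exp x)) \<longlongrightarrow> (\<Sum>i\<le>degree p. coeff p i * 0)) at_top"
    by (intro tendsto_intros tendsto_power_div_exp_0)
  then show ?thesis by (simp add: poly_altdef sum_divide_distrib)
qed

text \<open>For positive \<open>x\<close> the chain rule produces the factor \<open>1 / x^2\<close>,
  which is the polynomial \<open>[:0, 0, 1:]\<close>, times \<open>p - pderiv p\<close>. At 0 the
  substitution of \<open>1 / h\<close> for \<open>h\<close> turns the difference quotient into a
  polynomial over an exponential at infinity.\<close>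

lemma flat_exp_DERIV:
  "(flat_exp p has_real_derivative flat_exp ([:0, 0, 1:] * (p - pderiv p)) x) (at x)"
proof -
  consider "x < 0" | "x = 0" | "x > 0" by linarith
  then show ?thesis
  proof cases
    case 1
    have "((\<lambda>_. 0) has_real_derivative 0) (at x)" by simp
    then have "(flat_exp p has_real_derivative 0) (at x)"
      by (rule has_field_derivative_transform_within_open[of _ _ _ "{..<0}"])
         (use 1 in \<open>auto simp: flat_exp_def\<close>)
    with 1 show ?thesis by (simp add: flat_exp_def)
  next
    case 3
    have "((\<lambda>x. poly p (1 / x) * exp (- (1 / x))) has_real_derivative
        (poly (pderiv p) (1 / x) * (- 1 / x\<^sup>2)) * exp (- (1 / x)) + poly p (1 / x) * (exp (- (1 / x)) * (1 / x\<^sup>2))) (at x)"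
      by (rule derivative_eq_intros DERIV_chain2[OF poly_DERIV] refl | use 3 in \<open>simp add: power2_eq_square\<close>)+
    also have "(poly (pderiv p) (1 / x) * (- 1 / x\<^sup>2)) * exp (- (1 / x)) + poly p (1 / x) * (exp (- (1 / x)) * (1 / x\<^sup>2))
        = flat_exp ([:0, 0, 1:] * (p - pderiv p)) x"
      using 3 by (simp add: flat_exp_def power2_eq_square algebra_simps)
    finally show ?thesis
      by (rule has_field_derivative_transform_within_open[of _ _ _ "{0<..}"])
         (use 3 in \<open>auto simp: flat_exp_def\<close>)
  next
    case 2
    have "((\<lambda>h. flat_exp p h / h) \<longlongrightarrow> 0) (at_left 0)"
      by (rule Lim_transform_eventually[OF tendsto_const])
         (auto simp: eventually_at_filter flat_exp_def)
    moreover have "((\<lambda>h. flat_exp p h / h) \<longlongrightarrow> 0) (at_right 0)"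
      unfolding filterlim_at_right_to_top
    proof (rule Lim_transform_eventually[OF poly_div_exp_tendsto_0[of "[:0, 1:] * p"]])
      show "\<forall>\<^sub>F x in at_top. poly ([:0, 1:] * p) x / exp x = flat_exp p (inverse x) / inverse x"
        using eventually_gt_at_top[of 0]
        by eventually_elim (simp add: flat_exp_def exp_minus field_simps)
    qed
    ultimately have "((\<lambda>h. flat_exp p h / h) \<longlongrightarrow> 0) (at 0)"
      by (rule filterlim_split_at)
    with 2 show ?thesis by (simp add: DERIV_def flat_exp_def)
  qed
qed

lemma smooth_flat_exp: "smooth (flat_exp p)"
  by (rule smooth_coinduct[where S = "\<lambda>f. \<exists>p. f = flat_exp p"]) (use flat_exp_DERIV in blast)+

text \<open>As \<open>k\<close> tends to infinity, these test functions increase to the indicator of \<open>(c, d)\<close>.\<close>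

definition bump :: "real \<Rightarrow> real \<Rightarrow> real \<Rightarrow> real \<Rightarrow> real" where
  "bump k c d x = flat_exp 1 (k * (x - c)) * flat_exp 1 (k * (d - x))"

lemma smooth_bump: "smooth (bump k c d)"
proof -
  have "smooth (\<lambda>x. flat_exp 1 (k * x + - k * c) * flat_exp 1 (- k * x + k * d))"
    by (intro smooth_mult smooth_affine smooth_flat_exp)
  then show ?thesis by (simp add: bump_def[abs_def] algebra_simps)
qed

lemma bump_outside: "k > 0 \<Longrightarrow> x \<notin> {c<..<d} \<Longrightarrow> bump k c d x = 0"
  by (auto simp: bump_def flat_exp_def zero_less_mult_iff)

lemma bump_pos: "k > 0 \<Longrightarrow> x \<in> {c<..<d} \<Longrightarrow> bump k c d x > 0"
  by (auto simp: bump_def flat_exp_def)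

lemma bump_le_1: "bump k c d x \<le> 1"
proof -
  have "0 \<le> flat_exp 1 y" "flat_exp 1 y \<le> 1" for y by (auto simp: flat_exp_def)
  then show ?thesis unfolding bump_def by (intro mult_le_one) auto
qed

lemma bump_nonneg: "0 \<le> bump k c d x"
  by (auto simp: bump_def flat_exp_def)

lemma bump_tendsto:
  assumes "x \<in> {c<..<d}" shows "(\<lambda>n. bump (real (Suc n)) c d x) \<longlonglongrightarrow> 1"
proof -
  have *: "(\<lambda>n. flat_exp 1 (real (Suc n) * y)) \<longlonglongrightarrow> 1" if "y > 0" for y
  proof -
    have "(\<lambda>n. exp (- (inverse (real (Suc n)) * (1 / y)))) \<longlonglongrightarrow> exp (- (0 * (1 / y)))"
      by (intro tendsto_intros LIMSEQ_inverse_real_of_nat)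
    moreover have "exp (- (inverse (real (Suc n)) * (1 / y))) = flat_exp 1 (real (Suc n) * y)" for n
    proof -
      have "real (Suc n) * y > 0" using that by simp
      then show ?thesis by (simp add: flat_exp_def inverse_eq_divide del: of_nat_Suc)
    qed
    ultimately show ?thesis by simp
  qed
  have "(\<lambda>n. flat_exp 1 (real (Suc n) * (x - c)) * flat_exp 1 (real (Suc n) * (d - x))) \<longlonglongrightarrow> 1 * 1"
    by (intro tendsto_mult *) (use assms in auto)
  then show ?thesis by (simp add: bump_def)
qed

lemma test_fnI:
  assumes "smooth f" "\<And>x. x \<notin> {c..d} \<Longrightarrow> f x = 0" "{c..d} \<subseteq> I"
  shows "test_fn I f"
proof -
  have sub: "closure {x. f x \<noteq> 0} \<subseteq> {c..d}"
    by (rule closure_minimal) (use assms(2) in fastforce, simp)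
  then have "compact (closure {x. f x \<noteq> 0})"
    by (meson bounded_closed_interval bounded_subset closed_closure compact_eq_bounded_closed)
  with sub assms(3) smooth_imp_differentiable_all[OF assms(1)] show ?thesis
    by (auto simp: test_fn_def)
qed

lemma test_fn_bump: "k > 0 \<Longrightarrow> {c..d} \<subseteq> I \<Longrightarrow> test_fn I (bump k c d)"
  by (rule test_fnI[OF smooth_bump]) (auto intro: bump_outside)

section \<open>The fundamental lemma of the calculus of variations\<close>

lemma loc_int_smooth_mult:
  assumes v: "loc_int v" and f: "continuous_on UNIV f" and z: "\<And>x. x \<notin> {c..d} \<Longrightarrow> f x = 0"
  shows "integrable lebesgue (\<lambda>x. v x * complex_of_real (f x))"
proof -
  have "loc_int (\<lambda>x. complex_of_real (f x) * v x)"
    by (intro loc_int_mult v continuous_intros f)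
  then have "integrable lebesgue (\<lambda>x. indicat_real {c..d} x *\<^sub>R (complex_of_real (f x) * v x))"
    by (simp add: loc_int_def set_integrable_def)
  moreover have "indicat_real {c..d} x *\<^sub>R (complex_of_real (f x) * v x) = v x * complex_of_real (f x)" for x
    using z by (auto simp: indicator_def)
  ultimately show ?thesis by simp
qed

text \<open>Bumps converge to the indicator of their interval, so by dominated convergence
  \<open>v\<close> has integral 0 over every compact interval in \<open>I\<close>. Its primitive is
  then constant on \<open>I\<close>, and \<open>ac_unique_deriv_AE\<close> applies.\<close>

lemma fundamental_lemma:
  assumes v: "loc_int v" and I: "open I" "is_interval I"
    and z: "\<And>k c d. k > 0 \<Longrightarrow> c < d \<Longrightarrow> {c..d} \<subseteq> I \<Longrightarrow> (\<integral>x. v x * of_real (bump k c d x) \<partial>lebesgue) = 0"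
  shows "AE x in lebesgue. x \<in> I \<longrightarrow> v x = 0"
proof (cases "I = {}")
  case False
  then obtain x0 where x0: "x0 \<in> I" by blast
  have int0: "(LINT x:{c..d}|lebesgue. v x) = 0" if cd: "c < d" "{c..d} \<subseteq> I" for c d
  proof -
    have "(\<lambda>n. \<integral>x. v x * of_real (bump (real (Suc n)) c d x) \<partial>lebesgue)
        \<longlonglongrightarrow> (\<integral>x. indicat_real {c<..<d} x *\<^sub>R v x \<partial>lebesgue)"
    proof (rule integral_dominated_convergence)
      show "(\<lambda>x. indicat_real {c<..<d} x *\<^sub>R v x) \<in> borel_measurable lebesgue"
        using loc_int_measurable[OF v] by (intro borel_measurable_scaleR borel_measurable_indicator) auto
      show "(\<lambda>x. v x * of_real (bump (real (Suc n)) c d x)) \<in> borel_measurable lebesgue" for n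
        by (rule borel_measurable_integrable,
            rule loc_int_smooth_mult[OF v smooth_continuous[OF smooth_bump], of c d], rule bump_outside) auto
      show "integrable lebesgue (\<lambda>x. norm (indicat_real {c..d} x *\<^sub>R v x))"
        using v by (intro integrable_norm) (simp add: loc_int_def set_integrable_def)
      show "AE x in lebesgue. norm (v x * of_real (bump (real (Suc n)) c d x))
          \<le> norm (indicat_real {c..d} x *\<^sub>R v x)" for n
      proof (rule AE_I2)
        fix x
        have "bump (real (Suc n)) c d x = 0" if "x \<notin> {c..d}"
          by (rule bump_outside) (use that in auto)
        moreover have "norm (v x) * \<bar>bump (real (Suc n)) c d x\<bar> \<le> norm (v x) * 1"
          using bump_le_1 bump_nonneg by (intro mult_left_mono) (auto simp: abs_le_iff intro: order_trans[of _ 0])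
        ultimately show "norm (v x * of_real (bump (real (Suc n)) c d x))
            \<le> norm (indicat_real {c..d} x *\<^sub>R v x)"
          by (auto simp: indicator_def norm_mult simp del: of_nat_Suc)
      qed
      show "AE x in lebesgue. (\<lambda>n. v x * of_real (bump (real (Suc n)) c d x)) \<longlonglongrightarrow> indicat_real {c<..<d} x *\<^sub>R v x"
      proof (rule AE_I2)
        fix x show "(\<lambda>n. v x * of_real (bump (real (Suc n)) c d x)) \<longlonglongrightarrow> indicat_real {c<..<d} x *\<^sub>R v x"
        proof (cases "x \<in> {c<..<d}")
          case True
          have "(\<lambda>n. v x * of_real (bump (real (Suc n)) c d x)) \<longlonglongrightarrow> v x * of_real 1"
            by (intro tendsto_intros bump_tendsto[OF True])
          with True show ?thesis by simp
        next
          case False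
          then have "bump (real (Suc n)) c d x = 0" for n by (intro bump_outside) auto
          with False show ?thesis by (simp del: of_nat_Suc)
        qed
      qed
    qed
    moreover have "(\<integral>x. v x * of_real (bump (real (Suc n)) c d x) \<partial>lebesgue) = 0" for n
      by (rule z) (use cd in auto)
    ultimately have "(\<lambda>n. 0) \<longlonglongrightarrow> (\<integral>x. indicat_real {c<..<d} x *\<^sub>R v x \<partial>lebesgue)"
      by (simp del: of_nat_Suc)
    then have "(\<integral>x. indicat_real {c<..<d} x *\<^sub>R v x \<partial>lebesgue) = 0"
      using LIMSEQ_unique tendsto_const by blast
    moreover have "AE x in lebesgue. x \<noteq> c" "AE x in lebesgue. x \<noteq> d"
      by (auto intro!: AE_completion AE_lborel_singleton)
    then have "(\<integral>x. indicat_real {c<..<d} x *\<^sub>R v x \<partial>lebesgue) = (\<integral>x. indicat_real {c..d} x *\<^sub>R v x \<partial>lebesgue)"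
      using loc_int_measurable[OF v]
      by (intro integral_cong_AE borel_measurable_scaleR borel_measurable_indicator)
         (auto simp: indicator_def elim: AE_mp)
    ultimately show ?thesis by (simp add: set_lebesgue_integral_def)
  qed
  note V = ac_primitive[OF v]
  have "primitive v x = primitive v x0" if "x \<in> I" for x
  proof -
    have 1: "{x..x0} \<subseteq> I" "{x0..x} \<subseteq> I"
      using mem_is_interval_1_I[OF I(2) that x0] mem_is_interval_1_I[OF I(2) x0 that] by auto
    consider "x < x0" | "x = x0" | "x0 < x" by linarith
    then show ?thesis
      by cases (use ac_integral[OF V, of x x0] ac_integral[OF V, of x0 x] int0[OF _ 1(1)] int0[OF _ 1(2)] in auto)
  qed
  from ac_unique_deriv_AE[OF V I this] show ?thesis by simp
qed simp

section \<open>Weak derivatives and absolutely continuous representatives\<close>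

lemma integral_lebesgue_on:
  "I \<in> sets lebesgue \<Longrightarrow> (\<integral>x. f x \<partial>lebesgue_on I) = (\<integral>x. indicat_real I x *\<^sub>R f x \<partial>lebesgue)"
  for f :: "real \<Rightarrow> 'a::{banach, second_countable_topology}"
  by (simp add: integral_restrict_space)

lemma integrable_lebesgue_on:
  "I \<in> sets lebesgue \<Longrightarrow> integrable (lebesgue_on I) f \<longleftrightarrow> integrable lebesgue (\<lambda>x. indicat_real I x *\<^sub>R f x)"
  for f :: "real \<Rightarrow> 'a::{banach, second_countable_topology}"
  by (simp add: integrable_restrict_space)

lemma AE_lebesgue_on: "I \<in> sets lebesgue \<Longrightarrow> (AE x in lebesgue_on I. P x) \<longleftrightarrow> (AE x in lebesgue. x \<in> I \<longrightarrow> P x)"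
  by (simp add: AE_restrict_space_iff)

lemma measurable_lebesgue_on:
  "I \<in> sets lebesgue \<Longrightarrow> f \<in> borel_measurable (lebesgue_on I) \<longleftrightarrow>
     (\<lambda>x. indicat_real I x *\<^sub>R f x) \<in> borel_measurable lebesgue"
  for f :: "real \<Rightarrow> complex"
  by (simp add: borel_measurable_restrict_space_iff)

lemma L2_iff:
  assumes "I \<in> sets lebesgue"
  shows "u \<in> L2 (lebesgue_on I) \<longleftrightarrow>
    (\<lambda>x. indicat_real I x *\<^sub>R u x) \<in> borel_measurable lebesgue \<and>
    integrable lebesgue (\<lambda>x. (cmod (indicat_real I x *\<^sub>R u x))\<^sup>2)"
proof -
  have "indicat_real I x *\<^sub>R (cmod (u x))\<^sup>2 = (cmod (indicat_real I x *\<^sub>R u x))\<^sup>2" for x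
    by (simp add: indicator_def)
  with assms show ?thesis
    by (simp only: L2_def mem_Collect_eq measurable_lebesgue_on integrable_lebesgue_on)
qed

text \<open>On a bounded interval the pointwise bound \<open>r \<le> 1 + r\<^sup>2\<close> gives an
  integrable majorant. Extension by zero outside \<open>I\<close> makes the result usable with
  \<open>has_ac_deriv\<close>, which lives on the whole line.\<close>

lemma L2_loc_int:
  assumes I: "I \<in> sets lebesgue" and u: "u \<in> L2 (lebesgue_on I)"
  shows "loc_int (\<lambda>x. indicat_real I x *\<^sub>R u x)"
  unfolding loc_int_def set_integrable_def
proof (intro allI)
  fix a b :: real
  let ?v = "\<lambda>x. indicat_real I x *\<^sub>R u x"
  have v: "?v \<in> borel_measurable lebesgue" "integrable lebesgue (\<lambda>x. (cmod (?v x))\<^sup>2)"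
    using u L2_iff[OF I] by auto
  have "loc_int (\<lambda>_. 1)" by (intro loc_int_continuous continuous_intros)
  then have "integrable lebesgue (\<lambda>x. indicat_real {a..b} x *\<^sub>R (1::complex))"
    unfolding loc_int_def set_integrable_def by blast
  then have "integrable lebesgue (\<lambda>x. norm (indicat_real {a..b} x *\<^sub>R (1::complex)) + (cmod (?v x))\<^sup>2)"
    by (intro Bochner_Integration.integrable_add integrable_norm v(2))
  then show "integrable lebesgue (\<lambda>x. indicat_real {a..b} x *\<^sub>R ?v x)"
  proof (rule Bochner_Integration.integrable_bound)
    show "(\<lambda>x. indicat_real {a..b} x *\<^sub>R ?v x) \<in> borel_measurable lebesgue"
      by (rule borel_measurable_scaleR[OF borel_measurable_indicator v(1)]) simp
    have "r \<le> 1 + r\<^sup>2" for r :: real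
      using sum_squares_bound[of r 1] zero_le_power2[of r] unfolding power_one mult_1_right by linarith
    then have "cmod (?v x) \<le> 1 + (cmod (?v x))\<^sup>2" for x by blast
    then show "AE x in lebesgue. norm (indicat_real {a..b} x *\<^sub>R ?v x)
        \<le> norm (norm (indicat_real {a..b} x *\<^sub>R (1::complex)) + (cmod (?v x))\<^sup>2)"
      by (intro AE_I2) (simp add: indicator_def)
  qed
qed

lemma test_fn_support:
  assumes "test_fn I f"
  obtains R where "R > 0" "\<And>x. x \<notin> I \<or> \<bar>x\<bar> \<ge> R \<Longrightarrow> f x = 0 \<and> deriv f x = 0"
proof -
  let ?S = "closure {x. f x \<noteq> 0}"
  have S: "compact ?S" "?S \<subseteq> I" using assms by (auto simp: test_fn_def)
  obtain R where R: "R > 0" "\<And>x. x \<in> ?S \<Longrightarrow> \<bar>x\<bar> \<le> R"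
    using compact_imp_bounded[OF S(1)] by (auto simp: bounded_pos)
  have "f x = 0 \<and> deriv f x = 0" if "x \<notin> ?S" for x
  proof
    show "f x = 0" using that closure_subset[of "{x. f x \<noteq> 0}"] by blast
    have "((\<lambda>_. 0) has_real_derivative 0) (at x)" by simp
    then have "(f has_real_derivative 0) (at x)"
      by (rule has_field_derivative_transform_within_open[of _ _ _ "- ?S"])
         (use that closure_subset[of "{x. f x \<noteq> 0}"] in auto)
    then show "deriv f x = 0" by (rule DERIV_imp_deriv)
  qed
  moreover have "x \<notin> ?S" if "x \<notin> I \<or> \<bar>x\<bar> \<ge> R + 1" for x
    using that S(2) R(2)[of x] by auto
  ultimately have "\<And>x. x \<notin> I \<or> \<bar>x\<bar> \<ge> R + 1 \<Longrightarrow> f x = 0 \<and> deriv f x = 0" by blast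
  with R(1) show ?thesis by (meson that add_pos_pos zero_less_one)
qed

lemma ac_of_real_smooth:
  assumes "smooth f" shows "has_ac_deriv (\<lambda>x. of_real (f x)) (\<lambda>x. of_real (deriv f x))"
proof (rule ac_C1)
  show "((\<lambda>x. complex_of_real (f x)) has_vector_derivative of_real (deriv f x)) (at x)" for x
    by (rule has_vector_derivative_of_real[OF smooth_DERIV[OF assms]])
  show "continuous_on UNIV (\<lambda>x. complex_of_real (deriv f x))"
    by (intro continuous_intros smooth_continuous smooth_deriv assms)
qed

text \<open>Integration by parts over an interval \<open>[-R, R]\<close> that carries the test
  function, so that the boundary terms vanish. The test function also removes whatever
  \<open>U\<close> and \<open>G\<close> do outside \<open>I\<close>.\<close>

lemma ac_weak_deriv:
  assumes U: "has_ac_deriv U G" and I: "I \<in> sets lebesgue"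
    and u: "AE x in lebesgue. x \<in> I \<longrightarrow> u x = U x" and g: "AE x in lebesgue. x \<in> I \<longrightarrow> g x = G x"
    and um: "u \<in> borel_measurable (lebesgue_on I)" and gm: "g \<in> borel_measurable (lebesgue_on I)"
  shows "has_weak_deriv I u g"
  unfolding has_weak_deriv_def
proof (intro allI impI)
  fix f assume t: "test_fn I f"
  obtain R where R: "R > 0" "\<And>x. x \<notin> I \<or> \<bar>x\<bar> \<ge> R \<Longrightarrow> f x = 0 \<and> deriv f x = 0"
    using test_fn_support[OF t] by metis
  have Rf: "f R = 0" "f (-R) = 0" using R by auto
  note sm = smooth_test_fn[OF t]
  note F = ac_of_real_smooth[OF sm]
  have prod: "has_ac_deriv (\<lambda>x. U x * of_real (f x)) (\<lambda>x. G x * of_real (f x) + U x * of_real (deriv f x))"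
    by (rule ac_mult[OF U F])
  have i1: "integrable lebesgue (\<lambda>x. G x * of_real (f x))"
    by (rule loc_int_smooth_mult[OF ac_loc_int[OF U] smooth_continuous[OF sm], of "-R" R]) (use R in auto)
  have i2: "integrable lebesgue (\<lambda>x. U x * of_real (deriv f x))"
    by (rule loc_int_smooth_mult[OF loc_int_continuous[OF ac_continuous[OF U]] smooth_continuous[OF smooth_deriv[OF sm]], of "-R" R])
       (use R in auto)
  have ind: "indicat_real {-R..R} x *\<^sub>R (G x * of_real (f x) + U x * of_real (deriv f x)) =
     G x * of_real (f x) + U x * of_real (deriv f x)" for x
    using R(2)[of x] by (cases "R \<le> \<bar>x\<bar>") (auto simp: indicator_def)
  have "(LINT x:{-R..R}|lebesgue. G x * of_real (f x) + U x * of_real (deriv f x)) = 0"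
    using ac_integral[OF prod, of "-R" R] R(1) Rf by simp
  then have "(\<integral>x. G x * of_real (f x) + U x * of_real (deriv f x) \<partial>lebesgue) = 0"
    unfolding set_lebesgue_integral_def ind .
  then have sum0: "(\<integral>x. G x * of_real (f x) \<partial>lebesgue) + (\<integral>x. U x * of_real (deriv f x) \<partial>lebesgue) = 0"
    by (simp add: Bochner_Integration.integral_add[OF i1 i2])
  have eq: "(\<integral>x. a x * of_real (h x) \<partial>lebesgue_on I) = (\<integral>x. b x * of_real (h x) \<partial>lebesgue)"
    if "a \<in> borel_measurable (lebesgue_on I)" "AE x in lebesgue. x \<in> I \<longrightarrow> a x = b x" "continuous_on UNIV h"
      "integrable lebesgue (\<lambda>x. b x * complex_of_real (h x))" "\<And>x. x \<notin> I \<Longrightarrow> h x = 0"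
    for a b h
  proof -
    have "(\<lambda>x. complex_of_real (h x)) \<in> borel_measurable lebesgue"
      by (intro loc_int_measurable loc_int_continuous continuous_intros that)
    moreover have "(\<lambda>x. indicat_real I x *\<^sub>R a x) \<in> borel_measurable lebesgue"
      using that(1) measurable_lebesgue_on[OF I] by simp
    ultimately have m: "(\<lambda>x. (indicat_real I x *\<^sub>R a x) * complex_of_real (h x)) \<in> borel_measurable lebesgue"
      by measurable
    have "(\<integral>x. (indicat_real I x *\<^sub>R a x) * of_real (h x) \<partial>lebesgue) = (\<integral>x. b x * of_real (h x) \<partial>lebesgue)"
    proof (rule integral_cong_AE[OF m borel_measurable_integrable[OF that(4)]])
      show "AE x in lebesgue. (indicat_real I x *\<^sub>R a x) * complex_of_real (h x) = b x * complex_of_real (h x)"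
        using that(2) by eventually_elim (use that(5) in \<open>auto simp: indicator_def\<close>)
    qed
    then show ?thesis using I by (simp add: integral_lebesgue_on)
  qed
  have "(\<integral>x. u x * of_real (deriv f x) \<partial>lebesgue_on I) = (\<integral>x. U x * of_real (deriv f x) \<partial>lebesgue)"
    by (rule eq[OF um u _ i2]) (use R smooth_continuous[OF smooth_deriv[OF sm]] in auto)
  moreover have "(\<integral>x. g x * of_real (f x) \<partial>lebesgue_on I) = (\<integral>x. G x * of_real (f x) \<partial>lebesgue)"
    by (rule eq[OF gm g _ i1]) (use R smooth_continuous[OF sm] in auto)
  ultimately show "(\<integral>x. u x * of_real (deriv f x) \<partial>lebesgue_on I) = - (\<integral>x. g x * of_real (f x) \<partial>lebesgue_on I)"
    using sum0 by (simp add: eq_neg_iff_add_eq_0 add.commute)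
qed

lemma ac_has_vector_derivative:
  assumes "has_ac_deriv U g" "continuous_on UNIV g"
  shows "(U has_vector_derivative g x) (at x)"
proof -
  have "((\<lambda>t. integral {x-1..t} g) has_vector_derivative g x) (at x within {x-1..x+1})"
    by (rule integral_has_vector_derivative) (use assms(2) continuous_on_subset in auto)
  then have "((\<lambda>t. integral {x-1..t} g + U (x-1)) has_vector_derivative g x) (at x within {x-1<..<x+1})"
    by (auto intro!: derivative_eq_intros elim: has_vector_derivative_within_subset)
  then have "((\<lambda>t. integral {x-1..t} g + U (x-1)) has_vector_derivative g x) (at x)"
    by (simp add: at_within_open[of x "{x-1<..<x+1}"])
  then show ?thesis
    by (rule has_vector_derivative_transform_within_open[of _ _ _ "{x-1<..<x+1}"])
       (auto simp: ac_integral_HK[OF assms(1)])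
qed

text \<open>The primitive starting at \<open>lo\<close> returns to zero at \<open>hi\<close> because
  the mean of \<open>e\<close> is zero, so its support stays in \<open>[lo, hi]\<close>.\<close>

lemma test_fn_antideriv:
  assumes e: "smooth e" and z: "\<And>x. x \<notin> {lo..hi} \<Longrightarrow> e x = 0" and lh: "lo \<le> hi" "{lo..hi} \<subseteq> I"
    and tot: "(\<integral>x. complex_of_real (e x) \<partial>lebesgue) = 0"
  obtains f where "test_fn I f" "deriv f = e"
proof -
  let ?e = "\<lambda>x. complex_of_real (e x)"
  have ec: "continuous_on UNIV ?e" by (intro continuous_intros smooth_continuous e)
  note Z = ac_primitive[OF loc_int_continuous[OF ec]]
  define f where "f = (\<lambda>x. Re (primitive ?e x - primitive ?e lo))"
  have "((\<lambda>x. primitive ?e x - primitive ?e lo) has_vector_derivative ?e x) (at x)" for x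
    by (auto intro!: derivative_eq_intros ac_has_vector_derivative[OF Z ec])
  from bounded_linear.has_vector_derivative[OF bounded_linear_Re this]
  have D: "(f has_real_derivative e x) (at x)" for x
    by (simp add: f_def has_real_derivative_iff_has_vector_derivative)
  have z0: "(LINT t:{a..b}|lebesgue. ?e t) = 0" if "\<And>t. a < t \<Longrightarrow> t < b \<Longrightarrow> e t = 0" for a b
  proof -
    have "AE x in lebesgue. x \<noteq> a" "AE x in lebesgue. x \<noteq> b"
      by (auto intro!: AE_completion AE_lborel_singleton)
    then have "AE t in lebesgue. indicat_real {a..b} t *\<^sub>R ?e t = 0"
      by eventually_elim (use that in \<open>auto simp: indicator_def\<close>)
    then show ?thesis unfolding set_lebesgue_integral_def by (rule integral_eq_zero_AE)
  qed
  have "f x = 0" if "x \<notin> {lo..hi}" for x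
  proof (cases "x < lo")
    case True
    then show ?thesis using ac_integral[OF Z, of x lo] z0[of x lo] z by (simp add: f_def)
  next
    case False
    then have x: "hi < x" using that by auto
    have "indicat_real {lo..hi} t *\<^sub>R ?e t = ?e t" for t using z by (simp add: indicator_def)
    then have "(LINT t:{lo..hi}|lebesgue. ?e t) = 0"
      using tot by (simp add: set_lebesgue_integral_def)
    then show ?thesis
      using ac_integral[OF Z, of hi x] ac_integral[OF Z, of lo hi] z0[of hi x] z x lh by (simp add: f_def)
  qed
  then have "test_fn I f"
    using test_fnI[OF smooth_antideriv[OF D e]] lh(2) by blast
  moreover have "deriv f = e" using D by (intro ext DERIV_imp_deriv)
  ultimately show ?thesis by (rule that)
qed

text \<open>The du Bois-Reymond argument: the primitive \<open>V\<close> of \<open>g\<close> has the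
  same weak derivative as \<open>u\<close>, so the difference \<open>h\<close> is orthogonal to all
  derivatives of test functions and must be constant.\<close>

lemma weak_deriv_imp_ac:
  assumes I: "open I" "is_interval I" "I \<noteq> {}"
    and u: "u \<in> L2 (lebesgue_on I)" and g: "g \<in> L2 (lebesgue_on I)" and w: "has_weak_deriv I u g"
  obtains U where "has_ac_deriv U (\<lambda>x. indicat_real I x *\<^sub>R g x)" "AE x in lebesgue. x \<in> I \<longrightarrow> u x = U x"
proof -
  have Is: "I \<in> sets lebesgue" using I(1) by (simp add: borel_open)
  let ?g = "\<lambda>x. indicat_real I x *\<^sub>R g x"
  have lg: "loc_int ?g" and lu: "loc_int (\<lambda>x. indicat_real I x *\<^sub>R u x)"
    using L2_loc_int[OF Is] u g by auto
  define V where "V = primitive ?g"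
  note V = ac_primitive[OF lg, folded V_def]
  have gm: "g \<in> borel_measurable (lebesgue_on I)" using g by (simp add: L2_def)
  have Vm: "V \<in> borel_measurable (lebesgue_on I)"
    using ac_measurable[OF V] measurable_restrict_space1 by blast
  have wV: "has_weak_deriv I V g"
    by (rule ac_weak_deriv[OF V Is _ _ Vm gm]) auto
  define h where "h = (\<lambda>x. indicat_real I x *\<^sub>R (u x - V x))"
  have IV: "loc_int (\<lambda>x. indicat_real I x *\<^sub>R V x)"
    unfolding loc_int_def
  proof (intro allI)
    fix a b :: real
    have "set_integrable lebesgue ({a..b} \<inter> I) V"
      by (rule set_integrable_subset[OF loc_intD[OF loc_int_continuous[OF ac_continuous[OF V]]]])
         (use Is in auto)
    then show "set_integrable lebesgue {a..b} (\<lambda>x. indicat_real I x *\<^sub>R V x)"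
      by (simp add: set_integrable_def indicator_inter_arith)
  qed
  have lh: "loc_int h"
    using loc_int_diff[OF lu IV] by (simp add: h_def scaleR_diff_right)
  have h_orth: "(\<integral>x. h x * of_real (deriv f x) \<partial>lebesgue) = 0" if t: "test_fn I f" for f
  proof -
    obtain R where R: "R > 0" "\<And>x. x \<notin> I \<or> \<bar>x\<bar> \<ge> R \<Longrightarrow> f x = 0 \<and> deriv f x = 0"
      using test_fn_support[OF t] by metis
    note dc = smooth_continuous[OF smooth_deriv[OF smooth_test_fn[OF t]]]
    have "(\<integral>x. h x * of_real (deriv f x) \<partial>lebesgue)
      = (\<integral>x. (indicat_real I x *\<^sub>R u x) * of_real (deriv f x) - (indicat_real I x *\<^sub>R V x) * of_real (deriv f x) \<partial>lebesgue)"
      by (simp add: h_def algebra_simps)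
    also have "\<dots> = (\<integral>x. (indicat_real I x *\<^sub>R u x) * of_real (deriv f x) \<partial>lebesgue)
      - (\<integral>x. (indicat_real I x *\<^sub>R V x) * of_real (deriv f x) \<partial>lebesgue)"
      by (intro Bochner_Integration.integral_diff loc_int_smooth_mult[OF lu dc, of "-R" R] loc_int_smooth_mult[OF IV dc, of "-R" R])
         (use R in auto)
    also have "\<dots> = (\<integral>x. u x * of_real (deriv f x) \<partial>lebesgue_on I) - (\<integral>x. V x * of_real (deriv f x) \<partial>lebesgue_on I)"
      using Is by (simp add: integral_lebesgue_on)
    also have "\<dots> = 0" using w wV t by (simp add: has_weak_deriv_def)
    finally show ?thesis .
  qed
  obtain x0 r where r: "r > 0" "ball x0 r \<subseteq> I" "x0 \<in> I"
    using I openE by (metis ex_in_conv)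
  have x0r: "{x0..x0+r/2} \<subseteq> I"
  proof
    fix x assume "x \<in> {x0..x0+r/2}"
    then have "x \<in> ball x0 r" using r(1) by (auto simp: dist_real_def)
    then show "x \<in> I" using r(2) by blast
  qed
  \<comment> \<open>One fixed bump inside \<open>I\<close> with nonzero mass \<open>m\<close>; it
    serves to correct the mean of every other bump.\<close>
  define b where "b = bump 1 x0 (x0+r/2)"
  have one: "loc_int (\<lambda>_. 1)" by (intro loc_int_continuous continuous_intros)
  have bi: "integrable lebesgue (\<lambda>x. complex_of_real (bump k c d x))" if "k > 0" for k c d
  proof -
    have "integrable lebesgue (\<lambda>x. 1 * complex_of_real (bump k c d x))"
      by (rule loc_int_smooth_mult[OF one smooth_continuous[OF smooth_bump], of c d], rule bump_outside[OF that]) auto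
    then show ?thesis by simp
  qed
  have bir: "integrable lebesgue b"
    using bi[of 1 x0 "x0+r/2"] by (simp add: b_def complex_of_real_integrable_eq)
  define m where "m = (\<integral>x. b x \<partial>lebesgue)"
  have "m \<noteq> 0"
  proof
    assume "m = 0"
    then have "AE x in lebesgue. b x = 0"
      using integral_nonneg_eq_0_iff_AE[OF bir] bump_nonneg by (simp add: m_def b_def)
    then have "AE x in lebesgue. x \<notin> {x0<..<x0+r/2}"
      by eventually_elim (use bump_pos[of 1 _ x0 "x0+r/2"] in \<open>fastforce simp: b_def\<close>)
    then have "{x0<..<x0+r/2} \<in> null_sets lebesgue"
      by (subst AE_iff_null_sets) auto
    then show False using r(1) by (simp add: null_sets_def)
  qed
  \<comment> \<open>The constant that \<open>h\<close> must equal, read off by averaging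
    \<open>h\<close> against \<open>b\<close>.\<close>
  define K where "K = (\<integral>x. h x * of_real (b x) \<partial>lebesgue) / of_real m"
  have hbi: "integrable lebesgue (\<lambda>x. h x * complex_of_real (bump k c d x))" if "k > 0" for k c d
    by (rule loc_int_smooth_mult[OF lh smooth_continuous[OF smooth_bump], of c d], rule bump_outside[OF that]) auto
  have "AE x in lebesgue. x \<in> I \<longrightarrow> h x - K = 0"
  proof (rule fundamental_lemma[OF loc_int_diff[OF lh] I(1,2)])
    show "loc_int (\<lambda>_. K)" by (intro loc_int_continuous continuous_intros)
    fix k c d :: real assume k: "k > 0" "c < d" "{c..d} \<subseteq> I"
    define M where "M = (\<integral>x. bump k c d x \<partial>lebesgue)"
    \<comment> \<open>Has mean zero by construction, hence is the derivative of a test function.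
      Orthogonality to \<open>h\<close> then compares the pairing of \<open>h\<close> with an
      arbitrary bump to its pairing with \<open>b\<close>.\<close>
    define e where "e = (\<lambda>x. bump k c d x + (- (M / m)) * b x)"
    have bkr: "integrable lebesgue (bump k c d)"
      using bi[OF k(1)] by (simp add: complex_of_real_integrable_eq)
    have e: "smooth e" unfolding e_def b_def by (intro smooth_add smooth_mult smooth_const smooth_bump)
    have e0: "(\<integral>x. complex_of_real (e x) \<partial>lebesgue) = 0"
    proof -
      have "(\<integral>x. e x \<partial>lebesgue) = M - (M / m) * m"
        unfolding e_def M_def m_def using bkr bir by simp
      then show ?thesis using \<open>m \<noteq> 0\<close> by simp
    qed
    define lo hi where "lo = min c x0" and "hi = max d (x0+r/2)"
    have lohi: "lo \<le> hi" "{lo..hi} \<subseteq> I"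
    proof -
      show "lo \<le> hi" using k r by (auto simp: lo_def hi_def)
      have "lo \<in> I" "hi \<in> I" using k x0r r by (auto simp: lo_def hi_def min_def max_def subset_iff)
      then show "{lo..hi} \<subseteq> I" using mem_is_interval_1_I[OF I(2), of lo hi] by (simp add: subset_iff)
    qed
    have ez: "e x = 0" if "x \<notin> {lo..hi}" for x
    proof -
      have "x \<notin> {c<..<d}" "x \<notin> {x0<..<x0+r/2}" using that by (auto simp: lo_def hi_def)
      then show ?thesis by (simp add: e_def b_def bump_outside k(1))
    qed
    obtain f where f: "test_fn I f" "deriv f = e"
      using test_fn_antideriv[OF e ez lohi e0] by blast
    have "(\<integral>x. h x * of_real (bump k c d x) - of_real (M / m) * (h x * of_real (b x)) \<partial>lebesgue) = 0"
      using h_orth[OF f(1)] unfolding f(2) by (simp add: e_def algebra_simps)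
    then have "(\<integral>x. h x * of_real (bump k c d x) \<partial>lebesgue) = of_real (M / m) * (\<integral>x. h x * of_real (b x) \<partial>lebesgue)"
      using hbi[OF k(1), of c d] hbi[of 1 x0 "x0+r/2"]
      by (subst (asm) Bochner_Integration.integral_diff) (auto simp: b_def)
    also have "\<dots> = K * of_real M" by (simp add: K_def)
    finally have 1: "(\<integral>x. h x * of_real (bump k c d x) \<partial>lebesgue) = K * of_real M" .
    have "(\<integral>x. (h x - K) * of_real (bump k c d x) \<partial>lebesgue) =
      (\<integral>x. h x * of_real (bump k c d x) - K * of_real (bump k c d x) \<partial>lebesgue)"
      by (simp add: algebra_simps)
    also have "\<dots> = (\<integral>x. h x * of_real (bump k c d x) \<partial>lebesgue) - K * (\<integral>x. of_real (bump k c d x) \<partial>lebesgue)"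
      using hbi[OF k(1), of c d] bi[OF k(1), of c d] by (subst Bochner_Integration.integral_diff) auto
    also have "\<dots> = 0" by (simp add: 1 M_def)
    finally show "(\<integral>x. (h x - K) * of_real (bump k c d x) \<partial>lebesgue) = 0" .
  qed
  then have "AE x in lebesgue. x \<in> I \<longrightarrow> u x = V x + K"
    by eventually_elim (auto simp: h_def algebra_simps)
  moreover have "has_ac_deriv (\<lambda>x. V x + K) ?g"
    using ac_add[OF V ac_const[of K]] by simp
  ultimately show ?thesis by (rule that[rotated])
qed

text \<open>Two weak derivatives pair equally with every bump. As \<open>weak_deriv\<close> is an
  arbitrary choice, this is what determines its values almost everywhere.\<close>

lemma weak_deriv_unique:
  assumes I: "open I" "is_interval I"
    and g: "g \<in> L2 (lebesgue_on I)" "h \<in> L2 (lebesgue_on I)"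
    and w: "has_weak_deriv I u g" "has_weak_deriv I u h"
  shows "AE x in lebesgue. x \<in> I \<longrightarrow> g x = h x"
proof -
  have Is: "I \<in> sets lebesgue" using I(1) by (simp add: borel_open)
  let ?v = "\<lambda>f x. indicat_real I x *\<^sub>R f x"
  have lg: "loc_int (?v g)" "loc_int (?v h)" using L2_loc_int[OF Is] g by auto
  have "AE x in lebesgue. x \<in> I \<longrightarrow> ?v g x - ?v h x = 0"
  proof (rule fundamental_lemma[OF loc_int_diff[OF lg] I])
    fix k c d :: real assume k: "k > 0" "c < d" "{c..d} \<subseteq> I"
    have bi: "integrable lebesgue (\<lambda>x. v x * complex_of_real (bump k c d x))" if "loc_int v" for v
      by (rule loc_int_smooth_mult[OF that smooth_continuous[OF smooth_bump], of c d], rule bump_outside[OF k(1)]) auto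
    have "(\<integral>x. (?v g x - ?v h x) * of_real (bump k c d x) \<partial>lebesgue)
       = (\<integral>x. ?v g x * of_real (bump k c d x) - ?v h x * of_real (bump k c d x) \<partial>lebesgue)"
      by (simp add: algebra_simps)
    also have "\<dots> = (\<integral>x. ?v g x * of_real (bump k c d x) \<partial>lebesgue) - (\<integral>x. ?v h x * of_real (bump k c d x) \<partial>lebesgue)"
      by (intro Bochner_Integration.integral_diff bi lg)
    also have "\<dots> = (\<integral>x. g x * of_real (bump k c d x) \<partial>lebesgue_on I) - (\<integral>x. h x * of_real (bump k c d x) \<partial>lebesgue_on I)"
      using Is by (simp add: integral_lebesgue_on)
    also have "\<dots> = 0"
    proof -
      have "- (\<integral>x. g x * of_real (bump k c d x) \<partial>lebesgue_on I) = - (\<integral>x. h x * of_real (bump k c d x) \<partial>lebesgue_on I)"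
        using w test_fn_bump[OF k(1,3)] unfolding has_weak_deriv_def by metis
      then show ?thesis by simp
    qed
    finally show "(\<integral>x. (?v g x - ?v h x) * of_real (bump k c d x) \<partial>lebesgue) = 0" .
  qed
  then show ?thesis by eventually_elim auto
qed

lemma weak_deriv_spec:
  assumes "u \<in> H1 I" shows "weak_deriv I u \<in> L2 (lebesgue_on I)" "has_weak_deriv I u (weak_deriv I u)"
proof -
  have "\<exists>g. g \<in> L2 (lebesgue_on I) \<and> has_weak_deriv I u g" using assms by (auto simp: H1_def)
  from someI_ex[OF this] show "weak_deriv I u \<in> L2 (lebesgue_on I)" "has_weak_deriv I u (weak_deriv I u)"
    by (simp_all add: weak_deriv_def)
qed

text \<open>Together with \<open>ac_imp_H1\<close> the bridge between the Sobolev spaces and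
  absolutely continuous functions; later arguments integrate by parts on the latter side.\<close>

lemma H1_imp_ac:
  assumes "open I" "is_interval I" "I \<noteq> {}" "u \<in> H1 I"
  obtains U where "has_ac_deriv U (\<lambda>x. indicat_real I x *\<^sub>R weak_deriv I u x)"
    "AE x in lebesgue. x \<in> I \<longrightarrow> u x = U x"
  using weak_deriv_imp_ac[OF assms(1-3) _ weak_deriv_spec[OF assms(4)]] assms(4)
  by (auto simp: H1_def)

lemma ac_imp_H1:
  assumes I: "open I" "is_interval I" and U: "has_ac_deriv U G"
    and u: "u \<in> L2 (lebesgue_on I)" "AE x in lebesgue. x \<in> I \<longrightarrow> u x = U x"
    and G: "G \<in> L2 (lebesgue_on I)"
  shows "u \<in> H1 I" "AE x in lebesgue. x \<in> I \<longrightarrow> weak_deriv I u x = G x"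
proof -
  have Is: "I \<in> sets lebesgue" using I(1) by (simp add: borel_open)
  have w: "has_weak_deriv I u G"
    by (rule ac_weak_deriv[OF U Is u(2)]) (use u G in \<open>auto simp: L2_def\<close>)
  with u G show H: "u \<in> H1 I" by (auto simp: H1_def)
  show "AE x in lebesgue. x \<in> I \<longrightarrow> weak_deriv I u x = G x"
    by (rule weak_deriv_unique[OF I weak_deriv_spec(1)[OF H] G weak_deriv_spec(2)[OF H] w])
qed

section \<open>The first order system\<close>

text \<open>The solutions of the system are power series in \<open>\<lambda>\<close>; these iterated integrals, with alternating weights, are
  their coefficients.\<close>

primrec iter_int :: "(real \<Rightarrow> real) \<Rightarrow> (real \<Rightarrow> real) \<Rightarrow> nat \<Rightarrow> real \<Rightarrow> complex" where
  "iter_int g h 0 = (\<lambda>_. 1)"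
| "iter_int g h (Suc k) = primitive (\<lambda>t. of_real (g t) * iter_int h g k t)"

text \<open>The bound holds at every point rather than almost everywhere, so that the estimates for
  integrands and series below are pointwise.\<close>

definition bounded_weight :: "real \<Rightarrow> (real \<Rightarrow> real) \<Rightarrow> bool" where
  "bounded_weight C g \<longleftrightarrow> g \<in> borel_measurable lebesgue \<and> (\<forall>x. \<bar>g x\<bar> \<le> C)"

lemma bounded_weight_const: "\<bar>c\<bar> \<le> C \<Longrightarrow> bounded_weight C (\<lambda>_. c)"
  by (simp add: bounded_weight_def)

lemma bounded_weight_mono: "bounded_weight C g \<Longrightarrow> C \<le> D \<Longrightarrow> bounded_weight D g"
  unfolding bounded_weight_def by (meson order_trans)

lemma bounded_weight_nonneg: "bounded_weight C g \<Longrightarrow> 0 \<le> C"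
  unfolding bounded_weight_def by (meson abs_ge_zero order_trans)

lemma loc_int_weight:
  assumes "bounded_weight C g" "continuous_on UNIV f"
  shows "loc_int (\<lambda>x. of_real (g x) * f x)"
proof (rule loc_int_mult_bounded)
  show "(\<lambda>x. complex_of_real (g x)) \<in> borel_measurable lebesgue"
    using assms by (auto simp: bounded_weight_def)
  show "bounded ((\<lambda>x. complex_of_real (g x)) ` {a..b})" for a b
    using assms by (auto simp: bounded_weight_def intro!: boundedI)
qed (rule loc_int_continuous[OF assms(2)])

lemma iter_int_continuous:
  assumes "bounded_weight C g" "bounded_weight C h" shows "continuous_on UNIV (iter_int g h k)"
  using assms
proof (induction k arbitrary: g h)
  case (Suc k)
  then show ?case
    by (auto intro!: ac_continuous[OF ac_primitive] loc_int_weight)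
qed simp

lemma iter_int_ac:
  assumes "bounded_weight C g" "bounded_weight C h"
  shows "has_ac_deriv (iter_int g h (Suc k)) (\<lambda>t. of_real (g t) * iter_int h g k t)"
  unfolding iter_int.simps
  by (rule ac_primitive[OF loc_int_weight[OF assms(1) iter_int_continuous[OF assms(2,1)]]])

text \<open>The induction step for the factorial decay of \<open>iter_int\<close>: integrating the
  bound from 0 raises \<open>k\<close> by one. The two signs of \<open>x\<close> are treated
  separately.\<close>

lemma norm_primitive_le:
  assumes f: "loc_int f" and b: "\<And>t. norm (f t) \<le> B * \<bar>t\<bar> ^ k / fact k"
  shows "norm (primitive f x) \<le> B * \<bar>x\<bar> ^ Suc k / fact (Suc k)"
proof (cases "0 \<le> x")
  case True
  have D: "((\<lambda>t. B * t ^ Suc k / fact (Suc k)) has_vector_derivative B * t ^ k / fact k) (at t within S)" for t S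
  proof -
    have "((\<lambda>t. B * t ^ Suc k / fact (Suc k)) has_real_derivative B * (real (Suc k) * t ^ k) / fact (Suc k)) (at t within S)"
      by (rule derivative_eq_intros refl | simp)+
    then show ?thesis
      by (simp add: has_real_derivative_iff_has_vector_derivative[symmetric] field_simps del: of_nat_Suc)
  qed
  have hi: "((\<lambda>t. B * t ^ k / fact k) has_integral B * x ^ Suc k / fact (Suc k) - B * 0 ^ Suc k / fact (Suc k)) {0..x}"
    by (rule fundamental_theorem_of_calculus[OF True D])
  have "norm (integral {0..x} f) \<le> integral {0..x} (\<lambda>t. B * t ^ k / fact k)"
  proof (rule integral_norm_bound_integral)
    show "norm (f t) \<le> B * t ^ k / fact k" if "t \<in> {0..x}" for t
      using b[of t] that by simp
  qed (use loc_int_integrable_on[OF f] hi in blast)+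
  moreover have "integral {x..0} f = 0" using True by (metis integral_null content_real_eq_0 interval_cbox)
  ultimately show ?thesis
    using integral_unique[OF hi] True by (simp add: primitive_def)
next
  case False
  have D: "((\<lambda>t. - (B * (-t) ^ Suc k / fact (Suc k))) has_vector_derivative B * (-t) ^ k / fact k) (at t within S)" for t S
  proof -
    have "((\<lambda>t. - (B * (-t) ^ Suc k / fact (Suc k))) has_real_derivative - (B * (- (real (Suc k) * (-t) ^ k)) / fact (Suc k))) (at t within S)"
      by (rule derivative_eq_intros refl | simp)+
    then show ?thesis
      by (simp add: has_real_derivative_iff_has_vector_derivative[symmetric] field_simps del: of_nat_Suc)
  qed
  have hi: "((\<lambda>t. B * (-t) ^ k / fact k) has_integral (- (B * (-0) ^ Suc k / fact (Suc k))) - (- (B * (-x) ^ Suc k / fact (Suc k)))) {x..0}"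
    by (rule fundamental_theorem_of_calculus[OF _ D]) (use False in simp)
  have "norm (integral {x..0} f) \<le> integral {x..0} (\<lambda>t. B * (-t) ^ k / fact k)"
  proof (rule integral_norm_bound_integral)
    show "norm (f t) \<le> B * (-t) ^ k / fact k" if "t \<in> {x..0}" for t
      using b[of t] that by simp
  qed (use loc_int_integrable_on[OF f] hi in blast)+
  moreover have "integral {0..x} f = 0" using False by (metis integral_null content_real_eq_0 interval_cbox linear)
  ultimately show ?thesis
    using integral_unique[OF hi] False by (simp add: primitive_def)
qed

lemma iter_int_bound:
  assumes "bounded_weight C g" "bounded_weight C h"
  shows "norm (iter_int g h k x) \<le> C ^ k * \<bar>x\<bar> ^ k / fact k"
  using assms
proof (induction k arbitrary: g h x)
  case (Suc k)
  have C: "0 \<le> C" by (rule bounded_weight_nonneg[OF Suc.prems(1)])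
  show ?case unfolding iter_int.simps
  proof (rule norm_primitive_le)
    show "loc_int (\<lambda>t. of_real (g t) * iter_int h g k t)"
      by (rule loc_int_weight[OF Suc.prems(1) iter_int_continuous[OF Suc.prems(2,1)]])
    show "norm (of_real (g t) * iter_int h g k t) \<le> C ^ Suc k * \<bar>t\<bar> ^ k / fact k" for t
    proof -
      have "norm (of_real (g t) * iter_int h g k t) = \<bar>g t\<bar> * norm (iter_int h g k t)"
        by (simp add: norm_mult)
      also have "\<dots> \<le> C * (C ^ k * \<bar>t\<bar> ^ k / fact k)"
        using Suc C by (intro mult_mono) (auto simp: bounded_weight_def)
      finally show ?thesis by simp
    qed
  qed
qed simp

lemma primitive_cnj: "primitive (\<lambda>x. cnj (f x)) y = cnj (primitive f y)"
  by (simp add: primitive_def integral_cnj)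

lemma iter_int_cnj: "cnj (iter_int g h k x) = iter_int g h k x"
proof (induction k arbitrary: g h x)
  case (Suc k)
  show ?case by (simp add: Suc flip: primitive_cnj)
qed simp

lemma iter_int_0: "iter_int g h k 0 = (if k = 0 then 1 else 0)"
  by (cases k) auto

text \<open>Termwise integration, justified on each bounded interval by one summable majorant for
  the functions and their derivatives.\<close>

lemma ac_suminf:
  assumes ac: "\<And>n. has_ac_deriv (f n) (g n)"
    and b: "\<And>R. R > 0 \<Longrightarrow> \<exists>B. summable B \<and> (\<forall>n x. \<bar>x\<bar> \<le> R \<longrightarrow> norm (f n x) \<le> B n \<and> norm (g n x) \<le> B n)"
  shows "has_ac_deriv (\<lambda>x. \<Sum>n. f n x) (\<lambda>x. \<Sum>n. g n x)"
proof -
  have *: "set_integrable lebesgue {a..b} (\<lambda>x. \<Sum>n. g n x) \<and>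
     (a \<le> b \<longrightarrow> (LINT x:{a..b}|lebesgue. (\<Sum>n. g n x)) = (\<Sum>n. f n b) - (\<Sum>n. f n a))" for a b :: real
  proof -
    have "0 < \<bar>a\<bar> + \<bar>b\<bar> + 1" by simp
    from b[OF this] obtain B where B: "summable B"
      "\<forall>n x. \<bar>x\<bar> \<le> \<bar>a\<bar> + \<bar>b\<bar> + 1 \<longrightarrow> norm (f n x) \<le> B n \<and> norm (g n x) \<le> B n"
      by blast
    let ?G = "\<lambda>n x. indicat_real {a..b} x *\<^sub>R g n x"
    have Gi: "integrable lebesgue (?G n)" for n
      using ac_loc_int[OF ac, of n] by (simp add: loc_int_def set_integrable_def)
    have Gb: "norm (?G n x) \<le> indicat_real {a..b} x * B n" for n x
      using B(2)[rule_format, of x n] by (auto simp: indicator_def)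
    have sG: "summable (\<lambda>n. norm (?G n x))" for x
      by (rule summable_comparison_test'[OF summable_mult[OF B(1)], of 0]) (use Gb in auto)
    have ii: "integrable lebesgue (\<lambda>x. indicat_real {a..b} x * B n)" for n
      by (intro integrable_mult_left integrable_real_indicator) (auto simp: emeasure_lborel_Icc_eq)
    have sI: "summable (\<lambda>n. \<integral>x. norm (?G n x) \<partial>lebesgue)"
    proof (rule summable_comparison_test'[of "\<lambda>n. measure lebesgue {a..b} * B n" 0])
      show "summable (\<lambda>n. measure lebesgue {a..b} * B n)" by (rule summable_mult[OF B(1)])
      show "norm (\<integral>x. norm (?G n x) \<partial>lebesgue) \<le> measure lebesgue {a..b} * B n" for n
      proof -
        have "(\<integral>x. norm (?G n x) \<partial>lebesgue) \<le> (\<integral>x. indicat_real {a..b} x * B n \<partial>lebesgue)"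
          by (rule integral_mono[OF integrable_norm[OF Gi] ii]) (rule Gb)
        also have "\<dots> = measure lebesgue {a..b} * B n" by simp
        finally show ?thesis by simp
      qed
    qed
    have eq: "(\<Sum>n. ?G n x) = indicat_real {a..b} x *\<^sub>R (\<Sum>n. g n x)" for x
      by (cases "x \<in> {a..b}") auto
    have 1: "integrable lebesgue (\<lambda>x. \<Sum>n. ?G n x)"
      by (rule integrable_suminf[OF Gi _ sI]) (use sG in auto)
    have 2: "(\<lambda>n. \<integral>x. ?G n x \<partial>lebesgue) sums (\<integral>x. (\<Sum>n. ?G n x) \<partial>lebesgue)"
      by (rule sums_integral[OF Gi _ sI]) (use sG in auto)
    show ?thesis
    proof (intro conjI impI)
      show "set_integrable lebesgue {a..b} (\<lambda>x. \<Sum>n. g n x)"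
        using 1 unfolding eq by (simp add: set_integrable_def)
      assume "a \<le> b"
      then have "(\<integral>x. ?G n x \<partial>lebesgue) = f n b - f n a" for n
        using ac_integral[OF ac, of a b n] by (simp add: set_lebesgue_integral_def)
      with 2 have "(\<lambda>n. f n b - f n a) sums (LINT x:{a..b}|lebesgue. (\<Sum>n. g n x))"
        unfolding eq by (simp add: set_lebesgue_integral_def)
      moreover have "summable (\<lambda>n. f n b)" "summable (\<lambda>n. f n a)"
        using B(2) by (auto intro!: summable_comparison_test'[OF B(1), of 0])
      then have "(\<lambda>n. f n b - f n a) sums ((\<Sum>n. f n b) - (\<Sum>n. f n a))"
        by (intro sums_diff summable_sums)
      ultimately show "(LINT x:{a..b}|lebesgue. (\<Sum>n. g n x)) = (\<Sum>n. f n b) - (\<Sum>n. f n a)"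
        by (rule sums_unique2)
    qed
  qed
  show ?thesis unfolding has_ac_deriv_def loc_int_def using * by metis
qed

text \<open>A weighted hyperbolic cosine: for \<open>g = h = 1\<close> the iterated integrals are
  \<open>x ^ k / fact k\<close>, so this is \<open>cosh (sqrt \<mu> * x)\<close>, and
  \<open>odd_series\<close> is \<open>sinh (sqrt \<mu> * x) / sqrt \<mu>\<close>.\<close>

definition even_series :: "(real \<Rightarrow> real) \<Rightarrow> (real \<Rightarrow> real) \<Rightarrow> complex \<Rightarrow> real \<Rightarrow> complex" where
  "even_series g h \<mu> x = (\<Sum>n. \<mu> ^ n * iter_int g h (2 * n) x)"

definition odd_series :: "(real \<Rightarrow> real) \<Rightarrow> (real \<Rightarrow> real) \<Rightarrow> complex \<Rightarrow> real \<Rightarrow> complex" where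
  "odd_series g h \<mu> x = (\<Sum>n. \<mu> ^ n * iter_int g h (2 * n + 1) x)"

lemma term_bound:
  assumes "bounded_weight C g" "bounded_weight C h" "\<bar>x\<bar> \<le> R"
  shows "norm (\<mu> ^ n * iter_int g h (2 * n) x) \<le> (norm \<mu> * (C * R)\<^sup>2) ^ n / fact n"
    and "norm (\<mu> ^ n * iter_int g h (2 * n + 1) x) \<le> C * R * ((norm \<mu> * (C * R)\<^sup>2) ^ n / fact n)"
proof -
  have C: "0 \<le> C" by (rule bounded_weight_nonneg[OF assms(1)])
  have R: "0 \<le> R" using assms(3) by simp
  \<comment> \<open>Used with \<open>m = n\<close> while \<open>k\<close> is \<open>2 * n\<close> or
    \<open>2 * n + 1\<close>: this gives away decay but turns the majorant into an exponential
    series.\<close>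
  have b: "norm (iter_int g h k x) \<le> (C * R) ^ k / fact m" if "m \<le> k" for k m
  proof -
    have "norm (iter_int g h k x) \<le> C ^ k * \<bar>x\<bar> ^ k / fact k" by (rule iter_int_bound[OF assms(1,2)])
    also have "\<dots> \<le> C ^ k * R ^ k / fact m"
      using C R assms(3) that
      by (intro frac_le mult_mono power_mono fact_mono) auto
    finally show ?thesis by (simp add: power_mult_distrib)
  qed
  have "norm (\<mu> ^ n * iter_int g h (2 * n) x) \<le> norm \<mu> ^ n * ((C * R) ^ (2 * n) / fact n)"
    unfolding norm_mult norm_power by (intro mult_left_mono b) auto
  then show "norm (\<mu> ^ n * iter_int g h (2 * n) x) \<le> (norm \<mu> * (C * R)\<^sup>2) ^ n / fact n"
    by (simp add: power_mult_distrib power_mult)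
  have "norm (\<mu> ^ n * iter_int g h (2 * n + 1) x) \<le> norm \<mu> ^ n * ((C * R) ^ (2 * n + 1) / fact n)"
    unfolding norm_mult norm_power by (intro mult_left_mono b) auto
  moreover have "norm \<mu> ^ n * ((C * R) ^ (2 * n + 1) / fact n) = C * R * ((norm \<mu> * (C * R)\<^sup>2) ^ n / fact n)"
    unfolding power_mult_distrib[of "norm \<mu>"] power_add power_mult by simp
  ultimately show "norm (\<mu> ^ n * iter_int g h (2 * n + 1) x) \<le> C * R * ((norm \<mu> * (C * R)\<^sup>2) ^ n / fact n)"
    by (rule ord_le_eq_trans)
qed

lemma summable_exp_real: "summable (\<lambda>n. (y::real) ^ n / fact n)"
  using summable_exp[of y] by (simp add: field_simps)

lemma summable_series:
  assumes "bounded_weight C g" "bounded_weight C h"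
  shows "summable (\<lambda>n. \<mu> ^ n * iter_int g h (2 * n) x)" "summable (\<lambda>n. \<mu> ^ n * iter_int g h (2 * n + 1) x)"
proof -
  show "summable (\<lambda>n. \<mu> ^ n * iter_int g h (2 * n) x)"
    by (rule summable_comparison_test'[OF summable_exp_real term_bound(1)[OF assms order_refl]])
  show "summable (\<lambda>n. \<mu> ^ n * iter_int g h (2 * n + 1) x)"
    by (rule summable_comparison_test'[OF summable_mult[OF summable_exp_real] term_bound(2)[OF assms order_refl]])
qed

lemma odd_series_ac:
  assumes g: "bounded_weight C g" and h: "bounded_weight C h"
  shows "has_ac_deriv (odd_series g h \<mu>) (\<lambda>x. of_real (g x) * even_series h g \<mu> x)"
proof -
  have C: "0 \<le> C" by (rule bounded_weight_nonneg[OF g])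
  have "has_ac_deriv (\<lambda>x. \<Sum>n. \<mu> ^ n * iter_int g h (2 * n + 1) x)
     (\<lambda>x. \<Sum>n. \<mu> ^ n * (of_real (g x) * iter_int h g (2 * n) x))"
  proof (rule ac_suminf)
    show "has_ac_deriv (\<lambda>x. \<mu> ^ n * iter_int g h (2 * n + 1) x) (\<lambda>x. \<mu> ^ n * (of_real (g x) * iter_int h g (2 * n) x))" for n
      using ac_cmult[OF iter_int_ac[OF g h, of "2 * n"]] by simp
    fix R :: real assume R: "R > 0"
    let ?B = "\<lambda>n. (C * R + C) * ((norm \<mu> * (C * R)\<^sup>2) ^ n / fact n)"
    have "norm (\<mu> ^ n * iter_int g h (2 * n + 1) x) \<le> ?B n \<and>
          norm (\<mu> ^ n * (of_real (g x) * iter_int h g (2 * n) x)) \<le> ?B n" if "\<bar>x\<bar> \<le> R" for n x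
    proof
      have nn: "0 \<le> (norm \<mu> * (C * R)\<^sup>2) ^ n / fact n" by simp
      have "norm (\<mu> ^ n * iter_int g h (2 * n + 1) x) \<le> C * R * ((norm \<mu> * (C * R)\<^sup>2) ^ n / fact n)"
        by (rule term_bound(2)[OF g h that])
      also have "\<dots> \<le> ?B n" using C nn by (intro mult_right_mono) auto
      finally show "norm (\<mu> ^ n * iter_int g h (2 * n + 1) x) \<le> ?B n" .
      have "norm (\<mu> ^ n * (of_real (g x) * iter_int h g (2 * n) x)) = \<bar>g x\<bar> * norm (\<mu> ^ n * iter_int h g (2 * n) x)"
        by (simp add: norm_mult)
      also have "\<dots> \<le> C * ((norm \<mu> * (C * R)\<^sup>2) ^ n / fact n)"
        using g C by (intro mult_mono term_bound(1)[OF h g that]) (auto simp: bounded_weight_def)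
      also have "\<dots> \<le> ?B n" using C R nn by (intro mult_right_mono) auto
      finally show "norm (\<mu> ^ n * (of_real (g x) * iter_int h g (2 * n) x)) \<le> ?B n" .
    qed
    then show "\<exists>B. summable B \<and> (\<forall>n x. \<bar>x\<bar> \<le> R \<longrightarrow> norm (\<mu> ^ n * iter_int g h (2 * n + 1) x) \<le> B n \<and>
        norm (\<mu> ^ n * (of_real (g x) * iter_int h g (2 * n) x)) \<le> B n)"
      by (intro exI[of _ ?B] conjI summable_mult summable_exp_real) blast
  qed
  then show ?thesis
  proof (rule ac_cong)
    fix x
    show "(\<Sum>n. \<mu> ^ n * iter_int g h (2 * n + 1) x) = odd_series g h \<mu> x" by (simp add: odd_series_def)
    have "(\<Sum>n. of_real (g x) * (\<mu> ^ n * iter_int h g (2 * n) x)) = of_real (g x) * even_series h g \<mu> x"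
      unfolding even_series_def by (rule suminf_mult[OF summable_series(1)[OF h g]])
    then show "(\<Sum>n. \<mu> ^ n * (of_real (g x) * iter_int h g (2 * n) x)) = of_real (g x) * even_series h g \<mu> x"
      by (simp add: mult_ac)
  qed
qed

text \<open>The constant term is split off since its derivative is 0, and the extracted \<mu> is the
  factor that appears in \<open>even_series_ac\<close>. Dividing by \<mu> proves summability, hence
  the separate case \<mu> = 0.\<close>

lemma even_series_split:
  assumes "bounded_weight C g" "bounded_weight C h"
  shows "even_series g h \<mu> x = 1 + \<mu> * (\<Sum>n. \<mu> ^ n * iter_int g h (2 * n + 2) x)"
    and "summable (\<lambda>n. \<mu> ^ n * iter_int g h (2 * n + 2) x)"
proof -
  show s: "summable (\<lambda>n. \<mu> ^ n * iter_int g h (2 * n + 2) x)" for \<mu>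
  proof (cases "\<mu> = 0")
    case True
    show ?thesis by (rule summable_finite[of "{0}"]) (use True in auto)
  next
    case False
    have "summable (\<lambda>n. \<mu> ^ Suc n * iter_int g h (2 * Suc n) x)"
      using summable_series(1)[OF assms, of \<mu> x] by (subst summable_Suc_iff)
    then have "summable (\<lambda>n. (1 / \<mu>) * (\<mu> ^ Suc n * iter_int g h (2 * Suc n) x))" by (rule summable_mult)
    then show ?thesis using False by simp
  qed
  show "even_series g h \<mu> x = 1 + \<mu> * (\<Sum>n. \<mu> ^ n * iter_int g h (2 * n + 2) x)"
    unfolding even_series_def suminf_mult[OF s, symmetric]
    using suminf_split_head[OF summable_series(1)[OF assms, of \<mu> x]] by (simp add: mult_ac)
qed

lemma even_series_ac:
  assumes g: "bounded_weight C g" and h: "bounded_weight C h"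
  shows "has_ac_deriv (even_series g h \<mu>) (\<lambda>x. of_real (g x) * (\<mu> * odd_series h g \<mu> x))"
proof -
  have C: "0 \<le> C" by (rule bounded_weight_nonneg[OF g])
  have b2: "norm (\<mu> ^ n * iter_int g h (2 * n + 2) x) \<le> (C * R)\<^sup>2 * ((norm \<mu> * (C * R)\<^sup>2) ^ n / fact n)"
    if x: "\<bar>x\<bar> \<le> R" for n x R
  proof -
    have R: "0 \<le> R" using x by simp
    have "norm (iter_int g h (2 * n + 2) x) \<le> C ^ (2 * n + 2) * \<bar>x\<bar> ^ (2 * n + 2) / fact (2 * n + 2)"
      by (rule iter_int_bound[OF g h])
    also have "\<dots> \<le> C ^ (2 * n + 2) * R ^ (2 * n + 2) / fact n"
      using C R x by (intro frac_le mult_mono power_mono fact_mono) auto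
    finally have "norm (\<mu> ^ n) * norm (iter_int g h (2 * n + 2) x) \<le> norm (\<mu> ^ n) * (C ^ (2 * n + 2) * R ^ (2 * n + 2) / fact n)"
      by (rule mult_left_mono) simp
    also have "\<dots> = (C * R)\<^sup>2 * ((norm \<mu> * (C * R)\<^sup>2) ^ n / fact n)"
      by (simp add: norm_power power_add power_mult power_mult_distrib power2_eq_square mult_ac)
    finally show ?thesis by (simp only: norm_mult)
  qed
  have "has_ac_deriv (\<lambda>x. \<Sum>n. \<mu> ^ n * iter_int g h (2 * n + 2) x)
     (\<lambda>x. \<Sum>n. \<mu> ^ n * (of_real (g x) * iter_int h g (2 * n + 1) x))"
  proof (rule ac_suminf)
    show "has_ac_deriv (\<lambda>x. \<mu> ^ n * iter_int g h (2 * n + 2) x) (\<lambda>x. \<mu> ^ n * (of_real (g x) * iter_int h g (2 * n + 1) x))" for n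
      using ac_cmult[OF iter_int_ac[OF g h, of "2 * n + 1"]] by simp
    fix R :: real assume R: "R > 0"
    let ?B = "\<lambda>n. ((C * R)\<^sup>2 + C * (C * R)) * ((norm \<mu> * (C * R)\<^sup>2) ^ n / fact n)"
    have "norm (\<mu> ^ n * iter_int g h (2 * n + 2) x) \<le> ?B n \<and>
          norm (\<mu> ^ n * (of_real (g x) * iter_int h g (2 * n + 1) x)) \<le> ?B n" if "\<bar>x\<bar> \<le> R" for n x
    proof
      have nn: "0 \<le> (norm \<mu> * (C * R)\<^sup>2) ^ n / fact n" by simp
      have "norm (\<mu> ^ n * iter_int g h (2 * n + 2) x) \<le> (C * R)\<^sup>2 * ((norm \<mu> * (C * R)\<^sup>2) ^ n / fact n)"
        by (rule b2[OF that])
      also have "\<dots> \<le> ?B n" using C R nn by (intro mult_right_mono) auto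
      finally show "norm (\<mu> ^ n * iter_int g h (2 * n + 2) x) \<le> ?B n" .
      have "norm (\<mu> ^ n * (of_real (g x) * iter_int h g (2 * n + 1) x)) = \<bar>g x\<bar> * norm (\<mu> ^ n * iter_int h g (2 * n + 1) x)"
        by (simp add: norm_mult)
      also have "\<dots> \<le> C * (C * R * ((norm \<mu> * (C * R)\<^sup>2) ^ n / fact n))"
        using g C by (intro mult_mono term_bound(2)[OF h g that]) (auto simp: bounded_weight_def)
      also have "\<dots> = (C * (C * R)) * ((norm \<mu> * (C * R)\<^sup>2) ^ n / fact n)" by simp
      also have "\<dots> \<le> ?B n" using C R nn by (intro mult_right_mono) auto
      finally show "norm (\<mu> ^ n * (of_real (g x) * iter_int h g (2 * n + 1) x)) \<le> ?B n" .
    qed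
    then show "\<exists>B. summable B \<and> (\<forall>n x. \<bar>x\<bar> \<le> R \<longrightarrow> norm (\<mu> ^ n * iter_int g h (2 * n + 2) x) \<le> B n \<and>
        norm (\<mu> ^ n * (of_real (g x) * iter_int h g (2 * n + 1) x)) \<le> B n)"
      by (intro exI[of _ ?B] conjI summable_mult summable_exp_real) blast
  qed
  then have "has_ac_deriv (\<lambda>x. 1 + \<mu> * (\<Sum>n. \<mu> ^ n * iter_int g h (2 * n + 2) x))
     (\<lambda>x. 0 + \<mu> * (\<Sum>n. \<mu> ^ n * (of_real (g x) * iter_int h g (2 * n + 1) x)))"
    by (intro ac_add ac_const ac_cmult)
  then show ?thesis
  proof (rule ac_cong)
    fix x
    show "1 + \<mu> * (\<Sum>n. \<mu> ^ n * iter_int g h (2 * n + 2) x) = even_series g h \<mu> x"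
      by (simp only: even_series_split[OF g h])
    have "(\<Sum>n. of_real (g x) * (\<mu> ^ n * iter_int h g (2 * n + 1) x)) = of_real (g x) * odd_series h g \<mu> x"
      unfolding odd_series_def by (rule suminf_mult[OF summable_series(2)[OF h g]])
    then show "0 + \<mu> * (\<Sum>n. \<mu> ^ n * (of_real (g x) * iter_int h g (2 * n + 1) x)) = of_real (g x) * (\<mu> * odd_series h g \<mu> x)"
      by (simp add: mult_ac)
  qed
qed

lemma even_series_0 [simp]: "even_series g h \<mu> 0 = 1"
  unfolding even_series_def iter_int_0
  by (subst suminf_finite[of "{0}"]) auto

lemma odd_series_0 [simp]: "odd_series g h \<mu> 0 = 0"
  unfolding odd_series_def iter_int_0 by simp

lemma even_series_cnj:
  assumes "bounded_weight C g" "bounded_weight C h"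
  shows "cnj (even_series g h \<mu> x) = even_series g h (cnj \<mu>) x"
  unfolding even_series_def
  using bounded_linear.suminf[OF bounded_linear_cnj summable_series(1)[OF assms]]
  by (simp add: iter_int_cnj)

section \<open>Wronskians, fundamental solutions and Floquet theory\<close>

definition ode_sol :: "(real \<Rightarrow> real) \<Rightarrow> complex \<Rightarrow> (real \<Rightarrow> complex) \<Rightarrow> (real \<Rightarrow> complex) \<Rightarrow> bool" where
  "ode_sol q lam u w \<longleftrightarrow> has_ac_deriv u (\<lambda>x. of_real (q x) * w x) \<and> has_ac_deriv w (\<lambda>x. - lam * u x)"

lemma ode_sol_wronskian:
  assumes "ode_sol q lam u w" "ode_sol q lam v z"
  shows "u x * z x - v x * w x = u y * z y - v y * w y"
proof -
  have "has_ac_deriv (\<lambda>x. u x * z x - v x * w x)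
    (\<lambda>x. (of_real (q x) * w x * z x + u x * (- lam * v x)) - (of_real (q x) * z x * w x + v x * (- lam * u x)))"
    by (intro ac_diff ac_mult) (use assms in \<open>auto simp: ode_sol_def\<close>)
  then have "has_ac_deriv (\<lambda>x. u x * z x - v x * w x) (\<lambda>_. 0)"
    by (rule ac_cong) (simp_all add: algebra_simps)
  then show ?thesis by (rule ac_const_diff)
qed

lemma ode_sol_lincomb:
  assumes "ode_sol q lam u w" "ode_sol q lam v z"
  shows "ode_sol q lam (\<lambda>x. a * u x + b * v x) (\<lambda>x. a * w x + b * z x)"
proof -
  have "has_ac_deriv (\<lambda>x. a * u x + b * v x) (\<lambda>x. a * (of_real (q x) * w x) + b * (of_real (q x) * z x))"
       "has_ac_deriv (\<lambda>x. a * w x + b * z x) (\<lambda>x. a * (- lam * u x) + b * (- lam * v x))"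
    by (intro ac_add ac_cmult; use assms in \<open>simp add: ode_sol_def\<close>)+
  then show ?thesis unfolding ode_sol_def
    by (auto elim!: ac_cong simp: algebra_simps)
qed

lemma ode_sol_shift:
  assumes "ode_sol q lam u w" "\<And>x. q (x + T) = q x"
  shows "ode_sol q lam (\<lambda>x. u (x + T)) (\<lambda>x. w (x + T))"
proof -
  have "has_ac_deriv (\<lambda>x. u (x + T)) (\<lambda>x. of_real (q (x + T)) * w (x + T))"
    "has_ac_deriv (\<lambda>x. w (x + T)) (\<lambda>x. - lam * u (x + T))"
    using assms(1) ac_shift[of u "\<lambda>x. of_real (q x) * w x" T] ac_shift[of w "\<lambda>x. - lam * u x" T]
    by (auto simp: ode_sol_def)
  then show ?thesis by (simp add: ode_sol_def assms(2))
qed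

locale ode_system =
  fixes q :: "real \<Rightarrow> real" and C :: real
  assumes q_weight: "bounded_weight C q" and C1: "1 \<le> C"
begin

lemma one_weight: "bounded_weight C (\<lambda>_. 1)"
  using C1 by (intro bounded_weight_const) simp

definition "u1 lam = even_series q (\<lambda>_. 1) (- lam)"
definition "u2 lam = odd_series q (\<lambda>_. 1) (- lam)"
definition "w1 lam x = - lam * odd_series (\<lambda>_. 1) q (- lam) x"
definition "w2 lam = even_series (\<lambda>_. 1) q (- lam)"

lemma fundamental_sols: "ode_sol q lam (u1 lam) (w1 lam)" "ode_sol q lam (u2 lam) (w2 lam)"
proof -
  show "ode_sol q lam (u1 lam) (w1 lam)"
    unfolding ode_sol_def u1_def w1_def
    using even_series_ac[OF q_weight one_weight, of "-lam"]
      ac_cmult[OF odd_series_ac[OF one_weight q_weight, of "-lam"], of "-lam"] by auto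
  show "ode_sol q lam (u2 lam) (w2 lam)"
    unfolding ode_sol_def u2_def w2_def
    using odd_series_ac[OF q_weight one_weight, of "-lam"]
      even_series_ac[OF one_weight q_weight, of "-lam"] by auto
qed

lemma init [simp]: "u1 lam 0 = 1" "u2 lam 0 = 0" "w1 lam 0 = 0" "w2 lam 0 = 1"
  by (simp_all add: u1_def u2_def w1_def w2_def)

lemma wronskian: "u1 lam x * w2 lam x - u2 lam x * w1 lam x = 1"
  using ode_sol_wronskian[OF fundamental_sols, of lam x 0] by simp

text \<open>The Wronskians of a solution with the two fundamental solutions are constant in
  \<open>x\<close>. They give two linear equations for \<open>u x\<close> and \<open>w x\<close>
  whose determinant is 1.\<close>

lemma ode_sol_unique:
  assumes "ode_sol q lam u w"
  shows "u x = u 0 * u1 lam x + w 0 * u2 lam x" "w x = u 0 * w1 lam x + w 0 * w2 lam x"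
proof -
  have a: "u1 lam x * w x - u x * w1 lam x = w 0" "u x * w2 lam x - u2 lam x * w x = u 0"
    using ode_sol_wronskian[OF fundamental_sols(1) assms, of x 0]
      ode_sol_wronskian[OF assms fundamental_sols(2), of x 0] by simp_all
  show "u x = u 0 * u1 lam x + w 0 * u2 lam x" "w x = u 0 * w1 lam x + w 0 * w2 lam x"
    using wronskian[of lam x] unfolding a[symmetric] by algebra+
qed

text \<open>The trace of the monodromy matrix over \<open>[0, T]\<close>, whose determinant is 1 by \<open>wronskian\<close>.\<close>

definition "discr T lam = u1 lam T + w2 lam T"

lemma discr_cnj: "discr T (cnj lam) = cnj (discr T lam)"
  using even_series_cnj[OF q_weight one_weight] even_series_cnj[OF one_weight q_weight]
  by (simp add: discr_def u1_def w2_def)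

text \<open>The monodromy matrix has determinant 1, so the hypothesis is its characteristic equation
  at \<open>z\<close>, and an eigenvector provides the initial data.\<close>

lemma floquet_initial:
  assumes "z\<^sup>2 - discr T lam * z + 1 = 0"
  obtains u w where "ode_sol q lam u w" "u 0 \<noteq> 0 \<or> w 0 \<noteq> 0" "u T = z * u 0" "w T = z * w 0"
proof -
  define A B C D where "A = u1 lam T" "B = u2 lam T" "C = w1 lam T" "D = w2 lam T"
  have det: "(A - z) * (D - z) = B * C"
    using assms wronskian[of lam T] unfolding discr_def A_B_C_D_def[symmetric] by algebra
  have "\<exists>a b. (a \<noteq> 0 \<or> b \<noteq> 0) \<and> A * a + B * b = z * a \<and> C * a + D * b = z * b"
  \<comment> \<open>The first row suggests the eigenvector \<open>(B, z - A)\<close>; if it is zero,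
    the second row suggests \<open>(z - D, C)\<close>; if that is zero as well, the matrix is
    \<open>z\<close> times the identity.\<close>
  proof (cases "B \<noteq> 0 \<or> A \<noteq> z")
    case True
    have "A * B + B * (z - A) = z * B" by algebra
    moreover have "C * B + D * (z - A) = z * (z - A)" using det by algebra
    ultimately
    show ?thesis using True by (intro exI[of _ B] exI[of _ "z - A"]) auto
  next
    case False
    show ?thesis
    proof (cases "C \<noteq> 0 \<or> D \<noteq> z")
      case True
      then show ?thesis using False by (intro exI[of _ "z - D"] exI[of _ C]) (auto simp: algebra_simps)
    next
      case False': False
      show ?thesis using False False' by (intro exI[of _ 1] exI[of _ 0]) auto
    qed
  qed
  then obtain a b where ab: "a \<noteq> 0 \<or> b \<noteq> 0" "A * a + B * b = z * a" "C * a + D * b = z * b" by blast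
  show ?thesis
  proof (rule that[OF ode_sol_lincomb[OF fundamental_sols, of lam a b]])
  qed (use ab in \<open>auto simp: A_B_C_D_def algebra_simps\<close>)
qed

text \<open>The translate by a period is again a solution and its initial data are \<open>z\<close>
  times the old ones; uniqueness spreads the factor to all \<open>x\<close>.\<close>

lemma floquet:
  assumes "z\<^sup>2 - discr T lam * z + 1 = 0" and per: "\<And>x. q (x + T) = q x"
  obtains u w where "ode_sol q lam u w" "u 0 \<noteq> 0 \<or> w 0 \<noteq> 0" "\<And>x. u (x + T) = z * u x" "\<And>x. w (x + T) = z * w x"
proof -
  obtain u w where uw: "ode_sol q lam u w" "u 0 \<noteq> 0 \<or> w 0 \<noteq> 0" "u T = z * u 0" "w T = z * w 0"
    using floquet_initial[OF assms(1)] by blast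
  note s = ode_sol_unique[OF ode_sol_shift[OF uw(1) per]] and t = ode_sol_unique[OF uw(1)]
  show ?thesis
  proof (rule that[OF uw(1,2)])
    fix x
    show "u (x + T) = z * u x" using s(1)[of x] t(1)[of x] uw(3,4) by (simp add: algebra_simps)
    show "w (x + T) = z * w x" using s(2)[of x] t(2)[of x] uw(3,4) by (simp add: algebra_simps)
  qed
qed

text \<open>A degenerate weight could leave \<open>u = 0\<close> with a nonzero flux. If
  \<open>u\<close> vanishes on the interval, then \<open>w\<close> is a nonzero constant there, and
  \<open>q * w = 0\<close> forces \<open>q = 0\<close> almost everywhere.\<close>

lemma ode_sol_nontrivial:
  assumes s: "ode_sol q lam u w" and n: "u 0 \<noteq> 0 \<or> w 0 \<noteq> 0" and T: "0 < T"
    and q: "\<not> (AE x in lebesgue. x \<in> {0<..<T} \<longrightarrow> q x = 0)"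
  obtains x where "x \<in> {0<..<T}" "u x \<noteq> 0"
proof (rule ccontr)
  assume "\<not> thesis"
  then have z: "u x = 0" if "x \<in> {0<..<T}" for x using that \<open>\<And>x. x \<in> {0<..<T} \<Longrightarrow> u x \<noteq> 0 \<Longrightarrow> thesis\<close> by blast
  have U: "has_ac_deriv u (\<lambda>x. of_real (q x) * w x)" and W: "has_ac_deriv w (\<lambda>x. - lam * u x)"
    using s by (auto simp: ode_sol_def)
  have qw: "AE x in lebesgue. x \<in> {0<..<T} \<longrightarrow> of_real (q x) * w x = 0"
    by (rule ac_unique_deriv_AE[OF U, of _ 0]) (use z in auto)
  have "closure {0<..<T} \<subseteq> {x \<in> UNIV. u x = 0}"
    by (rule closure_minimal)
       (use z continuous_closed_preimage_constant[OF ac_continuous[OF U], of 0] in auto)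
  then have zz: "u x = 0" if "x \<in> {0..T}" for x using that T by auto
  have w0: "w x = w 0" if "x \<in> {0..T}" for x
  proof -
    have "(LINT t:{0..x}|lebesgue. - lam * u t) = (LINT t:{0..x}|lebesgue. 0)"
      by (rule set_lebesgue_integral_cong) (use zz that in auto)
    then show ?thesis using ac_integral[OF W, of 0 x] that by simp
  qed
  have "w 0 \<noteq> 0" using n zz[of 0] T by auto
  have "AE x in lebesgue. x \<in> {0<..<T} \<longrightarrow> q x = 0"
    using qw
  proof eventually_elim
    case (elim x)
    then show ?case using w0[of x] \<open>w 0 \<noteq> 0\<close> by auto
  qed
  with q show False by blast
qed

end

lemma periodic_bounded:
  fixes f :: "real \<Rightarrow> complex"
  assumes c: "continuous_on UNIV f" and p: "\<And>x. norm (f (x + T)) = norm (f x)" and T: "T > 0"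
  obtains B where "\<And>x. norm (f x) \<le> B"
proof -
  have n: "norm (f (x + real n * T)) = norm (f x)" for n x
  proof (induction n)
    case (Suc n)
    have "x + real (Suc n) * T = (x + real n * T) + T" by (simp add: algebra_simps)
    then show ?case using Suc p by metis
  qed simp
  have i: "norm (f (x + of_int k * T)) = norm (f x)" for k x
  proof (cases "0 \<le> k")
    case True then show ?thesis using n[of x "nat k"] by simp
  next
    case False then show ?thesis using n[of "x + of_int k * T" "nat (-k)"] by (simp add: algebra_simps)
  qed
  have "bounded (f ` {0..T})"
    by (intro compact_imp_bounded compact_continuous_image continuous_on_subset[OF c]) auto
  then obtain B where B: "\<forall>x\<in>{0..T}. norm (f x) \<le> B" by (auto simp: bounded_iff)
  show ?thesis
  proof (rule that)
    fix x
    define k where "k = \<lfloor>x / T\<rfloor>"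
    have "of_int k \<le> x / T" "x / T < of_int k + 1" unfolding k_def by linarith+
    then have "x + of_int (-k) * T \<in> {0..T}" using T by (auto simp: field_simps)
    with B have "norm (f (x + of_int (-k) * T)) \<le> B" by blast
    then show "norm (f x) \<le> B" unfolding i .
  qed
qed

section \<open>The limit problem on the unit cell\<close>

lemma borel_measurable_cnj:
  "f \<in> borel_measurable M \<Longrightarrow> (\<lambda>x. cnj (f x)) \<in> borel_measurable M"
  by (rule measurable_compose[of f M borel cnj]) (auto intro!: borel_measurable_continuous_onI continuous_intros)

lemma L2_mult_integrable:
  assumes "u \<in> L2 M" "v \<in> L2 M" shows "integrable M (\<lambda>x. u x * cnj (v x))"
proof (rule Bochner_Integration.integrable_bound)
  show "integrable M (\<lambda>x. (cmod (u x))\<^sup>2 + (cmod (v x))\<^sup>2)"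
    using assms by (auto simp: L2_def)
  show "(\<lambda>x. u x * cnj (v x)) \<in> borel_measurable M"
    by (intro borel_measurable_times borel_measurable_cnj) (use assms in \<open>simp_all add: L2_def\<close>)
  have "cmod a * cmod b \<le> (cmod a)\<^sup>2 + (cmod b)\<^sup>2" for a b :: complex
    using sum_squares_bound[of "cmod a" "cmod b"] mult_nonneg_nonneg[OF norm_ge_zero[of a] norm_ge_zero[of b]]
    by linarith
  then show "AE x in M. norm (u x * cnj (v x)) \<le> norm ((cmod (u x))\<^sup>2 + (cmod (v x))\<^sup>2)"
    by (intro AE_I2) (simp add: norm_mult)
qed

lemma L2_diff:
  assumes "u \<in> L2 M" "v \<in> L2 M" shows "(\<lambda>x. u x - v x) \<in> L2 M"
proof -
  have m: "(\<lambda>x. u x - v x) \<in> borel_measurable M" using assms by (auto simp: L2_def)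
  have "integrable M (\<lambda>x. (cmod (u x - v x))\<^sup>2)"
  proof (rule Bochner_Integration.integrable_bound)
    show "integrable M (\<lambda>x. 2 * (cmod (u x))\<^sup>2 + 2 * (cmod (v x))\<^sup>2)"
      using assms by (auto simp: L2_def)
    show "(\<lambda>x. (cmod (u x - v x))\<^sup>2) \<in> borel_measurable M" using m by measurable
    have "(cmod (a - b))\<^sup>2 \<le> 2 * (cmod a)\<^sup>2 + 2 * (cmod b)\<^sup>2" for a b :: complex
    proof -
      have "(cmod (a - b))\<^sup>2 \<le> (cmod a + cmod b)\<^sup>2"
        by (intro power_mono norm_triangle_ineq4) auto
      also have "\<dots> \<le> 2 * (cmod a)\<^sup>2 + 2 * (cmod b)\<^sup>2"
        using sum_squares_bound[of "cmod a" "cmod b"] by (simp add: power2_sum)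
      finally show ?thesis .
    qed
    then show "AE x in M. norm ((cmod (u x - v x))\<^sup>2) \<le> norm (2 * (cmod (u x))\<^sup>2 + 2 * (cmod (v x))\<^sup>2)"
      by (intro AE_I2) simp
  qed
  with m show ?thesis by (simp add: L2_def)
qed

lemma L2inner_cnj: "cnj (L2inner M u v) = L2inner M v u"
  unfolding L2inner_def Bochner_Integration.integral_cnj[symmetric] by (simp add: mult.commute)

lemma L2inner_diff_left:
  assumes "u \<in> L2 M" "v \<in> L2 M" "w \<in> L2 M"
  shows "L2inner M (\<lambda>x. u x - v x) w = L2inner M u w - L2inner M v w"
  unfolding L2inner_def using assms
  by (simp add: left_diff_distrib Bochner_Integration.integral_diff L2_mult_integrable)

lemma L2inner_self: "L2inner M u u = of_real (\<integral>x. (cmod (u x))\<^sup>2 \<partial>M)"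
  unfolding L2inner_def by (simp only: complex_norm_square[symmetric] of_real_power[symmetric] integral_complex_of_real)

lemma L2inner_self_eq_0:
  assumes "u \<in> L2 M" "L2inner M u u = 0" shows "AE x in M. u x = 0"
proof -
  have "(\<integral>x. (cmod (u x))\<^sup>2 \<partial>M) = 0" using assms(2) by (simp only: L2inner_self of_real_eq_0_iff)
  then have "AE x in M. (cmod (u x))\<^sup>2 = 0"
    using assms(1) integral_nonneg_eq_0_iff_AE[of M "\<lambda>x. (cmod (u x))\<^sup>2"] by (simp add: L2_def)
  then show ?thesis by eventually_elim simp
qed

text \<open>For a Hermitian form, uniqueness at \<open>\<lambda>\<close> is dual to solvability at \<open>cnj \<lambda>\<close>.\<close>

lemma form_resolventI:
  assumes D: "D \<subseteq> L2 M" and H: "H \<subseteq> L2 M"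
    and herm: "\<And>u v. u \<in> D \<Longrightarrow> v \<in> D \<Longrightarrow> a u v = cnj (a v u)"
    and ex: "\<exists>C. \<forall>f \<in> L2 M. \<exists>u \<in> D. (\<forall>\<phi> \<in> D. a u \<phi> - lam * L2inner M u \<phi> = L2inner M f \<phi>) \<and> L2norm M u \<le> C * L2norm M f"
    and adj: "\<And>f. f \<in> L2 M \<Longrightarrow> \<exists>u \<in> D. \<forall>\<phi> \<in> D. a u \<phi> - cnj lam * L2inner M u \<phi> = L2inner M f \<phi>"
  shows "form_resolvent M H D a lam"
proof -
  obtain C where C: "\<And>f. f \<in> L2 M \<Longrightarrow> \<exists>u \<in> D. (\<forall>\<phi> \<in> D. a u \<phi> - lam * L2inner M u \<phi> = L2inner M f \<phi>) \<and> L2norm M u \<le> C * L2norm M f"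
    using ex by blast
  have uniq: "AE x in M. w x = u x"
    if u: "u \<in> D" "\<And>\<phi>. \<phi> \<in> D \<Longrightarrow> a u \<phi> - lam * L2inner M u \<phi> = L2inner M f \<phi>"
      and w: "w \<in> D" "\<And>\<phi>. \<phi> \<in> D \<Longrightarrow> a w \<phi> - lam * L2inner M w \<phi> = L2inner M f \<phi>" for f u w
  proof -
    define g where "g = (\<lambda>x. w x - u x)"
    have g: "g \<in> L2 M" unfolding g_def using u w D by (auto intro: L2_diff)
    obtain v where v: "v \<in> D" "\<And>\<phi>. \<phi> \<in> D \<Longrightarrow> a v \<phi> - cnj lam * L2inner M v \<phi> = L2inner M g \<phi>"
      using adj[OF g] by blast
    \<comment> \<open>Testing \<open>y\<close> with \<open>v\<close> and \<open>v\<close> with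
      \<open>y\<close> fixes the inner product with \<open>g\<close> independently of the solution
      \<open>y\<close>. For the two solutions \<open>u\<close> and \<open>w\<close> this makes
      \<open>g = w - u\<close> orthogonal to itself.\<close>
    have *: "L2inner M y g = L2inner M f v"
      if y: "y \<in> D" "\<And>\<phi>. \<phi> \<in> D \<Longrightarrow> a y \<phi> - lam * L2inner M y \<phi> = L2inner M f \<phi>" for y
    proof -
      have "L2inner M y g = cnj (a v y - cnj lam * L2inner M v y)"
        using v(2)[OF y(1)] by (simp add: L2inner_cnj)
      also have "\<dots> = a y v - lam * L2inner M y v"
        using herm[OF y(1) v(1)] by (simp add: L2inner_cnj)
      also have "\<dots> = L2inner M f v" by (rule y(2)[OF v(1)])
      finally show ?thesis .
    qed
    have "L2inner M g g = 0"
      using *[OF u] *[OF w] L2inner_diff_left[of w M u g] u w D g by (auto simp: g_def)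
    from L2inner_self_eq_0[OF g this] show ?thesis by eventually_elim (simp add: g_def)
  qed
  show ?thesis unfolding form_resolvent_def
  proof (intro exI[of _ C] ballI)
    fix f assume "f \<in> H"
    then have "f \<in> L2 M" using H by blast
    from C[OF this] obtain u where u: "u \<in> D" "\<forall>\<phi> \<in> D. a u \<phi> - lam * L2inner M u \<phi> = L2inner M f \<phi>"
      "L2norm M u \<le> C * L2norm M f" by blast
    show "\<exists>u\<in>D. (\<forall>\<phi>\<in>D. a u \<phi> - lam * L2inner M u \<phi> = L2inner M f \<phi>) \<and> L2norm M u \<le> C * L2norm M f \<and>
       (\<forall>w\<in>D. (\<forall>\<phi>\<in>D. a w \<phi> - lam * L2inner M w \<phi> = L2inner M f \<phi>) \<longrightarrow> (AE x in M. w x = u x))"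
      using u uniq[of u f] by (intro bexI[of _ u]) auto
  qed
qed

text \<open>For the right-hand side 0 both \<open>u\<close> and the zero function are solutions,
  against the uniqueness clause of \<open>form_resolvent\<close>.\<close>

lemma form_not_resolventI:
  assumes z: "(\<lambda>_. 0) \<in> H" "(\<lambda>_. 0) \<in> D" "\<And>\<phi>. \<phi> \<in> D \<Longrightarrow> a (\<lambda>_. 0) \<phi> = 0"
    and u: "u \<in> D" "\<And>\<phi>. \<phi> \<in> D \<Longrightarrow> a u \<phi> - lam * L2inner M u \<phi> = 0" "\<not> (AE x in M. u x = 0)"
  shows "\<not> form_resolvent M H D a lam"
proof
  assume "form_resolvent M H D a lam"
  then obtain v where v: "\<And>w. w \<in> D \<Longrightarrow> (\<forall>\<phi>\<in>D. a w \<phi> - lam * L2inner M w \<phi> = L2inner M (\<lambda>_. 0) \<phi>) \<Longrightarrow> (AE x in M. w x = v x)"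
    using z(1) unfolding form_resolvent_def by blast
  have i0: "L2inner M (\<lambda>_. 0) \<phi> = 0" for \<phi> by (simp add: L2inner_def)
  have "AE x in M. 0 = v x" by (rule v[of "\<lambda>_. 0"]) (use z i0 in auto)
  moreover have "AE x in M. u x = v x" by (rule v) (use u i0 in auto)
  ultimately have "AE x in M. u x = 0" by eventually_elim simp
  with u(3) show False by blast
qed

abbreviation (input) "QM \<equiv> lebesgue_on {0<..<1::real}"

lemma continuous_L2_Q:
  assumes "continuous_on UNIV u" shows "u \<in> L2 QM"
proof -
  have c2: "continuous_on UNIV (\<lambda>x. (complex_of_real ((cmod (u x))\<^sup>2)))" by (intro continuous_intros assms)
  have "set_integrable lebesgue {0<..<1} (\<lambda>x. complex_of_real ((cmod (u x))\<^sup>2))"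
    by (rule set_integrable_subset[OF loc_intD[OF loc_int_continuous[OF c2], of 0 1]]) auto
  then have "integrable QM (\<lambda>x. complex_of_real ((cmod (u x))\<^sup>2))"
    by (simp add: integrable_lebesgue_on set_integrable_def)
  then have "integrable QM (\<lambda>x. (cmod (u x))\<^sup>2)"
    unfolding complex_of_real_integrable_eq .
  moreover have "u \<in> borel_measurable QM"
    using loc_int_measurable[OF loc_int_continuous[OF assms]] by (rule measurable_restrict_space1)
  ultimately show ?thesis by (simp add: L2_def)
qed

text \<open>Inside the interval the set where \<open>f\<close> and \<open>g\<close> differ is open
  and null, hence empty. Passing to the closure adds the endpoints, which is how boundary values
  move from one representative to another.\<close>

lemma continuous_AE_eq:
  assumes "continuous_on {a..b} f" "continuous_on {a..b} (g :: real \<Rightarrow> complex)" "a < b"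
    and ae: "AE x in lebesgue. x \<in> {a<..<b} \<longrightarrow> f x = g x" and x: "x \<in> {a..b}"
  shows "f x = g x"
proof -
  let ?h = "\<lambda>x. f x - g x"
  have ch: "continuous_on {a..b} ?h" by (intro continuous_intros assms)
  have "open ({a<..<b} \<inter> ?h -` (- {0}))"
    by (rule continuous_open_preimage[OF continuous_on_subset[OF ch]]) auto
  moreover have "negligible ({a<..<b} \<inter> ?h -` (- {0}))"
  proof -
    have "{x \<in> space lebesgue. \<not> (x \<in> {a<..<b} \<longrightarrow> f x = g x)} = {a<..<b} \<inter> ?h -` (- {0})" by auto
    then show ?thesis
      using ae calculation by (simp add: negligible_iff_null_sets AE_iff_null_sets[symmetric] borel_open AE_iff_null)
  qed
  ultimately have e: "{a<..<b} \<inter> ?h -` (- {0}) = {}"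
    using open_not_negligible by blast
  have "closed ({a..b} \<inter> ?h -` {0})"
    by (rule continuous_closed_preimage[OF ch]) auto
  then have "closure {a<..<b} \<subseteq> {a..b} \<inter> ?h -` {0}"
    by (rule closure_minimal[rotated]) (use e in auto)
  with x \<open>a < b\<close> show ?thesis by auto
qed

lemma AE_not_endpoint: "AE x in lebesgue. x \<noteq> (c::real)"
  by (auto intro!: AE_completion AE_lborel_singleton)

text \<open>Since \<open>cis t\<close> and \<open>cis (- t)\<close> have product 1, a quadratic with
  constant term 1 vanishes at \<open>cis t\<close> exactly when its trace \<open>d\<close> is their
  sum.\<close>

lemma floquet_polynomial: "(cis t)\<^sup>2 - d * cis t + 1 = cis t * (of_real (2 * cos t) - d)"
proof -
  have "cis t * cis (- t) = 1" by (simp add: cis_mult)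
  moreover have "of_real (2 * cos t) = cis t + cis (- t)" by (simp add: complex_eq_iff)
  ultimately show ?thesis by algebra
qed

text \<open>\<open>q\<close> is tied to \<open>p\<close> only almost everywhere. This leaves room
  for a version of the reciprocal that is bounded at every point, as \<open>bounded_weight\<close>
  demands.\<close>

locale limit_problem = ode_system q C for q :: "real \<Rightarrow> real" and C :: real +
  fixes \<alpha> \<beta> :: real and p :: "real \<Rightarrow> real"
  assumes ab: "0 < \<alpha>" "\<alpha> < \<beta>" "\<beta> < 1"
    and p_meas: "p \<in> borel_measurable lebesgue" and p_pos: "\<And>x. p x > 0"
    and q_in: "AE x in lebesgue. x \<in> {\<alpha><..<\<beta>} \<longrightarrow> p x * q x = 1"
    and q_out: "AE x in lebesgue. x \<in> {0<..<1} - {\<alpha><..<\<beta>} \<longrightarrow> q x = 0"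
begin

text \<open>\<open>H1_theta\<close> asks for continuity on the closed interval, so \<open>v\<close>
  agrees with its absolutely continuous representative at 0 and 1 too, and the quasi-periodic
  condition carries over to \<open>V\<close>.\<close>

lemma V_theta_ac:
  assumes "v \<in> V_theta \<alpha> \<beta> p \<theta>"
  obtains V where "has_ac_deriv V (\<lambda>x. indicat_real {0<..<1} x *\<^sub>R weak_deriv {0<..<1} v x)"
    "\<And>x. x \<in> {0..1} \<Longrightarrow> v x = V x" "V 1 = cis (2 * pi * \<theta>) * V 0"
    "AE x in lebesgue. x \<in> {0<..<1} - {\<alpha><..<\<beta>} \<longrightarrow> weak_deriv {0<..<1} v x = 0"
proof -
  have v: "v \<in> H1 {0<..<1}" "continuous_on {0..1} v" "v 1 = cis (2 * pi * \<theta>) * v 0"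
    and z: "AE y in QM. y \<in> {0<..<\<alpha>} \<union> {\<beta><..<1} \<longrightarrow> of_real (p y) * weak_deriv {0<..<1} v y = 0"
    using assms by (auto simp: V_theta_def H1_theta_def)
  obtain V where V: "has_ac_deriv V (\<lambda>x. indicat_real {0<..<1} x *\<^sub>R weak_deriv {0<..<1} v x)"
    "AE x in lebesgue. x \<in> {0<..<1} \<longrightarrow> v x = V x"
    using H1_imp_ac[of "{0<..<1}" v] v(1) by (auto simp: is_interval_1)
  have eq: "v x = V x" if "x \<in> {0..1}" for x
    by (rule continuous_AE_eq[OF v(2) continuous_on_subset[OF ac_continuous[OF V(1)]] _ V(2) that]) auto
  have "AE x in lebesgue. x \<in> {0<..<1} \<longrightarrow> x \<in> {0<..<\<alpha>} \<union> {\<beta><..<1} \<longrightarrow> of_real (p x) * weak_deriv {0<..<1} v x = 0"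
    by (rule AE_lebesgue_on[THEN iffD1, OF _ z]) simp
  then have "AE x in lebesgue. x \<in> {0<..<1} - {\<alpha><..<\<beta>} \<longrightarrow> weak_deriv {0<..<1} v x = 0"
    using AE_not_endpoint[of \<alpha>] AE_not_endpoint[of \<beta>]
  proof eventually_elim
    case (elim x)
    then show ?case using p_pos[of x] by auto
  qed
  with V(1) eq v(3) eq[of 0] eq[of 1] show ?thesis by (intro that[of V]) auto
qed

lemma ac_in_V_theta:
  assumes V: "has_ac_deriv V G" and G: "G \<in> L2 QM" and z: "AE x in lebesgue. x \<in> {0<..<1} - {\<alpha><..<\<beta>} \<longrightarrow> G x = 0"
    and b: "V 1 = cis (2 * pi * \<theta>) * V 0"
  shows "V \<in> V_theta \<alpha> \<beta> p \<theta>" "AE x in lebesgue. x \<in> {0<..<1} \<longrightarrow> weak_deriv {0<..<1} V x = G x"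
proof -
  note c = ac_continuous[OF V]
  have I: "open {0<..<1::real}" "is_interval {0<..<1::real}" by (auto simp: is_interval_1)
  note H = ac_imp_H1[OF I V continuous_L2_Q[OF c] _ G]
  show w: "AE x in lebesgue. x \<in> {0<..<1} \<longrightarrow> weak_deriv {0<..<1} V x = G x" by (rule H(2)) simp
  have "AE x in lebesgue. x \<in> {0<..<1} \<longrightarrow> x \<in> {0<..<\<alpha>} \<union> {\<beta><..<1} \<longrightarrow> of_real (p x) * weak_deriv {0<..<1} V x = 0"
    using w z by eventually_elim auto
  with H(1) b show "V \<in> V_theta \<alpha> \<beta> p \<theta>"
    by (auto simp: V_theta_def H1_theta_def AE_lebesgue_on intro: continuous_on_subset[OF c])
qed

lemma V_theta_L2: "V_theta \<alpha> \<beta> p \<theta> \<subseteq> L2 QM"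
  by (auto simp: V_theta_def H1_theta_def H1_def)

lemma q_times_L2:
  assumes "continuous_on UNIV w" shows "(\<lambda>x. of_real (q x) * w x) \<in> L2 QM"
proof -
  have m: "(\<lambda>x. of_real (q x) * w x) \<in> borel_measurable QM"
    using loc_int_measurable[OF loc_int_weight[OF q_weight assms]] by (rule measurable_restrict_space1)
  have "integrable QM (\<lambda>x. (cmod (of_real (q x) * w x))\<^sup>2)"
  proof (rule Bochner_Integration.integrable_bound)
    show "integrable QM (\<lambda>x. C\<^sup>2 * (cmod (w x))\<^sup>2)"
      using continuous_L2_Q[OF assms] by (simp add: L2_def)
    show "(\<lambda>x. (cmod (of_real (q x) * w x))\<^sup>2) \<in> borel_measurable QM" using m by measurable
    have "\<bar>q x\<bar> \<le> \<bar>C\<bar>" for x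
      using q_weight by (auto simp: bounded_weight_def intro: order_trans[OF _ abs_ge_self])
    then have "(q x)\<^sup>2 \<le> C\<^sup>2" for x by (simp only: abs_le_square_iff)
    then show "AE x in QM. norm ((cmod (of_real (q x) * w x))\<^sup>2) \<le> norm (C\<^sup>2 * (cmod (w x))\<^sup>2)"
      by (intro AE_I2) (auto simp: norm_mult power_mult_distrib intro!: mult_right_mono)
  qed
  with m show ?thesis by (simp add: L2_def)
qed

text \<open>Integrate the derivative of \<open>W * cnj F\<close> over the cell; the boundary terms
  cancel because \<open>cis\<close> has modulus 1. On the soft interval \<open>p * U'\<close> is
  \<open>W\<close>, and on the stiff part the test function has derivative 0, so the values of
  \<open>W\<close> there do not enter the form.\<close>

lemma weak_form_theta:
  assumes U: "has_ac_deriv U (\<lambda>x. of_real (q x) * W x)"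
    and W: "has_ac_deriv W (\<lambda>x. - lam * U x - indicat_real {0<..<1} x *\<^sub>R f x)"
    and b: "U 1 = cis (2 * pi * \<theta>) * U 0" "W 1 = cis (2 * pi * \<theta>) * W 0"
    and f: "f \<in> L2 QM"
  shows "U \<in> V_theta \<alpha> \<beta> p \<theta>"
    and "\<phi> \<in> V_theta \<alpha> \<beta> p \<theta> \<Longrightarrow> form_theta \<alpha> \<beta> p U \<phi> - lam * L2inner QM U \<phi> = L2inner QM f \<phi>"
proof -
  note wc = ac_continuous[OF W] and uc = ac_continuous[OF U]
  have qz: "AE x in lebesgue. x \<in> {0<..<1} - {\<alpha><..<\<beta>} \<longrightarrow> of_real (q x) * W x = 0"
    using q_out by eventually_elim auto
  note UV = ac_in_V_theta[OF U q_times_L2[OF wc] qz b(1)]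
  show "U \<in> V_theta \<alpha> \<beta> p \<theta>" by (rule UV(1))
  assume phi: "\<phi> \<in> V_theta \<alpha> \<beta> p \<theta>"
  define g where "g = weak_deriv {0<..<1} \<phi>"
  define G where "G = (\<lambda>x. indicat_real {0<..<1} x *\<^sub>R g x)"
  obtain F where F: "has_ac_deriv F G" "\<And>x. x \<in> {0..1} \<Longrightarrow> \<phi> x = F x" "F 1 = cis (2 * pi * \<theta>) * F 0"
    "AE x in lebesgue. x \<in> {0<..<1} - {\<alpha><..<\<beta>} \<longrightarrow> g x = 0"
    using V_theta_ac[OF phi] unfolding g_def G_def by blast
  define f' where "f' = (\<lambda>x. indicat_real {0<..<1} x *\<^sub>R f x)"
  have W': "has_ac_deriv W (\<lambda>x. - lam * U x - f' x)" using W by (simp add: f'_def)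
  have prod: "has_ac_deriv (\<lambda>x. W x * cnj (F x)) (\<lambda>x. (- lam * U x - f' x) * cnj (F x) + W x * cnj (G x))"
    by (rule ac_mult[OF W' ac_cnj[OF F(1)]])
  have "cis (2 * pi * \<theta>) * cnj (cis (2 * pi * \<theta>)) = 1"
    by (simp add: cis_cnj cis_mult)
  then have "W 1 * cnj (F 1) - W 0 * cnj (F 0) = 0"
    unfolding b F(3) complex_cnj_mult by algebra
  then have 0: "(LINT x:{0..1}|lebesgue. (- lam * U x - f' x) * cnj (F x) + W x * cnj (G x)) = 0"
    using ac_integral[OF prod, of 0 1] by simp
  have cF: "continuous_on UNIV (\<lambda>x. cnj (F x))" by (intro continuous_intros ac_continuous[OF F(1)])
  have lG: "loc_int (\<lambda>x. W x * cnj (G x))" by (rule loc_int_mult[OF wc loc_int_cnj[OF ac_loc_int[OF F(1)]]])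
  have lU: "loc_int (\<lambda>x. U x * cnj (F x))" by (intro loc_int_continuous continuous_intros uc ac_continuous[OF F(1)])
  have lf': "loc_int f'" unfolding f'_def by (rule L2_loc_int[OF _ f]) auto
  have lf: "loc_int (\<lambda>x. f' x * cnj (F x))" using loc_int_mult[OF cF lf'] by (simp add: mult.commute)
  have "(LINT x:{0..1}|lebesgue. (- lam * U x - f' x) * cnj (F x) + W x * cnj (G x)) =
        (LINT x:{0..1}|lebesgue. W x * cnj (G x) - (lam * (U x * cnj (F x)) + f' x * cnj (F x)))"
    by (simp add: algebra_simps)
  also have "\<dots> = (LINT x:{0..1}|lebesgue. W x * cnj (G x)) - (lam * (LINT x:{0..1}|lebesgue. U x * cnj (F x)) + (LINT x:{0..1}|lebesgue. f' x * cnj (F x)))"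
    using loc_intD[OF lG] loc_intD[OF lU] loc_intD[OF lf]
    by (simp add: set_integral_diff(2) set_integral_add set_integrable_mult_right)
  finally have 1: "(LINT x:{0..1}|lebesgue. W x * cnj (G x)) = lam * (LINT x:{0..1}|lebesgue. U x * cnj (F x)) + (LINT x:{0..1}|lebesgue. f' x * cnj (F x))"
    using 0 by simp
  have inner: "L2inner QM y \<phi> = (LINT x:{0..1}|lebesgue. y' x * cnj (F x))"
    if y: "y \<in> L2 QM" "\<And>x. x \<in> {0<..<1} \<Longrightarrow> y x = y' x" "loc_int (\<lambda>x. y' x * cnj (F x))" for y y'
  proof -
    have "\<phi> \<in> L2 QM" using phi V_theta_L2 by blast
    then have "integrable QM (\<lambda>x. y x * cnj (\<phi> x))" using y(1) by (intro L2_mult_integrable)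
    then have m: "(\<lambda>x. indicat_real {0<..<1} x *\<^sub>R (y x * cnj (\<phi> x))) \<in> borel_measurable lebesgue"
      by (intro borel_measurable_integrable) (simp add: integrable_lebesgue_on)
    have "L2inner QM y \<phi> = (\<integral>x. indicat_real {0<..<1} x *\<^sub>R (y x * cnj (\<phi> x)) \<partial>lebesgue)"
      unfolding L2inner_def by (rule integral_lebesgue_on) auto
    also have "\<dots> = (LINT x:{0..1}|lebesgue. y' x * cnj (F x))"
      unfolding set_lebesgue_integral_def
    proof (rule integral_cong_AE[OF m])
      show "(\<lambda>x. indicat_real {0..1} x *\<^sub>R (y' x * cnj (F x))) \<in> borel_measurable lebesgue"
        by (rule borel_measurable_integrable[OF loc_intD[OF y(3), unfolded set_integrable_def]])
      show "AE x in lebesgue. indicat_real {0<..<1} x *\<^sub>R (y x * cnj (\<phi> x)) = indicat_real {0..1} x *\<^sub>R (y' x * cnj (F x))"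
        using AE_not_endpoint[of 0] AE_not_endpoint[of 1]
        by eventually_elim (use y(2) F(2) in \<open>auto simp: indicator_def\<close>)
    qed
    finally show ?thesis .
  qed
  have 2: "L2inner QM U \<phi> = (LINT x:{0..1}|lebesgue. U x * cnj (F x))"
    by (rule inner[OF continuous_L2_Q[OF uc] _ lU]) simp
  have 3: "L2inner QM f \<phi> = (LINT x:{0..1}|lebesgue. f' x * cnj (F x))"
    by (rule inner[OF f _ lf]) (simp add: f'_def)
  have "form_theta \<alpha> \<beta> p U \<phi> = (\<integral>x. indicat_real {\<alpha><..<\<beta>} x *\<^sub>R (of_real (p x) * weak_deriv {0<..<1} U x * cnj (g x)) \<partial>lebesgue)"
    unfolding form_theta_def g_def by (rule integral_lebesgue_on) auto
  also have "\<dots> = (LINT x:{0..1}|lebesgue. W x * cnj (G x))"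
    unfolding set_lebesgue_integral_def
  proof (rule integral_cong_AE)
    have H: "U \<in> H1 {0<..<1}" "\<phi> \<in> H1 {0<..<1}" using UV(1) phi by (auto simp: V_theta_def H1_theta_def)
    have m: "(\<lambda>x. indicat_real {0<..<1} x *\<^sub>R weak_deriv {0<..<1} U x) \<in> borel_measurable lebesgue"
      "(\<lambda>x. indicat_real {0<..<1} x *\<^sub>R g x) \<in> borel_measurable lebesgue"
      using weak_deriv_spec(1)[OF H(1)] weak_deriv_spec(1)[OF H(2)] by (simp_all add: L2_iff g_def)
    have mi: "indicat_real {\<alpha><..<\<beta>} \<in> borel_measurable lebesgue" by (intro borel_measurable_indicator) auto
    have mp: "(\<lambda>x. complex_of_real (p x)) \<in> borel_measurable lebesgue" using p_meas by simp
    have "(\<lambda>x. indicat_real {\<alpha><..<\<beta>} x *\<^sub>R (of_real (p x) * (indicat_real {0<..<1} x *\<^sub>R weak_deriv {0<..<1} U x) * cnj (indicat_real {0<..<1} x *\<^sub>R g x))) \<in> borel_measurable lebesgue"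
      by (rule borel_measurable_scaleR[OF mi borel_measurable_times[OF borel_measurable_times[OF mp m(1)] borel_measurable_cnj[OF m(2)]]])
    moreover have "indicat_real {\<alpha><..<\<beta>} x *\<^sub>R (of_real (p x) * (indicat_real {0<..<1} x *\<^sub>R weak_deriv {0<..<1} U x) * cnj (indicat_real {0<..<1} x *\<^sub>R g x))
       = indicat_real {\<alpha><..<\<beta>} x *\<^sub>R (of_real (p x) * weak_deriv {0<..<1} U x * cnj (g x))" for x
      using ab by (cases "x \<in> {\<alpha><..<\<beta>}") auto
    ultimately show "(\<lambda>x. indicat_real {\<alpha><..<\<beta>} x *\<^sub>R (of_real (p x) * weak_deriv {0<..<1} U x * cnj (g x))) \<in> borel_measurable lebesgue"
      by (simp only:)
    show "(\<lambda>x. indicat_real {0..1} x *\<^sub>R (W x * cnj (G x))) \<in> borel_measurable lebesgue"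
      by (rule borel_measurable_integrable[OF loc_intD[OF lG, unfolded set_integrable_def]])
    show "AE x in lebesgue. indicat_real {\<alpha><..<\<beta>} x *\<^sub>R (of_real (p x) * weak_deriv {0<..<1} U x * cnj (g x)) = indicat_real {0..1} x *\<^sub>R (W x * cnj (G x))"
      using UV(2) F(4) q_in
    proof eventually_elim
      case (elim x)
      consider "x \<in> {\<alpha><..<\<beta>}" | "x \<in> {0<..<1} - {\<alpha><..<\<beta>}" | "x \<notin> {0<..<1}" by auto
      then show ?case
      proof cases
        case 1
        then have x: "x \<in> {0<..<1}" using ab by auto
        have "complex_of_real (p x) * (of_real (q x) * W x) = of_real (p x * q x) * W x" by simp
        also have "\<dots> = W x" using elim(3) 1 by simp
        finally show ?thesis using elim(1) x 1 by (simp add: G_def)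
      next
        case 2
        then show ?thesis using elim(2) by (simp add: G_def)
      next
        case 3
        then show ?thesis using ab by (auto simp: G_def indicator_def)
      qed
    qed
  qed
  finally show "form_theta \<alpha> \<beta> p U \<phi> - lam * L2inner QM U \<phi> = L2inner QM f \<phi>"
    using 1 2 3 by simp
qed

lemma form_theta_cnj: "form_theta \<alpha> \<beta> p u v = cnj (form_theta \<alpha> \<beta> p v u)"
  unfolding form_theta_def Bochner_Integration.integral_cnj[symmetric] by (simp add: mult_ac)

lemma zero_V: "(\<lambda>_. 0) \<in> V_theta \<alpha> \<beta> p \<theta>" "AE x in lebesgue. x \<in> {0<..<1} \<longrightarrow> weak_deriv {0<..<1} (\<lambda>_. 0) x = 0"
proof -
  have "(\<lambda>_. 0) \<in> L2 QM" by (simp add: L2_def)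
  from ac_in_V_theta[OF ac_const[of 0] this, of \<theta>]
  show "(\<lambda>_. 0) \<in> V_theta \<alpha> \<beta> p \<theta>" "AE x in lebesgue. x \<in> {0<..<1} \<longrightarrow> weak_deriv {0<..<1} (\<lambda>_. 0) x = 0"
    by auto
qed

lemma form_theta_zero: "form_theta \<alpha> \<beta> p (\<lambda>_. 0) \<phi> = 0"
proof -
  have "AE x in lebesgue. x \<in> {\<alpha><..<\<beta>} \<longrightarrow> of_real (p x) * weak_deriv {0<..<1} (\<lambda>_. 0) x * cnj (weak_deriv {0<..<1} \<phi> x) = 0"
    using zero_V(2) by eventually_elim (use ab in auto)
  then have "AE x in lebesgue_on {\<alpha><..<\<beta>}. of_real (p x) * weak_deriv {0<..<1} (\<lambda>_. 0) x * cnj (weak_deriv {0<..<1} \<phi> x) = 0"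
    by (rule AE_lebesgue_on[THEN iffD2, rotated]) simp
  then show ?thesis unfolding form_theta_def by (rule integral_eq_zero_AE)
qed

lemma q_not_null: "\<not> (AE x in lebesgue. x \<in> {0<..<1} \<longrightarrow> q x = 0)"
proof
  assume "AE x in lebesgue. x \<in> {0<..<1} \<longrightarrow> q x = 0"
  with q_in have "AE x in lebesgue. x \<notin> {\<alpha><..<\<beta>}"
    by eventually_elim (use ab in auto)
  then have "{\<alpha><..<\<beta>} \<in> null_sets lebesgue" by (subst AE_iff_null_sets) auto
  then show False using ab by (simp add: null_sets_def)
qed

text \<open>The problem lives on one cell, so an eigenvector of the monodromy matrix supplies both
  boundary conditions. \<open>ode_sol_nontrivial\<close> ensures that \<open>u\<close> itself, and
  not only the flux, is nonzero.\<close>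

lemma eigenfunction_theta:
  assumes "discr 1 lam = of_real (2 * cos (2 * pi * \<theta>))"
  obtains u where "u \<in> V_theta \<alpha> \<beta> p \<theta>" "\<not> (AE x in QM. u x = 0)"
    "\<And>\<phi>. \<phi> \<in> V_theta \<alpha> \<beta> p \<theta> \<Longrightarrow> form_theta \<alpha> \<beta> p u \<phi> - lam * L2inner QM u \<phi> = 0"
proof -
  have "(cis (2 * pi * \<theta>))\<^sup>2 - discr 1 lam * cis (2 * pi * \<theta>) + 1 = 0"
    by (simp add: floquet_polynomial assms)
  from floquet_initial[OF this] obtain u w where uw: "ode_sol q lam u w" "u 0 \<noteq> 0 \<or> w 0 \<noteq> 0"
    "u 1 = cis (2 * pi * \<theta>) * u 0" "w 1 = cis (2 * pi * \<theta>) * w 0" by blast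
  have f0: "(\<lambda>_. 0) \<in> L2 QM" by (simp add: L2_def)
  have U: "has_ac_deriv u (\<lambda>x. of_real (q x) * w x)"
    and W: "has_ac_deriv w (\<lambda>x. - lam * u x - indicat_real {0<..<1} x *\<^sub>R 0)"
    using uw(1) by (auto simp: ode_sol_def)
  note wf = weak_form_theta[OF U W uw(3,4) f0]
  obtain x where x: "x \<in> {0<..<1}" "u x \<noteq> 0"
    using ode_sol_nontrivial[OF uw(1,2) _ q_not_null] by auto
  have "\<not> (AE x in QM. u x = 0)"
  proof
    assume "AE x in QM. u x = 0"
    then have "AE x in lebesgue. x \<in> {0<..<1} \<longrightarrow> u x = 0" by (simp add: AE_lebesgue_on)
    from continuous_AE_eq[OF continuous_on_subset[OF ac_continuous[OF U]] _ _ this, of x] x show False by auto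
  qed
  moreover have "form_theta \<alpha> \<beta> p u \<phi> - lam * L2inner QM u \<phi> = 0" if "\<phi> \<in> V_theta \<alpha> \<beta> p \<theta>" for \<phi>
    using wf(2)[OF that] by (simp add: L2inner_def)
  ultimately show ?thesis using wf(1) that by blast
qed

lemma eigenvalue_theta:
  assumes "discr 1 lam = of_real (2 * cos (2 * pi * \<theta>))"
  shows "lam \<in> spec_A_theta \<alpha> \<beta> p \<theta>"
proof -
  obtain u where u: "u \<in> V_theta \<alpha> \<beta> p \<theta>" "\<not> (AE x in QM. u x = 0)"
    "\<And>\<phi>. \<phi> \<in> V_theta \<alpha> \<beta> p \<theta> \<Longrightarrow> form_theta \<alpha> \<beta> p u \<phi> - lam * L2inner QM u \<phi> = 0"
    using eigenfunction_theta[OF assms] by blast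
  have "(\<lambda>_. 0) \<in> Hspace_theta \<alpha> \<beta> p \<theta>"
    unfolding Hspace_theta_def using zero_V(1)[of \<theta>] V_theta_L2[of \<theta>]
    by (auto intro!: bexI[of _ "\<lambda>_. 0"] simp: L2norm_def)
  then have "\<not> form_resolvent QM (Hspace_theta \<alpha> \<beta> p \<theta>) (V_theta \<alpha> \<beta> p \<theta>) (form_theta \<alpha> \<beta> p) lam"
    by (intro form_not_resolventI[where u = u] zero_V(1) form_theta_zero u)
  then show ?thesis by (simp add: spec_A_theta_def form_spectrum_def)
qed

text \<open>The form is real on the diagonal and the eigenfunction has nonzero norm. Its later use
  is to show that the limit discriminant is not constant.\<close>

lemma eigenvalue_real:
  assumes "discr 1 lam = of_real (2 * cos (2 * pi * \<theta>))" shows "Im lam = 0"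
proof -
  obtain u where u: "u \<in> V_theta \<alpha> \<beta> p \<theta>" "\<not> (AE x in QM. u x = 0)"
    "\<And>\<phi>. \<phi> \<in> V_theta \<alpha> \<beta> p \<theta> \<Longrightarrow> form_theta \<alpha> \<beta> p u \<phi> - lam * L2inner QM u \<phi> = 0"
    using eigenfunction_theta[OF assms] by blast
  define n where "n = (\<integral>x. (cmod (u x))\<^sup>2 \<partial>QM)"
  have n: "L2inner QM u u = of_real n" unfolding n_def by (rule L2inner_self)
  have "n \<noteq> 0" using L2inner_self_eq_0[of u QM] u(1,2) V_theta_L2 n by auto
  have "form_theta \<alpha> \<beta> p u u = lam * of_real n" using u(3)[OF u(1)] by (simp add: n)
  moreover have "Im (form_theta \<alpha> \<beta> p u u) = 0"
    using arg_cong[OF form_theta_cnj[of u u], of Im] by simp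
  ultimately show ?thesis using \<open>n \<noteq> 0\<close> by simp
qed

text \<open>The variance of \<open>cmod f\<close> is nonnegative, the unit cell having measure
  1.\<close>

lemma L1_le_L2_Q:
  assumes "f \<in> L2 QM" shows "(\<integral>x. cmod (f x) \<partial>QM) \<le> L2norm QM f"
proof -
  have m: "f \<in> borel_measurable QM" and i2: "integrable QM (\<lambda>x. (cmod (f x))\<^sup>2)"
    using assms by (auto simp: L2_def)
  have one: "(\<lambda>_. 1) \<in> L2 QM" by (intro continuous_L2_Q continuous_intros)
  have i1: "integrable QM (\<lambda>x. cmod (f x))"
    using integrable_norm[OF L2_mult_integrable[OF assms one]] by simp
  have "integrable QM (\<lambda>_. 1 :: real)" using one by (simp add: L2_def)
  then have ic: "integrable QM (\<lambda>_. c)" for c :: real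
    using Bochner_Integration.integrable_mult_right[of c QM "\<lambda>_. 1"] by simp
  have mu: "(\<integral>x. c \<partial>QM) = c" for c :: real
    by (simp add: measure_restrict_space)
  define F where "F = (\<integral>x. cmod (f x) \<partial>QM)"
  have "0 \<le> (\<integral>x. (cmod (f x) - F)\<^sup>2 \<partial>QM)" by simp
  also have "\<dots> = (\<integral>x. (cmod (f x))\<^sup>2 - 2 * F * cmod (f x) + F\<^sup>2 \<partial>QM)"
    by (simp add: power2_diff algebra_simps)
  also have "\<dots> = (\<integral>x. (cmod (f x))\<^sup>2 \<partial>QM) - 2 * F * F + F\<^sup>2"
    using i1 i2 ic mu by (simp add: F_def)
  finally have "F\<^sup>2 \<le> (\<integral>x. (cmod (f x))\<^sup>2 \<partial>QM)" by (simp add: power2_eq_square)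
  then show ?thesis unfolding L2norm_def F_def[symmetric] by (rule real_le_rsqrt)
qed

text \<open>Variation of parameters: the terms with \<open>f\<close> cancel in the first equation
  and add up to \<open>- f\<close> in the second, because the Wronskian is 1.\<close>

lemma particular_solution:
  fixes lam :: complex and f :: "real \<Rightarrow> complex"
  assumes f: "loc_int f"
  defines "A \<equiv> primitive (\<lambda>x. u2 lam x * f x)" and "B \<equiv> primitive (\<lambda>x. u1 lam x * f x)"
  shows "has_ac_deriv (\<lambda>x. u1 lam x * A x - u2 lam x * B x) (\<lambda>x. of_real (q x) * (w1 lam x * A x - w2 lam x * B x))"
    and "has_ac_deriv (\<lambda>x. w1 lam x * A x - w2 lam x * B x) (\<lambda>x. - lam * (u1 lam x * A x - u2 lam x * B x) - f x)"
proof -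
  note s = fundamental_sols[of lam, unfolded ode_sol_def]
  have A: "has_ac_deriv A (\<lambda>x. u2 lam x * f x)"
    unfolding A_def by (rule ac_primitive[OF loc_int_mult[OF ac_continuous f]]) (use s in blast)
  have B: "has_ac_deriv B (\<lambda>x. u1 lam x * f x)"
    unfolding B_def by (rule ac_primitive[OF loc_int_mult[OF ac_continuous f]]) (use s in blast)
  have "has_ac_deriv (\<lambda>x. u1 lam x * A x - u2 lam x * B x)
     (\<lambda>x. (of_real (q x) * w1 lam x * A x + u1 lam x * (u2 lam x * f x)) - (of_real (q x) * w2 lam x * B x + u2 lam x * (u1 lam x * f x)))"
    by (intro ac_diff ac_mult A B; use s in simp)
  then show "has_ac_deriv (\<lambda>x. u1 lam x * A x - u2 lam x * B x) (\<lambda>x. of_real (q x) * (w1 lam x * A x - w2 lam x * B x))"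
    by (rule ac_cong) (simp_all add: algebra_simps)
  have "has_ac_deriv (\<lambda>x. w1 lam x * A x - w2 lam x * B x)
     (\<lambda>x. (- lam * u1 lam x * A x + w1 lam x * (u2 lam x * f x)) - (- lam * u2 lam x * B x + w2 lam x * (u1 lam x * f x)))"
    by (intro ac_diff ac_mult A B; use s in simp)
  then show "has_ac_deriv (\<lambda>x. w1 lam x * A x - w2 lam x * B x) (\<lambda>x. - lam * (u1 lam x * A x - u2 lam x * B x) - f x)"
  proof (rule ac_cong)
    fix x
    show "(- lam * u1 lam x * A x + w1 lam x * (u2 lam x * f x)) - (- lam * u2 lam x * B x + w2 lam x * (u1 lam x * f x))
       = - lam * (u1 lam x * A x - u2 lam x * B x) - f x"
      using wronskian[of lam x] by algebra
  qed simp
qed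

text \<open>A particular solution with zero data at 0 is corrected by a combination of
  \<open>u1\<close> and \<open>u2\<close> to meet the quasi-periodic conditions; the linear system
  for this is regular because \<open>cis (2 * pi * \<theta>)\<close> is not an eigenvalue of the
  monodromy matrix.\<close>

lemma solve_theta:
  assumes d: "discr 1 lam \<noteq> of_real (2 * cos (2 * pi * \<theta>))"
  shows "\<exists>K. \<forall>f \<in> L2 QM. \<exists>U \<in> V_theta \<alpha> \<beta> p \<theta>.
    (\<forall>\<phi> \<in> V_theta \<alpha> \<beta> p \<theta>. form_theta \<alpha> \<beta> p U \<phi> - lam * L2inner QM U \<phi> = L2inner QM f \<phi>) \<and> L2norm QM U \<le> K * L2norm QM f"
proof -
  define z where "z = cis (2 * pi * \<theta>)"
  define a b c e where abce: "a = u1 lam 1" "b = u2 lam 1" "c = w1 lam 1" "e = w2 lam 1"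
  \<comment> \<open>The determinant of the monodromy matrix minus \<open>z\<close> times the
    identity, that is, the characteristic polynomial at \<open>z\<close>.\<close>
  define dt where "dt = (a - z) * (e - z) - b * c"
  have "dt = z\<^sup>2 - discr 1 lam * z + 1"
    using wronskian[of lam 1] unfolding dt_def discr_def abce by algebra
  then have dt: "dt \<noteq> 0" using d by (simp add: z_def floquet_polynomial)
  note s = fundamental_sols[of lam, unfolded ode_sol_def]
  have cont: "continuous_on UNIV (u1 lam)" "continuous_on UNIV (u2 lam)" "continuous_on UNIV (w1 lam)" "continuous_on UNIV (w2 lam)"
    using s ac_continuous by blast+
  have "bounded ((\<lambda>x. (u1 lam x, u2 lam x, w1 lam x, w2 lam x)) ` {0..1})"
    by (intro compact_imp_bounded compact_continuous_image continuous_intros continuous_on_subset[OF cont(1)]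
        continuous_on_subset[OF cont(2)] continuous_on_subset[OF cont(3)] continuous_on_subset[OF cont(4)]) auto
  then obtain K where K: "\<forall>x\<in>{0..1}. norm (u1 lam x, u2 lam x, w1 lam x, w2 lam x) \<le> K"
    by (auto simp: bounded_iff)
  have K': "norm (u1 lam x) \<le> K" "norm (u2 lam x) \<le> K" "norm (w1 lam x) \<le> K" "norm (w2 lam x) \<le> K" if "x \<in> {0..1}" for x
    using K[rule_format, OF that] norm_fst_le[of "u1 lam x" "(u2 lam x, w1 lam x, w2 lam x)"]
      norm_snd_le[of "(u2 lam x, w1 lam x, w2 lam x)" "u1 lam x"] norm_fst_le[of "u2 lam x" "(w1 lam x, w2 lam x)"]
      norm_snd_le[of "(w1 lam x, w2 lam x)" "u2 lam x"] norm_fst_le[of "w1 lam x" "w2 lam x"] norm_snd_le[of "w2 lam x" "w1 lam x"]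
    by linarith+
  have K0: "0 \<le> K" using K'(1)[of 0] norm_ge_zero order_trans by fastforce
  \<comment> \<open>Bounds the Cramer quotients below: matrix entries over the determinant, times
    the bound \<open>2 * K * K\<close> for the particular solution per unit of the L1 norm
    \<open>F\<close> of the data.\<close>
  define K4 where "K4 = (norm (a - z) + norm (e - z) + norm b + norm c) * (2 * K * K) / norm dt"
  have K4: "0 \<le> K4" unfolding K4_def using K0 by (intro divide_nonneg_nonneg mult_nonneg_nonneg add_nonneg_nonneg) auto
  define K5 where "K5 = 2 * K * K + 2 * K * K4"
  show ?thesis
  proof (intro exI[of _ K5] ballI)
    fix f assume f: "f \<in> L2 QM"
    define f' where "f' = (\<lambda>x. indicat_real {0<..<1} x *\<^sub>R f x)"
    have lf: "loc_int f'" unfolding f'_def by (rule L2_loc_int[OF _ f]) auto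
    define F where "F = (\<integral>x. cmod (f x) \<partial>QM)"
    have F0: "0 \<le> F" unfolding F_def by simp
    have intf: "integrable lebesgue (\<lambda>x. cmod (f' x))"
    proof -
      have "(\<lambda>_. 1) \<in> L2 QM" by (intro continuous_L2_Q continuous_intros)
      from integrable_norm[OF L2_mult_integrable[OF f this]]
      have "integrable QM (\<lambda>x. cmod (f x))" by simp
      then show ?thesis by (simp add: integrable_lebesgue_on f'_def)
    qed
    have Feq: "F = (\<integral>x. cmod (f' x) \<partial>lebesgue)"
      unfolding F_def f'_def by (subst integral_lebesgue_on) auto
    have prim: "norm (primitive (\<lambda>x. v x * f' x) x) \<le> K * F"
      if v: "continuous_on UNIV v" "\<And>x. x \<in> {0..1} \<Longrightarrow> norm (v x) \<le> K" and x: "x \<in> {0..1}" for v x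
    proof -
      have l: "loc_int (\<lambda>x. v x * f' x)" by (rule loc_int_mult[OF v(1) lf])
      have "primitive (\<lambda>x. v x * f' x) x = (\<integral>t. indicat_real {0..x} t *\<^sub>R (v t * f' t) \<partial>lebesgue)"
        using ac_integral[OF ac_primitive[OF l], of 0 x] x by (simp add: set_lebesgue_integral_def)
      also have "norm \<dots> \<le> (\<integral>t. K * cmod (f' t) \<partial>lebesgue)"
      proof (rule Bochner_Integration.integral_norm_bound_integral)
        show "integrable lebesgue (\<lambda>t. indicat_real {0..x} t *\<^sub>R (v t * f' t))"
          using loc_intD[OF l] by (simp add: set_integrable_def)
        show "integrable lebesgue (\<lambda>t. K * cmod (f' t))" using intf by simp
        show "norm (indicat_real {0..x} t *\<^sub>R (v t * f' t)) \<le> K * cmod (f' t)" for t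
          using v(2)[of t] x K0 by (auto simp: indicator_def norm_mult intro!: mult_right_mono)
      qed
      also have "\<dots> = K * F" by (simp add: Feq)
      finally show ?thesis .
    qed
    define A B where "A = primitive (\<lambda>x. u2 lam x * f' x)" and "B = primitive (\<lambda>x. u1 lam x * f' x)"
    define up wp where "up = (\<lambda>x. u1 lam x * A x - u2 lam x * B x)" and "wp = (\<lambda>x. w1 lam x * A x - w2 lam x * B x)"
    have part: "has_ac_deriv up (\<lambda>x. of_real (q x) * wp x)" "has_ac_deriv wp (\<lambda>x. - lam * up x - f' x)"
      unfolding up_def wp_def A_def B_def by (rule particular_solution[OF lf])+
    have AB: "norm (A x) \<le> K * F" "norm (B x) \<le> K * F" if "x \<in> {0..1}" for x
      unfolding A_def B_def using prim[OF cont(2) K'(2) that] prim[OF cont(1) K'(1) that] by auto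
    have pb: "norm (up x) \<le> 2 * K * K * F" "norm (wp x) \<le> 2 * K * K * F" if x: "x \<in> {0..1}" for x
    proof -
      have *: "norm (s * A x - t * B x) \<le> 2 * K * K * F" if "norm s \<le> K" "norm t \<le> K" for s t
      proof -
        have "norm (s * A x - t * B x) \<le> norm s * norm (A x) + norm t * norm (B x)"
          using norm_triangle_ineq4[of "s * A x" "t * B x"] by (simp add: norm_mult)
        also have "\<dots> \<le> K * (K * F) + K * (K * F)"
          using that AB[OF x] K0 by (intro add_mono mult_mono) auto
        also have "\<dots> = 2 * K * K * F" by simp
        finally show ?thesis .
      qed
      show "norm (up x) \<le> 2 * K * K * F" "norm (wp x) \<le> 2 * K * K * F"
        unfolding up_def wp_def using * K'[OF x] by auto
    qed
    \<comment> \<open>Cramer's rule for cancelling the defect \<open>(up 1, wp 1)\<close>, which is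
      the whole boundary defect because \<open>up\<close> and \<open>wp\<close> vanish at 0.\<close>
    define c1 c2 where "c1 = - ((e - z) * up 1 - b * wp 1) / dt" and "c2 = - ((a - z) * wp 1 - c * up 1) / dt"
    have ceq: "(a - z) * c1 + b * c2 = - up 1" "c * c1 + (e - z) * c2 = - wp 1"
    proof -
      have "dt * c1 = - ((e - z) * up 1 - b * wp 1)" "dt * c2 = - ((a - z) * wp 1 - c * up 1)"
        using dt by (simp_all add: c1_def c2_def)
      then have "dt * ((a - z) * c1 + b * c2) = dt * (- up 1)" "dt * (c * c1 + (e - z) * c2) = dt * (- wp 1)"
        unfolding dt_def by algebra+
      then show "(a - z) * c1 + b * c2 = - up 1" "c * c1 + (e - z) * c2 = - wp 1"
        using mult_left_cancel[OF dt] by blast+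
    qed
    have cb: "norm c1 \<le> K4 * F" "norm c2 \<le> K4 * F"
    proof -
      have *: "norm (- (s * up 1 - t * wp 1) / dt) \<le> K4 * F" "norm (- (s * wp 1 - t * up 1) / dt) \<le> K4 * F"
        if "norm s + norm t \<le> norm (a - z) + norm (e - z) + norm b + norm c" for s t
      proof -
        have 1: "norm x \<le> 2 * K * K * F \<Longrightarrow> norm y \<le> 2 * K * K * F \<Longrightarrow> norm (- (s * x - t * y) / dt) \<le> K4 * F" for x y
        proof -
          assume x: "norm x \<le> 2 * K * K * F" "norm y \<le> 2 * K * K * F"
          have "norm (s * x - t * y) \<le> norm s * norm x + norm t * norm y"
            using norm_triangle_ineq4[of "s * x" "t * y"] by (simp add: norm_mult)
          also have "\<dots> \<le> norm s * (2 * K * K * F) + norm t * (2 * K * K * F)"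
            using x by (intro add_mono mult_left_mono) auto
          also have "\<dots> = (norm s + norm t) * (2 * K * K * F)" by (simp add: algebra_simps)
          also have "\<dots> \<le> (norm (a - z) + norm (e - z) + norm b + norm c) * (2 * K * K * F)"
            using that K0 F0 by (intro mult_right_mono) auto
          finally have "norm (s * x - t * y) / norm dt \<le> (norm (a - z) + norm (e - z) + norm b + norm c) * (2 * K * K * F) / norm dt"
            by (rule divide_right_mono) simp
          moreover have "norm (- (s * x - t * y) / dt) = norm (s * x - t * y) / norm dt"
            by (simp only: norm_divide norm_minus_cancel)
          ultimately show ?thesis by (simp add: K4_def)
        qed
        show "norm (- (s * up 1 - t * wp 1) / dt) \<le> K4 * F" "norm (- (s * wp 1 - t * up 1) / dt) \<le> K4 * F"
          by (rule 1; rule pb; simp)+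
      qed
      show "norm c1 \<le> K4 * F" "norm c2 \<le> K4 * F"
        unfolding c1_def c2_def by (rule *; simp)+
    qed
    define U W where "U = (\<lambda>x. up x + (c1 * u1 lam x + c2 * u2 lam x))" and "W = (\<lambda>x. wp x + (c1 * w1 lam x + c2 * w2 lam x))"
    note lc = ode_sol_lincomb[OF fundamental_sols, of lam c1 c2, unfolded ode_sol_def]
    have U: "has_ac_deriv U (\<lambda>x. of_real (q x) * W x)"
      by (rule ac_cong[OF ac_add[OF part(1) conjunct1[OF lc]]]) (simp_all add: U_def W_def algebra_simps)
    have W: "has_ac_deriv W (\<lambda>x. - lam * U x - indicat_real {0<..<1} x *\<^sub>R f x)"
      by (rule ac_cong[OF ac_add[OF part(2) conjunct2[OF lc]]]) (simp_all add: U_def W_def f'_def algebra_simps)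
    have p0: "up 0 = 0" "wp 0 = 0" by (simp_all add: up_def wp_def A_def B_def)
    have b1: "U 1 = cis (2 * pi * \<theta>) * U 0" "W 1 = cis (2 * pi * \<theta>) * W 0"
      unfolding z_def[symmetric] U_def W_def p0 abce[symmetric] init using ceq by algebra+
    note wf = weak_form_theta[OF U W b1 f]
    have Ub: "norm (U x) \<le> K5 * F" if x: "x \<in> {0..1}" for x
    proof -
      have "norm (c1 * u1 lam x + c2 * u2 lam x) \<le> norm c1 * norm (u1 lam x) + norm c2 * norm (u2 lam x)"
        by (rule order_trans[OF norm_triangle_ineq]) (simp only: norm_mult order_refl)
      also have "\<dots> \<le> (K4 * F) * K + (K4 * F) * K"
        using cb K'[OF x] K4 F0 by (intro add_mono mult_mono) auto
      finally have "norm (c1 * u1 lam x + c2 * u2 lam x) \<le> 2 * K * K4 * F" by (simp add: mult_ac)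
      with pb(1)[OF x] norm_triangle_ineq[of "up x" "c1 * u1 lam x + c2 * u2 lam x"]
      show ?thesis unfolding U_def K5_def by (simp add: algebra_simps)
    qed
    have K5: "0 \<le> K5" unfolding K5_def using K0 K4 by simp
    have "L2norm QM U \<le> K5 * F"
    proof -
      have "(\<integral>x. (cmod (U x))\<^sup>2 \<partial>QM) \<le> (\<integral>x. (K5 * F)\<^sup>2 \<partial>QM)"
      proof (rule integral_mono)
        show "integrable QM (\<lambda>x. (cmod (U x))\<^sup>2)"
          using continuous_L2_Q[OF ac_continuous[OF U]] by (simp add: L2_def)
        have "(\<lambda>_. complex_of_real (K5 * F)) \<in> L2 QM" by (intro continuous_L2_Q continuous_intros)
        then show "integrable QM (\<lambda>x. (K5 * F)\<^sup>2)" using K5 F0 by (simp add: L2_def norm_mult)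
        show "(cmod (U x))\<^sup>2 \<le> (K5 * F)\<^sup>2" if "x \<in> space QM" for x
        proof (intro power_mono Ub)
          show "x \<in> {0..1}" using that by (simp add: space_restrict_space)
        qed simp
      qed
      also have "\<dots> = (K5 * F)\<^sup>2" by (simp add: measure_restrict_space)
      finally show ?thesis unfolding L2norm_def using K5 F0 by (intro real_le_lsqrt) auto
    qed
    also have "\<dots> \<le> K5 * L2norm QM f" using L1_le_L2_Q[OF f] K5 by (intro mult_left_mono) (auto simp: F_def)
    finally show "\<exists>U\<in>V_theta \<alpha> \<beta> p \<theta>. (\<forall>\<phi>\<in>V_theta \<alpha> \<beta> p \<theta>. form_theta \<alpha> \<beta> p U \<phi> - lam * L2inner QM U \<phi> = L2inner QM f \<phi>) \<and> L2norm QM U \<le> K5 * L2norm QM f"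
      using wf by (intro bexI[of _ U]) auto
  qed
qed

theorem spec_A_theta_iff:
  "lam \<in> spec_A_theta \<alpha> \<beta> p \<theta> \<longleftrightarrow> discr 1 lam = of_real (2 * cos (2 * pi * \<theta>))"
proof
  show "lam \<in> spec_A_theta \<alpha> \<beta> p \<theta>" if "discr 1 lam = of_real (2 * cos (2 * pi * \<theta>))"
    by (rule eigenvalue_theta[OF that])
next
  show "discr 1 lam = of_real (2 * cos (2 * pi * \<theta>))" if lam: "lam \<in> spec_A_theta \<alpha> \<beta> p \<theta>"
  proof (rule ccontr)
    assume d: "discr 1 lam \<noteq> of_real (2 * cos (2 * pi * \<theta>))"
    \<comment> \<open>The two traces are conjugate and the excluded value is real, so the problem at
      \<open>cnj lam\<close> is solvable as well, which is the dual half of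
      \<open>form_resolventI\<close>.\<close>
    then have d': "discr 1 (cnj lam) \<noteq> of_real (2 * cos (2 * pi * \<theta>))"
      unfolding discr_cnj by (metis complex_cnj_cnj complex_cnj_complex_of_real)
    have "form_resolvent QM (Hspace_theta \<alpha> \<beta> p \<theta>) (V_theta \<alpha> \<beta> p \<theta>) (form_theta \<alpha> \<beta> p) lam"
      by (rule form_resolventI[OF V_theta_L2 _ form_theta_cnj solve_theta[OF d]])
         (use solve_theta[OF d'] in \<open>auto simp: Hspace_theta_def\<close>)
    with lam show False by (simp add: spec_A_theta_def form_spectrum_def)
  qed
qed

end

section \<open>The periodic problem on the line\<close>

text \<open>\<open>F r - F (- r)\<close> converges to the integral \<open>L\<close> of
  \<open>f\<close>. If \<open>L\<close> were nonzero, \<open>norm (F r) + norm (F (- r))\<close>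
  would stay above \<open>norm L / 2\<close> for large \<open>r\<close>, which contradicts
  integrability of \<open>F\<close>.\<close>

lemma ac_integral_eq_0:
  assumes F: "has_ac_deriv F f" and iF: "integrable lebesgue F" and jf: "integrable lebesgue f"
  shows "(\<integral>x. f x \<partial>lebesgue) = 0"
proof (rule ccontr)
  define L where "L = (\<integral>x. f x \<partial>lebesgue)"
  assume "(\<integral>x. f x \<partial>lebesgue) \<noteq> 0"
  then have L: "norm L > 0" by (simp add: L_def)
  have "((\<lambda>r. \<integral>x. indicat_real {-r..r} x *\<^sub>R f x \<partial>lebesgue) \<longlongrightarrow> L) at_top"
    unfolding L_def
  proof (rule integral_dominated_convergence_at_top)
    show "integrable lebesgue (\<lambda>x. norm (f x))" using jf by simp
    show "f \<in> borel_measurable lebesgue" using jf by simp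
    show "(\<lambda>x. indicat_real {-r..r} x *\<^sub>R f x) \<in> borel_measurable lebesgue" for r
      by (rule borel_measurable_scaleR[OF borel_measurable_indicator borel_measurable_integrable[OF jf]]) simp
    show "\<forall>\<^sub>F r in at_top. AE x in lebesgue. norm (indicat_real {-r..r} x *\<^sub>R f x) \<le> norm (f x)"
      by (intro always_eventually allI AE_I2) (simp add: indicator_def)
    show "AE x in lebesgue. ((\<lambda>r. indicat_real {-r..r} x *\<^sub>R f x) \<longlongrightarrow> f x) at_top"
    proof (rule AE_I2)
      fix x
      show "((\<lambda>r. indicat_real {-r..r} x *\<^sub>R f x) \<longlongrightarrow> f x) at_top"
        by (rule Lim_transform_eventually[OF tendsto_const])
           (use eventually_ge_at_top[of "\<bar>x\<bar>"] in eventually_elim, auto simp: indicator_def)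
    qed
  qed
  from tendstoD[OF this, of "norm L / 2"] L
  obtain R0 where R0: "\<And>r. r \<ge> R0 \<Longrightarrow> dist (\<integral>x. indicat_real {-r..r} x *\<^sub>R f x \<partial>lebesgue) L < norm L / 2"
    unfolding eventually_at_top_linorder by auto
  define R where "R = max R0 0"
  have low: "norm L / 2 \<le> norm (F r) + norm (F (- r))" if "r \<ge> R" for r
  proof -
    have r: "r \<ge> R0" "-r \<le> r" using that by (auto simp: R_def)
    have "(\<integral>x. indicat_real {-r..r} x *\<^sub>R f x \<partial>lebesgue) = F r - F (- r)"
      using ac_integral[OF F r(2)] by (simp add: set_lebesgue_integral_def)
    then have "norm (F r - F (- r) - L) < norm L / 2" using R0[OF r(1)] by (simp add: dist_norm)
    then have "norm L / 2 \<le> norm (F r - F (- r))"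
      using norm_triangle_ineq2[of L "L - (F r - F (- r))"] by (simp add: norm_minus_commute)
    also have "\<dots> \<le> norm (F r) + norm (F (- r))" by (rule norm_triangle_ineq4)
    finally show ?thesis .
  qed
  define g where "g = (\<lambda>x. norm (F x) + norm (F (- x)))"
  have "integrable lebesgue (\<lambda>x. F (0 + (- 1) * x))" by (rule lebesgue_integrable_real_affine[OF iF]) simp
  then have gi: "integrable lebesgue g" using iF by (simp add: g_def)
  have "norm L / 2 * real n \<le> (\<integral>x. g x \<partial>lebesgue)" for n
  proof -
    have "(\<integral>x. indicat_real {R..R + real n} x * (norm L / 2) \<partial>lebesgue) \<le> (\<integral>x. g x \<partial>lebesgue)"
    proof (rule integral_mono[OF _ gi])
      show "integrable lebesgue (\<lambda>x. indicat_real {R..R + real n} x * (norm L / 2))"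
        by (intro integrable_mult_left integrable_real_indicator) (auto simp: emeasure_lborel_Icc_eq)
      show "indicat_real {R..R + real n} x * (norm L / 2) \<le> g x" for x
        using low[of x] by (auto simp: indicator_def g_def)
    qed
    then show ?thesis by (simp add: mult.commute)
  qed
  moreover obtain n where "(\<integral>x. g x \<partial>lebesgue) < real n * (norm L / 2)"
    using reals_Archimedean3[of "norm L / 2"] L by auto
  ultimately show False by (metis mult.commute not_le)
qed

lemma H1_UNIV_ac:
  assumes "\<phi> \<in> H1 UNIV"
  obtains F where "has_ac_deriv F (weak_deriv UNIV \<phi>)" "AE x in lebesgue. \<phi> x = F x"
    "F \<in> L2 lebesgue" "\<phi> \<in> L2 lebesgue" "weak_deriv UNIV \<phi> \<in> L2 lebesgue"
proof -
  obtain F where F: "has_ac_deriv F (\<lambda>x. indicat_real UNIV x *\<^sub>R weak_deriv UNIV \<phi> x)"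
    "AE x in lebesgue. x \<in> UNIV \<longrightarrow> \<phi> x = F x"
    using H1_imp_ac[OF open_UNIV is_interval_univ UNIV_not_empty assms] by blast
  have p: "\<phi> \<in> L2 lebesgue" using assms by (simp add: H1_def lebesgue_on_UNIV_eq)
  have "integrable lebesgue (\<lambda>x. (cmod (F x))\<^sup>2)"
  proof (rule integrable_cong_AE_imp[of lebesgue "\<lambda>x. (cmod (\<phi> x))\<^sup>2"])
    show "integrable lebesgue (\<lambda>x. (cmod (\<phi> x))\<^sup>2)" using p by (simp add: L2_def)
    show "(\<lambda>x. (cmod (F x))\<^sup>2) \<in> borel_measurable lebesgue"
      using ac_measurable[OF F(1)] by measurable
    show "AE x in lebesgue. (cmod (\<phi> x))\<^sup>2 = (cmod (F x))\<^sup>2"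
      using F(2) by eventually_elim simp
  qed
  with ac_measurable[OF F(1)] have "F \<in> L2 lebesgue" by (simp add: L2_def)
  moreover have "weak_deriv UNIV \<phi> \<in> L2 lebesgue"
    using weak_deriv_spec(1)[OF assms] by (simp add: lebesgue_on_UNIV_eq)
  ultimately show ?thesis using F p by (intro that[of F]) auto
qed

lemma ac_H1_UNIV:
  assumes "has_ac_deriv U G" "U \<in> L2 lebesgue" "G \<in> L2 lebesgue"
  shows "U \<in> H1 UNIV" "AE x in lebesgue. weak_deriv UNIV U x = G x"
  using ac_imp_H1[OF open_UNIV is_interval_univ assms(1), of U] assms(2,3)
  by (auto simp: lebesgue_on_UNIV_eq)

lemma L2_bound:
  assumes "g \<in> borel_measurable M" "f \<in> L2 M" "\<And>x. norm (g x) \<le> c * norm (f x)"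
  shows "g \<in> L2 M"
proof -
  have "integrable M (\<lambda>x. (cmod (g x))\<^sup>2)"
  proof (rule Bochner_Integration.integrable_bound)
    show "integrable M (\<lambda>x. c\<^sup>2 * (cmod (f x))\<^sup>2)" using assms(2) by (simp add: L2_def)
    show "(\<lambda>x. (cmod (g x))\<^sup>2) \<in> borel_measurable M" using assms(1) by measurable
    have "(cmod (g x))\<^sup>2 \<le> (c * cmod (f x))\<^sup>2" for x by (rule power_mono[OF assms(3)]) simp
    then show "AE x in M. norm ((cmod (g x))\<^sup>2) \<le> norm (c\<^sup>2 * (cmod (f x))\<^sup>2)"
      by (intro AE_I2) (simp add: power_mult_distrib)
  qed
  with assms(1) show ?thesis by (simp add: L2_def)
qed

lemma L2_add:
  assumes "u \<in> L2 M" "v \<in> L2 M" shows "(\<lambda>x. u x + v x) \<in> L2 M"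
proof -
  have "(\<lambda>x. - v x) \<in> L2 M" using assms(2) by (simp add: L2_def)
  from L2_diff[OF assms(1) this] show ?thesis by simp
qed

lemma L2_cmult: "u \<in> L2 M \<Longrightarrow> (\<lambda>x. c * u x) \<in> L2 M"
  by (auto simp: L2_def norm_mult power_mult_distrib)

lemma L2_weight:
  assumes "bounded_weight C q" "u \<in> L2 lebesgue" shows "(\<lambda>x. of_real (q x) * u x) \<in> L2 lebesgue"
proof (rule L2_bound[OF _ assms(2), of _ C])
  show "(\<lambda>x. of_real (q x) * u x) \<in> borel_measurable lebesgue"
    using assms by (auto simp: L2_def bounded_weight_def)
  show "norm (of_real (q x) * u x) \<le> C * norm (u x)" for x
    using assms(1) by (auto simp: bounded_weight_def norm_mult intro: mult_right_mono)
qed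

text \<open>The product \<open>W * cnj F\<close> and its derivative are both integrable, so
  \<open>ac_integral_eq_0\<close> disposes of the boundary terms at infinity.\<close>

lemma ac_parts_UNIV:
  assumes W: "has_ac_deriv W w" and F: "has_ac_deriv F g"
    and L: "W \<in> L2 lebesgue" "w \<in> L2 lebesgue" "F \<in> L2 lebesgue" "g \<in> L2 lebesgue"
  shows "(\<integral>x. W x * cnj (g x) \<partial>lebesgue) = - (\<integral>x. w x * cnj (F x) \<partial>lebesgue)"
proof -
  note i = L2_mult_integrable[OF L(2,3)] L2_mult_integrable[OF L(1,4)]
  have "(\<integral>x. w x * cnj (F x) + W x * cnj (g x) \<partial>lebesgue) = 0"
    by (rule ac_integral_eq_0[OF ac_mult[OF W ac_cnj[OF F]] L2_mult_integrable[OF L(1,3)]]) (use i in auto)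
  then show ?thesis using i by (simp add: add_eq_0_iff)
qed

definition form_line :: "(real \<Rightarrow> real) \<Rightarrow> (real \<Rightarrow> complex) \<Rightarrow> (real \<Rightarrow> complex) \<Rightarrow> complex" where
  "form_line a u v = (\<integral>x. of_real (a x) * weak_deriv UNIV u x * cnj (weak_deriv UNIV v x) \<partial>lebesgue)"

lemma form_line_cnj: "form_line a u v = cnj (form_line a v u)"
  unfolding form_line_def Bochner_Integration.integral_cnj[symmetric] by (simp add: mult_ac)

section \<open>Exponential kernels, Floquet solutions that decay, and the resolvent on the
  line\<close>

lemma exp_abs_integrable:
  fixes k :: real
  assumes k: "k > 0" shows "integrable lebesgue (\<lambda>t. exp (- (k * \<bar>t\<bar>)))"
proof -
  have 1: "(\<lambda>t. exp (- k * t)) absolutely_integrable_on {0..}"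
    by (rule nonnegative_absolutely_integrable_1[OF integrable_on_exp_minus_to_infinity[OF k]]) simp
  have "(\<lambda>t. exp (- k * (- t))) absolutely_integrable_on uminus ` {0..}"
  proof (rule absolutely_integrable_spike_set_eq[THEN iffD1])
    have "integrable lebesgue (\<lambda>t. indicat_real {0..} (0 + (-1) * t) *\<^sub>R exp (- k * (0 + (-1) * t)))"
      using 1 unfolding set_integrable_def by (rule lebesgue_integrable_real_affine) simp
    moreover have "indicat_real {0..} (0 + (-1) * t) = indicat_real {..0} t" for t :: real by (auto simp: indicator_def)
    ultimately show "(\<lambda>t. exp (- k * (- t))) absolutely_integrable_on {..0}" by (simp add: set_integrable_def)
    have "uminus ` {0..} = {..0::real}" by (auto simp: image_iff intro: bexI[of _ "- x" for x])
    then show "negligible {x \<in> {..0} - uminus ` {0..}. exp (- k * (- x)) \<noteq> 0}"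
      "negligible {x \<in> uminus ` {0..} - {..0}. exp (- k * (- x)) \<noteq> 0}" by auto
  qed
  moreover have im: "uminus ` {0..} = {..0::real}" by (auto simp: image_iff intro: bexI[of _ "- x" for x])
  ultimately have 2: "integrable lebesgue (\<lambda>t. indicat_real {..0} t *\<^sub>R exp (k * t))"
    by (simp add: set_integrable_def)
  have "integrable lebesgue (\<lambda>t. indicat_real {0..} t *\<^sub>R exp (- k * t) + indicat_real {..0} t *\<^sub>R exp (k * t))"
    using 1 2 by (auto simp: set_integrable_def)
  then show ?thesis
  proof (rule Bochner_Integration.integrable_bound)
    have "continuous_on UNIV (\<lambda>t. complex_of_real (exp (- (k * \<bar>t\<bar>))))" by (intro continuous_intros)
    from loc_int_measurable[OF loc_int_continuous[OF this]]
    have "(\<lambda>t. Re (complex_of_real (exp (- (k * \<bar>t\<bar>))))) \<in> borel_measurable lebesgue" by measurable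
    then show "(\<lambda>t. exp (- (k * \<bar>t\<bar>))) \<in> borel_measurable lebesgue" by simp
    show "AE t in lebesgue. norm (exp (- (k * \<bar>t\<bar>))) \<le> norm (indicat_real {0..} t *\<^sub>R exp (- k * t) + indicat_real {..0} t *\<^sub>R exp (k * t))"
      by (rule AE_I2) (auto simp: indicator_def abs_if)
  qed
qed

lemma ac_left_tail:
  assumes l: "loc_int h" and s: "\<And>x. set_integrable lebesgue {..x} h"
  shows "has_ac_deriv (\<lambda>x. LINT t:{..x}|lebesgue. h t) h"
  unfolding has_ac_deriv_def
proof (intro conjI l allI impI)
  fix a b :: real assume ab: "a \<le> b"
  have "(LINT t:{..a} \<union> {a..b}|lebesgue. h t) = (LINT t:{..a}|lebesgue. h t) + (LINT t:{a..b}|lebesgue. h t)"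
  proof (rule set_integral_Un_AE)
    show "AE x in lebesgue. \<not> (x \<in> {..a} \<and> x \<in> {a..b})"
      using AE_not_endpoint[of a] by eventually_elim auto
  qed (use s loc_intD[OF l] in auto)
  moreover have "{..a} \<union> {a..b} = {..b}" using ab by auto
  ultimately show "(LINT t:{..b}|lebesgue. h t) - (LINT t:{..a}|lebesgue. h t) = (LINT t:{a..b}|lebesgue. h t)"
    by simp
qed

lemma ac_right_tail:
  assumes l: "loc_int h" and s: "\<And>x. set_integrable lebesgue {x..} h"
  shows "has_ac_deriv (\<lambda>x. LINT t:{x..}|lebesgue. h t) (\<lambda>t. - h t)"
  unfolding has_ac_deriv_def
proof (intro conjI allI impI)
  show "loc_int (\<lambda>t. - h t)" using loc_int_cmult[OF l, of "-1"] by simp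
  fix a b :: real assume ab: "a \<le> b"
  have "(LINT t:{a..b} \<union> {b..}|lebesgue. h t) = (LINT t:{a..b}|lebesgue. h t) + (LINT t:{b..}|lebesgue. h t)"
  proof (rule set_integral_Un_AE)
    show "AE x in lebesgue. \<not> (x \<in> {a..b} \<and> x \<in> {b..})"
      using AE_not_endpoint[of b] by eventually_elim auto
  qed (use s loc_intD[OF l] in auto)
  moreover have "{a..b} \<union> {b..} = {a..}" using ab by auto
  moreover have "(LINT t:{a..b}|lebesgue. - h t) = - (LINT t:{a..b}|lebesgue. h t)"
    by (rule set_integral_uminus[OF loc_intD[OF l]])
  ultimately show "(LINT t:{b..}|lebesgue. h t) - (LINT t:{a..}|lebesgue. h t) = (LINT t:{a..b}|lebesgue. - h t)"
    by simp
qed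

text \<open>Schur's test: the kernel has mass \<open>m\<close> in each variable. Cauchy-Schwarz in
  \<open>t\<close> yields the first factor \<open>m\<close>, Tonelli and integration in
  \<open>x\<close> the second.\<close>

lemma exp_kernel_Schur:
  fixes k :: real
  assumes k: "k > 0" and f: "f \<in> L2 lebesgue"
  defines "m \<equiv> (\<integral>t. exp (- (k * \<bar>t\<bar>)) \<partial>lebesgue)"
  defines "G \<equiv> (\<lambda>x. \<integral>t. exp (- (k * \<bar>x - t\<bar>)) * cmod (f t) \<partial>lebesgue)"
  shows "integrable lebesgue (\<lambda>t. exp (- (k * \<bar>x - t\<bar>)) * cmod (f t))"
    and "(\<integral>\<^sup>+x. ennreal ((G x)\<^sup>2) \<partial>lebesgue) \<le> ennreal (m\<^sup>2 * (\<integral>t. (cmod (f t))\<^sup>2 \<partial>lebesgue))"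
proof -
  interpret L: sigma_finite_measure "lebesgue :: real measure" by (rule sigma_finite_lebesgue)
  interpret P: pair_sigma_finite "lebesgue :: real measure" "lebesgue :: real measure" ..
  let ?k = "\<lambda>x t. exp (- (k * \<bar>x - t\<bar>))"
  have fm [measurable]: "f \<in> borel_measurable lebesgue" and f2: "integrable lebesgue (\<lambda>t. (cmod (f t))\<^sup>2)"
    using f by (auto simp: L2_def)
  have idm [measurable]: "(\<lambda>x. x) \<in> measurable (lebesgue :: real measure) borel"
    by (metis measurable_completion measurable_ident_sets sets_lborel)
  have ki: "integrable lebesgue (?k x)" for x
    using lebesgue_integrable_real_affine[OF exp_abs_integrable[OF k], of "-1" x] by simp
  have ki': "integrable lebesgue (\<lambda>x. ?k x t)" for t
    using ki[of t] by (simp add: abs_minus_commute)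
  have km: "(\<integral>t. ?k x t \<partial>lebesgue) = m" for x
    unfolding m_def using lebesgue_integral_real_affine[of "-1" "\<lambda>t. exp (- (k * \<bar>t\<bar>))" x] by simp
  have km': "(\<integral>x. ?k x t \<partial>lebesgue) = m" for t
    using km[of t] by (simp add: abs_minus_commute)
  have m0: "0 \<le> m" unfolding m_def by simp
  have k1: "?k x t \<le> 1" for x t using k by simp
  have i2: "integrable lebesgue (\<lambda>t. ?k x t * (cmod (f t))\<^sup>2)" for x
  proof (rule Bochner_Integration.integrable_bound[OF f2])
    show "AE t in lebesgue. norm (?k x t * (cmod (f t))\<^sup>2) \<le> norm ((cmod (f t))\<^sup>2)"
      using k1 by (intro AE_I2) (auto simp: abs_mult intro: mult_left_le_one_le)
  qed measurable
  show i1: "integrable lebesgue (\<lambda>t. ?k x t * cmod (f t))" for x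
  proof (rule Bochner_Integration.integrable_bound[OF Bochner_Integration.integrable_add[OF ki[of x] i2[of x]]])
    have "r \<le> 1 + r\<^sup>2" for r :: real
      using sum_squares_bound[of r 1] zero_le_power2[of r] unfolding power_one mult_1_right by linarith
    then have "?k x t * cmod (f t) \<le> ?k x t * (1 + (cmod (f t))\<^sup>2)" for t
      by (intro mult_left_mono) auto
    then show "AE t in lebesgue. norm (?k x t * cmod (f t)) \<le> norm (?k x t + ?k x t * (cmod (f t))\<^sup>2)"
      by (intro AE_I2) (simp add: distrib_left)
  qed measurable
  have CS: "(G x)\<^sup>2 \<le> m * (\<integral>t. ?k x t * (cmod (f t))\<^sup>2 \<partial>lebesgue)" for x
  proof -
    let ?I = "\<integral>t. ?k x t * (cmod (f t))\<^sup>2 \<partial>lebesgue"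
    \<comment> \<open>The quadratic polynomial in \<open>s\<close> whose nonnegativity is the
      Cauchy-Schwarz inequality for the weighted measure.\<close>
    have Q: "0 \<le> ?I - 2 * s * G x + s\<^sup>2 * m" for s
    proof -
      have "0 \<le> (\<integral>t. ?k x t * (cmod (f t) - s)\<^sup>2 \<partial>lebesgue)" by simp
      also have "\<dots> = (\<integral>t. ?k x t * (cmod (f t))\<^sup>2 - 2 * s * (?k x t * cmod (f t)) + s\<^sup>2 * ?k x t \<partial>lebesgue)"
        by (simp add: power2_diff algebra_simps)
      also have "\<dots> = ?I - 2 * s * G x + s\<^sup>2 * m"
        using i1[of x] i2[of x] ki[of x] by (simp add: G_def km)
      finally show ?thesis .
    qed
    show ?thesis
    proof (cases "m = 0")
      case True
      \<comment> \<open>With zero mass the polynomial is affine in \<open>s\<close>, and this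
        \<open>s\<close> would give it the value -1.\<close>
      have "0 \<le> ?I - 2 * ((?I + 1) / (2 * G x)) * G x" if "G x \<noteq> 0" using Q[of "(?I + 1) / (2 * G x)"] True by simp
      then have "G x = 0" by (auto simp: field_simps)
      with True show ?thesis by simp
    next
      case False
      with m0 have mp: "m > 0" by simp
      \<comment> \<open>\<open>s = G x / m\<close> minimises the polynomial.\<close>
      have "0 \<le> m * (?I - 2 * (G x / m) * G x + (G x / m)\<^sup>2 * m)" by (intro mult_nonneg_nonneg m0 Q)
      also have "\<dots> = m * ?I - (G x)\<^sup>2" using mp by (simp add: field_simps power2_eq_square)
      finally show ?thesis by simp
    qed
  qed
  have "(\<integral>\<^sup>+x. ennreal ((G x)\<^sup>2) \<partial>lebesgue) \<le> (\<integral>\<^sup>+x. ennreal m * (\<integral>\<^sup>+t. ennreal (?k x t * (cmod (f t))\<^sup>2) \<partial>lebesgue) \<partial>lebesgue)"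
  proof (rule nn_integral_mono)
    fix x
    have "ennreal ((G x)\<^sup>2) \<le> ennreal (m * (\<integral>t. ?k x t * (cmod (f t))\<^sup>2 \<partial>lebesgue))" by (rule ennreal_leI[OF CS])
    also have "\<dots> = ennreal m * (\<integral>\<^sup>+t. ennreal (?k x t * (cmod (f t))\<^sup>2) \<partial>lebesgue)"
      using i2[of x] by (subst nn_integral_eq_integral) (auto simp: ennreal_mult m0)
    finally show "ennreal ((G x)\<^sup>2) \<le> ennreal m * (\<integral>\<^sup>+t. ennreal (?k x t * (cmod (f t))\<^sup>2) \<partial>lebesgue)" .
  qed
  also have "\<dots> = ennreal m * (\<integral>\<^sup>+x. \<integral>\<^sup>+t. ennreal (?k x t * (cmod (f t))\<^sup>2) \<partial>lebesgue \<partial>lebesgue)"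
    by (rule nn_integral_cmult) measurable
  also have "(\<integral>\<^sup>+x. \<integral>\<^sup>+t. ennreal (?k x t * (cmod (f t))\<^sup>2) \<partial>lebesgue \<partial>lebesgue) = (\<integral>\<^sup>+t. \<integral>\<^sup>+x. ennreal (?k x t * (cmod (f t))\<^sup>2) \<partial>lebesgue \<partial>lebesgue)"
    by (rule P.Fubini'[symmetric]) measurable
  also have "\<dots> = (\<integral>\<^sup>+t. ennreal (m * (cmod (f t))\<^sup>2) \<partial>lebesgue)"
  proof (rule nn_integral_cong)
    fix t
    show "(\<integral>\<^sup>+x. ennreal (?k x t * (cmod (f t))\<^sup>2) \<partial>lebesgue) = ennreal (m * (cmod (f t))\<^sup>2)"
      using ki'[of t] km'[of t] by (subst nn_integral_eq_integral) auto
  qed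
  also have "\<dots> = ennreal (m * (\<integral>t. (cmod (f t))\<^sup>2 \<partial>lebesgue))"
    using f2 m0 by (subst nn_integral_eq_integral) auto
  also have "ennreal m * \<dots> = ennreal (m\<^sup>2 * (\<integral>t. (cmod (f t))\<^sup>2 \<partial>lebesgue))"
    using m0 by (simp add: ennreal_mult[symmetric] power2_eq_square mult.assoc)
  finally show "(\<integral>\<^sup>+x. ennreal ((G x)\<^sup>2) \<partial>lebesgue) \<le> ennreal (m\<^sup>2 * (\<integral>t. (cmod (f t))\<^sup>2 \<partial>lebesgue))" .
qed

text \<open>The two roots have product 1 and sum \<open>D\<close>. On the unit circle they would be
  \<open>cis t\<close> and \<open>cis (- t)\<close>, making \<open>D\<close> equal to
  \<open>2 * cos t\<close>; otherwise one of them lies strictly inside.\<close>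

lemma decaying_root:
  assumes "\<not> (\<exists>\<theta>\<in>{0..<1}. D = complex_of_real (2 * cos (2 * pi * \<theta>)))"
  obtains z where "z\<^sup>2 - D * z + 1 = 0" "norm z < 1" "z \<noteq> 0"
proof -
  define s where "s = csqrt (D\<^sup>2 - 4)"
  define z1 z2 where "z1 = (D + s) / 2" and "z2 = (D - s) / 2"
  have s2: "s\<^sup>2 = D\<^sup>2 - 4" by (simp add: s_def)
  have "z1\<^sup>2 - D * z1 + 1 = (s\<^sup>2 - (D\<^sup>2 - 4)) / 4" "z2\<^sup>2 - D * z2 + 1 = (s\<^sup>2 - (D\<^sup>2 - 4)) / 4"
    "z1 * z2 = (D\<^sup>2 - s\<^sup>2) / 4" and sm: "z1 + z2 = D"
    by (simp_all add: z1_def z2_def field_simps power2_eq_square)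
  then have r1: "z1\<^sup>2 - D * z1 + 1 = 0" and r2: "z2\<^sup>2 - D * z2 + 1 = 0" and pr: "z1 * z2 = 1"
    by (simp_all add: s2)
  have n: "norm z1 * norm z2 = 1" using pr by (metis norm_mult norm_one)
  have nz: "z1 \<noteq> 0" "z2 \<noteq> 0" using pr by auto
  have "norm z1 \<noteq> 1"
  proof
    assume n1: "norm z1 = 1"
    define t where "t = Arg z1"
    have z1: "z1 = cis t" using cis_Arg[OF nz(1)] n1 by (simp add: t_def sgn_eq)
    have "z2 = cis (- t)"
    proof -
      have "cis t * z2 = cis t * cis (- t)" using pr by (simp add: z1 cis_mult)
      then show ?thesis by simp
    qed
    then have D: "D = complex_of_real (2 * cos t)" using sm z1 by (simp add: complex_eq_iff)
    \<comment> \<open>The fractional part reduces the angle to one turn, as \<theta> has to lie in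
      \<open>{0..<1}\<close>.\<close>
    define \<theta> where "\<theta> = frac (t / (2 * pi))"
    have "cos (2 * pi * \<theta>) = cos (t - 2 * pi * of_int \<lfloor>t / (2 * pi)\<rfloor>)"
      by (simp add: \<theta>_def frac_def right_diff_distrib)
    also have "\<dots> = cos t"
      using cos_int_2pin sin_int_2pin by (simp add: cos_diff)
    finally have "D = complex_of_real (2 * cos (2 * pi * \<theta>))" using D by simp
    moreover have "\<theta> \<in> {0..<1}" by (simp add: \<theta>_def frac_lt_1)
    ultimately show False using assms by blast
  qed
  then consider "norm z1 < 1" | "norm z1 > 1" by linarith
  then show ?thesis
  proof cases
    case 1 then show ?thesis using r1 nz that by blast
  next
    case 2
    have "norm z2 < 1"
    proof (rule ccontr)
      assume "\<not> norm z2 < 1"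
      then have "norm z1 * 1 \<le> norm z1 * norm z2" by (intro mult_left_mono) auto
      with n 2 show False by simp
    qed
    then show ?thesis using r2 nz that by blast
  qed
qed

text \<open>The form uses \<open>a\<close>, the system uses \<open>q\<close>. They are reciprocal
  only almost everywhere because the two phases omit the interface points, where both coefficients
  are 0 in the application.\<close>

locale line_problem = ode_system q C for q :: "real \<Rightarrow> real" and C :: real +
  fixes a :: "real \<Rightarrow> real" and Ma T :: real
  assumes T: "T > 0" and per: "\<And>x. q (x + T) = q x" and q0: "\<And>x. 0 \<le> q x"
    and a_meas: "a \<in> borel_measurable lebesgue"
    and aq: "AE x in lebesgue. a x * q x = 1"
    and a_bd: "AE x in lebesgue. \<bar>a x\<bar> \<le> Ma"
begin

text \<open>As \<open>a * q = 1\<close>, the part \<open>q * w\<close> of the derivative contributes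
  simply the flux \<open>w\<close>. The remainder \<open>v\<close> is 0 for solutions and comes from
  the derivative of the cutoff in \<open>bloch_not_resolvent\<close>.\<close>

lemma form_line_left:
  assumes u: "u \<in> H1 UNIV" "AE x in lebesgue. weak_deriv UNIV u x = v x + of_real (q x) * w x"
    and v: "v \<in> L2 lebesgue" and w: "w \<in> L2 lebesgue" and phi: "\<phi> \<in> H1 UNIV"
  shows "integrable lebesgue (\<lambda>x. of_real (a x) * v x * cnj (weak_deriv UNIV \<phi> x))"
    "form_line a u \<phi> = (\<integral>x. of_real (a x) * v x * cnj (weak_deriv UNIV \<phi> x) \<partial>lebesgue) + (\<integral>x. w x * cnj (weak_deriv UNIV \<phi> x) \<partial>lebesgue)"
proof -
  define g where "g = weak_deriv UNIV \<phi>"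
  have g: "g \<in> L2 lebesgue" using H1_UNIV_ac[OF phi] by (metis g_def)
  have am: "(\<lambda>x. complex_of_real (a x)) \<in> borel_measurable lebesgue" using a_meas by simp
  have gm: "(\<lambda>x. cnj (g x)) \<in> borel_measurable lebesgue" using g by (auto simp: L2_def intro: borel_measurable_cnj)
  have vm: "v \<in> borel_measurable lebesgue" using v by (simp add: L2_def)
  have m1: "(\<lambda>x. of_real (a x) * v x * cnj (g x)) \<in> borel_measurable lebesgue"
    by (intro borel_measurable_times am vm gm)
  have i1: "integrable lebesgue (\<lambda>x. of_real (a x) * v x * cnj (g x))"
  proof (rule Bochner_Integration.integrable_bound[OF integrable_norm[OF L2_mult_integrable[OF L2_cmult[OF v, of "of_real Ma"] g]] m1])
    show "AE x in lebesgue. norm (of_real (a x) * v x * cnj (g x)) \<le> norm (norm (of_real Ma * v x * cnj (g x)))"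
      using a_bd by eventually_elim (auto simp: norm_mult intro!: mult_right_mono)
  qed
  then show "integrable lebesgue (\<lambda>x. of_real (a x) * v x * cnj (weak_deriv UNIV \<phi> x))" by (simp add: g_def)
  note i2 = L2_mult_integrable[OF w g]
  have um: "weak_deriv UNIV u \<in> borel_measurable lebesgue"
    using weak_deriv_spec(1)[OF u(1)] by (simp add: L2_def lebesgue_on_UNIV_eq)
  have "form_line a u \<phi> = (\<integral>x. of_real (a x) * v x * cnj (g x) + w x * cnj (g x) \<partial>lebesgue)"
    unfolding form_line_def g_def[symmetric]
  proof (rule integral_cong_AE)
    show "(\<lambda>x. of_real (a x) * weak_deriv UNIV u x * cnj (g x)) \<in> borel_measurable lebesgue"
      by (intro borel_measurable_times am um gm)
    show "(\<lambda>x. of_real (a x) * v x * cnj (g x) + w x * cnj (g x)) \<in> borel_measurable lebesgue"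
      by (intro borel_measurable_add m1 borel_measurable_integrable[OF i2])
    show "AE x in lebesgue. of_real (a x) * weak_deriv UNIV u x * cnj (g x) = of_real (a x) * v x * cnj (g x) + w x * cnj (g x)"
      using u(2) aq
    proof eventually_elim
      case (elim x)
      have "complex_of_real (a x) * of_real (q x) = 1" using elim(2) by (metis of_real_1 of_real_mult)
      then show ?case unfolding elim(1) by algebra
    qed
  qed
  then show "form_line a u \<phi> = (\<integral>x. of_real (a x) * v x * cnj (weak_deriv UNIV \<phi> x) \<partial>lebesgue) + (\<integral>x. w x * cnj (weak_deriv UNIV \<phi> x) \<partial>lebesgue)"
    using i1 i2 by (simp add: g_def)
qed

lemma weak_form_line:
  assumes U: "has_ac_deriv U (\<lambda>x. of_real (q x) * W x)"
    and W: "has_ac_deriv W (\<lambda>x. - lam * U x - f x)"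
    and L: "U \<in> L2 lebesgue" "W \<in> L2 lebesgue" "f \<in> L2 lebesgue"
  shows "U \<in> H1 UNIV"
    and "\<phi> \<in> H1 UNIV \<Longrightarrow> form_line a U \<phi> - lam * L2inner lebesgue U \<phi> = L2inner lebesgue f \<phi>"
proof -
  note H = ac_H1_UNIV[OF U L(1) L2_weight[OF q_weight L(2)]]
  show "U \<in> H1 UNIV" by (rule H(1))
  assume phi: "\<phi> \<in> H1 UNIV"
  obtain F where F: "has_ac_deriv F (weak_deriv UNIV \<phi>)" "AE x in lebesgue. \<phi> x = F x"
    "F \<in> L2 lebesgue" "\<phi> \<in> L2 lebesgue" "weak_deriv UNIV \<phi> \<in> L2 lebesgue"
    using H1_UNIV_ac[OF phi] by blast
  have z: "(\<lambda>_. 0) \<in> L2 lebesgue" by (simp add: L2_def)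
  have "form_line a U \<phi> = (\<integral>x. W x * cnj (weak_deriv UNIV \<phi> x) \<partial>lebesgue)"
    using form_line_left(2)[OF H(1) _ z L(2) phi] H(2) by simp
  also have "\<dots> = - (\<integral>x. (- lam * U x - f x) * cnj (F x) \<partial>lebesgue)"
    by (rule ac_parts_UNIV[OF W F(1) L(2) L2_diff[OF L2_cmult[OF L(1)] L(3)] F(3,5)])
  also have "(\<integral>x. (- lam * U x - f x) * cnj (F x) \<partial>lebesgue) = (\<integral>x. - lam * (U x * cnj (\<phi> x)) - f x * cnj (\<phi> x) \<partial>lebesgue)"
  proof (rule integral_cong_AE)
    show "(\<lambda>x. (- lam * U x - f x) * cnj (F x)) \<in> borel_measurable lebesgue"
      by (rule borel_measurable_integrable[OF L2_mult_integrable[OF L2_diff[OF L2_cmult[OF L(1)] L(3)] F(3)]])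
    show "(\<lambda>x. - lam * (U x * cnj (\<phi> x)) - f x * cnj (\<phi> x)) \<in> borel_measurable lebesgue"
      by (rule borel_measurable_integrable)
         (intro Bochner_Integration.integrable_diff integrable_mult_right L2_mult_integrable L F)
    show "AE x in lebesgue. (- lam * U x - f x) * cnj (F x) = - lam * (U x * cnj (\<phi> x)) - f x * cnj (\<phi> x)"
      using F(2) by eventually_elim (simp add: algebra_simps)
  qed
  also have "\<dots> = - lam * L2inner lebesgue U \<phi> - L2inner lebesgue f \<phi>"
    unfolding L2inner_def
    by (subst Bochner_Integration.integral_diff)
       (auto intro!: L2_mult_integrable L F)
  finally show "form_line a U \<phi> - lam * L2inner lebesgue U \<phi> = L2inner lebesgue f \<phi>" by simp
qed

text \<open>Multiplying \<open>u\<close> by \<open>exp (- (k * x))\<close> makes its modulus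
  periodic, hence bounded.\<close>

lemma periodic_exp_bound:
  fixes u :: "real \<Rightarrow> complex" and k :: real
  assumes c: "continuous_on UNIV u" and p: "\<And>x. u (x + T) = y * u x" and y: "norm y = exp (k * T)"
  obtains K where "K \<ge> 0" "\<And>x. norm (u x) \<le> K * exp (k * x)"
proof -
  let ?f = "\<lambda>x. complex_of_real (exp (- (k * x))) * u x"
  have cf: "continuous_on UNIV ?f" by (intro continuous_intros c)
  have pf: "norm (?f (x + T)) = norm (?f x)" for x
  proof -
    have "exp (- (k * (x + T))) * exp (k * T) = exp (- (k * x))" by (simp add: exp_add[symmetric] algebra_simps)
    then show ?thesis by (simp add: norm_mult p y)
  qed
  obtain K where K: "\<And>x. norm (?f x) \<le> K" using periodic_bounded[OF cf pf T] by blast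
  have "norm (u x) \<le> K * exp (k * x)" for x
  proof -
    have "exp (- (k * x)) * exp (k * x) = 1" by (simp add: exp_add[symmetric])
    moreover have "norm (?f x) = exp (- (k * x)) * norm (u x)" by (simp only: norm_mult norm_of_real abs_exp_cancel)
    ultimately have "norm (u x) = norm (?f x) * exp (k * x)" by (metis mult.assoc mult.commute mult_1)
    also have "\<dots> \<le> K * exp (k * x)" by (rule mult_right_mono[OF K]) simp
    finally show ?thesis .
  qed
  moreover have "K \<ge> 0" using K[of 0] norm_ge_zero order_trans by blast
  ultimately show ?thesis by (rule that[rotated])
qed

text \<open>Eigenvectors for distinct multipliers are linearly independent. If the Wronskian
  vanished, the combinations with coefficients \<open>(z 0, - w 0)\<close> and
  \<open>(v 0, - u 0)\<close> would have zero data, hence vanish at \<open>T\<close>, where the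
  solutions carry different factors.\<close>

lemma floquet_wronskian:
  assumes P: "ode_sol q lam u w" "u 0 \<noteq> 0 \<or> w 0 \<noteq> 0" "u T = y * u 0" "w T = y * w 0"
    and M: "ode_sol q lam v z" "v 0 \<noteq> 0 \<or> z 0 \<noteq> 0" "v T = y' * v 0" "z T = y' * z 0"
    and ne: "y \<noteq> y'"
  shows "u 0 * z 0 - v 0 * w 0 \<noteq> 0"
proof
  assume W: "u 0 * z 0 - v 0 * w 0 = 0"
  have e: "(\<lambda>x. r * u x + s * v x) T = 0" "(\<lambda>x. r * w x + s * z x) T = 0"
    if "r * u 0 + s * v 0 = 0" "r * w 0 + s * z 0 = 0" for r s
    using ode_sol_unique[OF ode_sol_lincomb[OF P(1) M(1), of r s], of T] that by simp_all
  have 1: "z 0 * u T - w 0 * v T = 0" "z 0 * w T - w 0 * z T = 0"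
    using e[of "z 0" "- w 0"] W by (simp_all add: algebra_simps)
  have 2: "v 0 * u T - u 0 * v T = 0" "v 0 * w T - u 0 * z T = 0"
    using e[of "v 0" "- u 0"] W by (simp_all add: algebra_simps)
  have 3: "(y - y') * (u 0 * z 0) = 0" "(y - y') * (w 0 * z 0) = 0" "(y - y') * (v 0 * u 0) = 0" "(y - y') * (v 0 * w 0) = 0"
    using 1 2 W unfolding P(3,4) M(3,4) by algebra+
  then show False using ne P(2) M(2) by auto
qed

text \<open>The Green function is built from \<open>u\<close>, which decays at plus infinity, and
  \<open>v\<close>, which decays at minus infinity. It is dominated by a multiple of
  \<open>exp (- (k * \<bar>x - t\<bar>))\<close>, so Schur's test gives the norm bound.\<close>

lemma solve_line:
  assumes d: "\<not> (\<exists>\<theta>\<in>{0..<1}. discr T lam = complex_of_real (2 * cos (2 * pi * \<theta>)))"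
  shows "\<exists>K. \<forall>f \<in> L2 lebesgue. \<exists>U \<in> H1 UNIV.
    (\<forall>\<phi> \<in> H1 UNIV. form_line a U \<phi> - lam * L2inner lebesgue U \<phi> = L2inner lebesgue f \<phi>) \<and> L2norm lebesgue U \<le> K * L2norm lebesgue f"
proof -
  obtain y where y: "y\<^sup>2 - discr T lam * y + 1 = 0" "norm y < 1" "y \<noteq> 0"
    using decaying_root[OF d] by blast
  define y' where "y' = 1 / y"
  have y': "y'\<^sup>2 - discr T lam * y' + 1 = 0"
    using y(1,3) by (simp add: y'_def field_simps power2_eq_square)
  \<comment> \<open>The decay rate: the multiplier satisfies \<open>norm y = exp (- k * T)\<close>,
    and the reciprocal multiplier grows at the same rate.\<close>
  define k where "k = - ln (norm y) / T"
  have k: "k > 0" using y T by (simp add: k_def divide_neg_pos)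
  have ny: "norm y = exp (- k * T)" using y T by (simp add: k_def)
  have "norm y' = inverse (norm y)" by (simp add: y'_def norm_divide inverse_eq_divide)
  then have ny': "norm y' = exp (k * T)" by (simp add: ny exp_minus[symmetric])
  obtain u w where P: "ode_sol q lam u w" "u 0 \<noteq> 0 \<or> w 0 \<noteq> 0" "\<And>x. u (x + T) = y * u x" "\<And>x. w (x + T) = y * w x"
    using floquet[OF y(1) per] by blast
  obtain v z where M: "ode_sol q lam v z" "v 0 \<noteq> 0 \<or> z 0 \<noteq> 0" "\<And>x. v (x + T) = y' * v x" "\<And>x. z (x + T) = y' * z x"
    using floquet[OF y' per] by blast
  have u: "has_ac_deriv u (\<lambda>x. of_real (q x) * w x)" and w: "has_ac_deriv w (\<lambda>x. - lam * u x)"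
    and v: "has_ac_deriv v (\<lambda>x. of_real (q x) * z x)" and z: "has_ac_deriv z (\<lambda>x. - lam * v x)"
    using P(1) M(1) by (auto simp: ode_sol_def)
  define W0 where "W0 = u 0 * z 0 - v 0 * w 0"
  have "y \<noteq> y'"
  proof
    assume "y = y'"
    then have "norm y' < 1" using y(2) by simp
    then show False unfolding ny' using mult_pos_pos[OF k T] by simp
  qed
  then have W0: "W0 \<noteq> 0"
    unfolding W0_def using floquet_wronskian[OF P(1,2) _ _ M(1,2)] P(3)[of 0] P(4)[of 0] M(3)[of 0] M(4)[of 0] by auto
  have Wr: "u x * z x - v x * w x = W0" for x
    unfolding W0_def by (rule ode_sol_wronskian[OF P(1) M(1)])
  obtain K1 where K1: "K1 \<ge> 0" "\<And>x. norm (u x) \<le> K1 * exp (- k * x)" using periodic_exp_bound[OF ac_continuous[OF u] P(3) ny] by blast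
  obtain K2 where K2: "K2 \<ge> 0" "\<And>x. norm (w x) \<le> K2 * exp (- k * x)" using periodic_exp_bound[OF ac_continuous[OF w] P(4) ny] by blast
  obtain K3 where K3: "K3 \<ge> 0" "\<And>x. norm (v x) \<le> K3 * exp (k * x)" using periodic_exp_bound[OF ac_continuous[OF v] M(3) ny'] by blast
  obtain K4 where K4: "K4 \<ge> 0" "\<And>x. norm (z x) \<le> K4 * exp (k * x)" using periodic_exp_bound[OF ac_continuous[OF z] M(4) ny'] by blast
  define K where "K = K1 + K2 + K3 + K4"
  have K0: "K \<ge> 0" using K1 K2 K3 K4 by (simp add: K_def)
  have ub: "norm (u x) \<le> K * exp (- k * x)" "norm (w x) \<le> K * exp (- k * x)"
    and vb: "norm (v x) \<le> K * exp (k * x)" "norm (z x) \<le> K * exp (k * x)" for x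
    using K1 K2 K3 K4
    by (auto intro!: order_trans[OF K1(2)] order_trans[OF K2(2)] order_trans[OF K3(2)] order_trans[OF K4(2)] mult_right_mono simp: K_def)
  define m where "m = (\<integral>t. exp (- (k * \<bar>t\<bar>)) \<partial>lebesgue)"
  \<comment> \<open>Each of the two halves of the Green function contributes
    \<open>K * K / norm W0\<close>.\<close>
  define c where "c = 2 * K * K / norm W0"
  have c0: "c \<ge> 0" using K0 by (simp add: c_def)
  have m0: "m \<ge> 0" by (simp add: m_def)
  show ?thesis
  proof (intro exI[of _ "c * m"] ballI)
    fix f assume f: "f \<in> L2 lebesgue"
    have lf: "loc_int f" using L2_loc_int[of UNIV f] f by (simp add: lebesgue_on_UNIV_eq)
    define G where "G = (\<lambda>x. \<integral>t. exp (- (k * \<bar>x - t\<bar>)) * cmod (f t) \<partial>lebesgue)"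
    note kf = exp_kernel_Schur(1)[OF k f]
    have Schur: "(\<integral>\<^sup>+x. ennreal ((G x)\<^sup>2) \<partial>lebesgue) \<le> ennreal (m\<^sup>2 * (\<integral>t. (cmod (f t))\<^sup>2 \<partial>lebesgue))"
      using exp_kernel_Schur(2)[OF k f] by (simp add: G_def m_def)
    \<comment> \<open>The data are weighted by the solution that decays towards the infinite end of
      the range: \<open>v\<close> to the left of \<open>x\<close> here, \<open>u\<close> to the
      right of \<open>x\<close> in \<open>B\<close>.\<close>
    define A where "A = (\<lambda>x. LINT t:{..x}|lebesgue. v t * f t)"
    define B where "B = (\<lambda>x. LINT t:{x..}|lebesgue. u t * f t)"
    have lv: "loc_int (\<lambda>t. v t * f t)" and lu: "loc_int (\<lambda>t. u t * f t)"
      using loc_int_mult[OF ac_continuous[OF v] lf] loc_int_mult[OF ac_continuous[OF u] lf] by auto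
    have pv: "norm (indicat_real {..x} t *\<^sub>R (v t * f t)) \<le> K * exp (k * x) * (exp (- (k * \<bar>x - t\<bar>)) * cmod (f t))" for x t
    proof (cases "t \<le> x")
      case True
      have "norm (v t * f t) \<le> K * exp (k * t) * cmod (f t)"
        unfolding norm_mult by (rule mult_right_mono[OF vb(1)]) simp
      also have "exp (k * t) = exp (k * x) * exp (- (k * \<bar>x - t\<bar>))"
        using True by (simp add: exp_add[symmetric] algebra_simps)
      finally show ?thesis using True by (simp add: mult_ac)
    qed (use K0 in simp)
    have pu: "norm (indicat_real {x..} t *\<^sub>R (u t * f t)) \<le> K * exp (- k * x) * (exp (- (k * \<bar>x - t\<bar>)) * cmod (f t))" for x t
    proof (cases "x \<le> t")
      case True
      have "norm (u t * f t) \<le> K * exp (- k * t) * cmod (f t)"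
        unfolding norm_mult by (rule mult_right_mono[OF ub(1)]) simp
      also have "exp (- k * t) = exp (- k * x) * exp (- (k * \<bar>x - t\<bar>))"
        using True by (simp add: exp_add[symmetric] algebra_simps)
      finally show ?thesis using True by (simp add: mult_ac)
    qed (use K0 in simp)
    have sv: "set_integrable lebesgue {..x} (\<lambda>t. v t * f t)" for x
      unfolding set_integrable_def
    proof (rule Bochner_Integration.integrable_bound[OF integrable_mult_right[OF kf[of x]]])
      show "(\<lambda>t. indicat_real {..x} t *\<^sub>R (v t * f t)) \<in> borel_measurable lebesgue"
        by (rule borel_measurable_scaleR[OF borel_measurable_indicator loc_int_measurable[OF lv]]) simp
      show "AE t in lebesgue. norm (indicat_real {..x} t *\<^sub>R (v t * f t)) \<le> norm (K * exp (k * x) * (exp (- (k * \<bar>x - t\<bar>)) * cmod (f t)))"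
        by (rule AE_I2, rule order_trans[OF pv]) (simp only: real_norm_def abs_ge_self)
    qed
    have su: "set_integrable lebesgue {x..} (\<lambda>t. u t * f t)" for x
      unfolding set_integrable_def
    proof (rule Bochner_Integration.integrable_bound[OF integrable_mult_right[OF kf[of x]]])
      show "(\<lambda>t. indicat_real {x..} t *\<^sub>R (u t * f t)) \<in> borel_measurable lebesgue"
        by (rule borel_measurable_scaleR[OF borel_measurable_indicator loc_int_measurable[OF lu]]) simp
      show "AE t in lebesgue. norm (indicat_real {x..} t *\<^sub>R (u t * f t)) \<le> norm (K * exp (- k * x) * (exp (- (k * \<bar>x - t\<bar>)) * cmod (f t)))"
        by (rule AE_I2, rule order_trans[OF pu]) (simp only: real_norm_def abs_ge_self)
    qed
    have Ab: "norm (A x) \<le> K * exp (k * x) * G x" for x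
    proof -
      have "norm (A x) \<le> (\<integral>t. K * exp (k * x) * (exp (- (k * \<bar>x - t\<bar>)) * cmod (f t)) \<partial>lebesgue)"
        unfolding A_def set_lebesgue_integral_def
        by (rule Bochner_Integration.integral_norm_bound_integral[OF sv[unfolded set_integrable_def] integrable_mult_right[OF kf] pv])
      then show ?thesis by (simp add: G_def)
    qed
    have Bb: "norm (B x) \<le> K * exp (- k * x) * G x" for x
    proof -
      have "norm (B x) \<le> (\<integral>t. K * exp (- k * x) * (exp (- (k * \<bar>x - t\<bar>)) * cmod (f t)) \<partial>lebesgue)"
        unfolding B_def set_lebesgue_integral_def
        by (rule Bochner_Integration.integral_norm_bound_integral[OF su[unfolded set_integrable_def] integrable_mult_right[OF kf] pu])
      then show ?thesis by (simp add: G_def)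
    qed
    have A: "has_ac_deriv A (\<lambda>t. v t * f t)" unfolding A_def by (rule ac_left_tail[OF lv sv])
    have B: "has_ac_deriv B (\<lambda>t. - (u t * f t))" unfolding B_def by (rule ac_right_tail[OF lu su])
    define U where "U = (\<lambda>x. (1 / W0) * (u x * A x + v x * B x))"
    define W where "W = (\<lambda>x. (1 / W0) * (w x * A x + z x * B x))"
    have U: "has_ac_deriv U (\<lambda>x. of_real (q x) * W x)"
      by (rule ac_cong[OF ac_cmult[OF ac_add[OF ac_mult[OF u A] ac_mult[OF v B]], of "1 / W0"]])
         (simp_all add: U_def W_def algebra_simps)
    have W: "has_ac_deriv W (\<lambda>x. - lam * U x - f x)"
    proof (rule ac_cong[OF ac_cmult[OF ac_add[OF ac_mult[OF w A] ac_mult[OF z B]], of "1 / W0"]])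
      fix x
      have "(- lam * u x * A x + w x * (v x * f x) + (- lam * v x * B x + z x * - (u x * f x))) =
        - lam * (u x * A x + v x * B x) - (u x * z x - v x * w x) * f x" by algebra
      then show "1 / W0 * (- lam * u x * A x + w x * (v x * f x) + (- lam * v x * B x + z x * - (u x * f x))) = - lam * U x - f x"
        using W0 by (simp add: Wr U_def field_simps)
    qed (simp add: W_def)
    \<comment> \<open>The exponential bounds of the outer factors cancel the exponentials left over
      in \<open>Ab\<close> and \<open>Bb\<close>. The same estimate serves \<open>U\<close> and the
      flux \<open>W\<close>.\<close>
    have comb: "norm ((1 / W0) * (s * A x + t * B x)) \<le> c * G x"
      if "norm s \<le> K * exp (- k * x)" "norm t \<le> K * exp (k * x)" for s t x
    proof -
      have "norm (s * A x + t * B x) \<le> norm s * norm (A x) + norm t * norm (B x)"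
        by (rule order_trans[OF norm_triangle_ineq]) (simp only: norm_mult order_refl)
      also have "\<dots> \<le> (K * exp (- k * x)) * (K * exp (k * x) * G x) + (K * exp (k * x)) * (K * exp (- k * x) * G x)"
        using that Ab[of x] Bb[of x] K0 by (intro add_mono mult_mono) auto
      also have "\<dots> = 2 * K * K * G x * (exp (k * x) * exp (- k * x))" by (simp add: algebra_simps)
      also have "exp (k * x) * exp (- k * x) = 1" by (simp add: exp_add[symmetric])
      finally have "norm (s * A x + t * B x) / norm W0 \<le> 2 * K * K * G x / norm W0"
        by (intro divide_right_mono) auto
      then show ?thesis by (simp add: c_def norm_mult norm_divide)
    qed
    have L2G: "h \<in> L2 lebesgue \<and> (\<integral>x. (cmod (h x))\<^sup>2 \<partial>lebesgue) \<le> (c * m)\<^sup>2 * (\<integral>t. (cmod (f t))\<^sup>2 \<partial>lebesgue)"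
      if hm: "h \<in> borel_measurable lebesgue" and hb: "\<And>x. norm (h x) \<le> c * G x" for h
    proof -
      let ?I = "\<integral>t. (cmod (f t))\<^sup>2 \<partial>lebesgue"
      have Gm: "(\<lambda>x. ennreal ((c * G x)\<^sup>2)) = (\<lambda>x. ennreal (c\<^sup>2) * ennreal ((G x)\<^sup>2))"
        by (simp add: power_mult_distrib ennreal_mult)
      have "(\<integral>\<^sup>+x. ennreal ((cmod (h x))\<^sup>2) \<partial>lebesgue) \<le> (\<integral>\<^sup>+x. ennreal (c\<^sup>2) * ennreal ((G x)\<^sup>2) \<partial>lebesgue)"
        unfolding Gm[symmetric] by (intro nn_integral_mono ennreal_leI power_mono hb) auto
      also have "\<dots> \<le> ennreal (c\<^sup>2) * (\<integral>\<^sup>+x. ennreal ((G x)\<^sup>2) \<partial>lebesgue)"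
      proof -
        have idm [measurable]: "(\<lambda>x. x) \<in> measurable (lebesgue :: real measure) borel"
          by (metis measurable_completion measurable_ident_sets sets_lborel)
        interpret L: sigma_finite_measure "lebesgue :: real measure" by (rule sigma_finite_lebesgue)
        have fm [measurable]: "f \<in> borel_measurable lebesgue" using f by (simp add: L2_def)
        have [measurable]: "G \<in> borel_measurable lebesgue" unfolding G_def by measurable
        show ?thesis by (subst nn_integral_cmult) auto
      qed
      also have "\<dots> \<le> ennreal (c\<^sup>2) * ennreal (m\<^sup>2 * ?I)"
        by (rule mult_left_mono[OF Schur]) simp
      also have "\<dots> = ennreal ((c * m)\<^sup>2 * ?I)"
        by (simp add: ennreal_mult[symmetric] power_mult_distrib mult.assoc)
      finally have le: "(\<integral>\<^sup>+x. ennreal ((cmod (h x))\<^sup>2) \<partial>lebesgue) \<le> ennreal ((c * m)\<^sup>2 * ?I)" .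
      have hm2: "(\<lambda>x. (cmod (h x))\<^sup>2) \<in> borel_measurable lebesgue" using hm by measurable
      have i: "integrable lebesgue (\<lambda>x. (cmod (h x))\<^sup>2)"
        by (rule integrableI_nonneg[OF hm2]) (use le in \<open>auto intro: le_less_trans\<close>)
      have "(\<integral>x. (cmod (h x))\<^sup>2 \<partial>lebesgue) \<le> (c * m)\<^sup>2 * ?I"
        using le i by (subst (asm) nn_integral_eq_integral) (auto simp: ennreal_le_iff)
      with i hm show ?thesis by (simp add: L2_def)
    qed
    have UL: "U \<in> L2 lebesgue" "(\<integral>x. (cmod (U x))\<^sup>2 \<partial>lebesgue) \<le> (c * m)\<^sup>2 * (\<integral>t. (cmod (f t))\<^sup>2 \<partial>lebesgue)"
      using L2G[OF ac_measurable[OF U]] comb[OF ub(1) vb(1)] by (auto simp: U_def)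
    have WL: "W \<in> L2 lebesgue"
      using L2G[OF ac_measurable[OF W]] comb[OF ub(2) vb(2)] by (auto simp: W_def)
    note wf = weak_form_line[OF U W UL(1) WL f]
    have "L2norm lebesgue U \<le> sqrt ((c * m)\<^sup>2 * (\<integral>t. (cmod (f t))\<^sup>2 \<partial>lebesgue))"
      unfolding L2norm_def by (rule real_sqrt_le_mono[OF UL(2)])
    also have "\<dots> = c * m * L2norm lebesgue f"
      using c0 m0 by (simp add: real_sqrt_mult L2norm_def)
    finally show "\<exists>U\<in>H1 UNIV. (\<forall>\<phi>\<in>H1 UNIV. form_line a U \<phi> - lam * L2inner lebesgue U \<phi> = L2inner lebesgue f \<phi>) \<and> L2norm lebesgue U \<le> c * m * L2norm lebesgue f"
      using wf by (intro bexI[of _ U]) auto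
  qed
qed

end

section \<open>Slowly varying cutoffs, Bloch solutions and the spectrum on the line\<close>

definition sech :: "real \<Rightarrow> real \<Rightarrow> real" where "sech N x = 1 / cosh (x / N)"
definition sech' :: "real \<Rightarrow> real \<Rightarrow> real" where "sech' N x = - (sinh (x / N) / (cosh (x / N))\<^sup>2) / N"

lemma sech_pos: "0 < sech N x"
  by (simp add: sech_def cosh_real_pos)

lemma sech_ac:
  assumes "N > 0" shows "has_ac_deriv (\<lambda>x. of_real (sech N x)) (\<lambda>x. of_real (sech' N x))"
proof (rule ac_C1)
  have D: "(sech N has_real_derivative sech' N x) (at x)" for x
    unfolding sech_def[abs_def] sech'_def
    by (rule derivative_eq_intros refl | use assms cosh_real_pos[of "x / N"] in \<open>simp add: power2_eq_square\<close>)+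
  show "((\<lambda>x. complex_of_real (sech N x)) has_vector_derivative of_real (sech' N x)) (at x)" for x
    by (rule has_vector_derivative_of_real[OF D])
  have "cosh y \<noteq> 0" for y :: real using cosh_real_pos[of y] by linarith
  then show "continuous_on UNIV (\<lambda>x. complex_of_real (sech' N x))"
    unfolding sech'_def by (intro continuous_intros) (use assms in auto)
qed

text \<open>The reason for this cutoff: its logarithmic derivative is
  \<open>- tanh (x / N) / N\<close>, so the derivative is dominated by the cutoff itself. A nonzero
  cutoff of compact support cannot have this property.\<close>

lemma sech'_le: assumes "N > 0" shows "\<bar>sech' N x\<bar> \<le> sech N x / N"
proof -
  let ?y = "x / N"
  have c: "cosh ?y > 0" by (rule cosh_real_pos)
  have "\<bar>sinh ?y\<bar> \<le> cosh ?y"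
    by (metis abs_le_square_iff abs_of_pos c cosh_square_eq less_add_one less_imp_le)
  then have "\<bar>sinh ?y\<bar> / (cosh ?y)\<^sup>2 \<le> cosh ?y / (cosh ?y)\<^sup>2" by (intro divide_right_mono) auto
  also have "\<dots> = sech N x" using c by (simp add: sech_def power2_eq_square)
  finally have "\<bar>sinh ?y\<bar> / (cosh ?y)\<^sup>2 / N \<le> sech N x / N" using assms by (intro divide_right_mono) auto
  then show ?thesis using assms by (simp add: sech'_def abs_divide)
qed

lemma sech_le: assumes "N > 0" shows "sech N x \<le> 2 * exp (- (1 / N * \<bar>x\<bar>))"
proof -
  have "exp \<bar>y\<bar> \<le> 2 * cosh y" for y :: real
    by (cases "y \<ge> 0") (simp_all add: cosh_def)
  from this[of "x / N"]
  have "1 / cosh (x / N) \<le> 2 / exp \<bar>x / N\<bar>"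
    using cosh_real_pos[of "x / N"] by (simp add: field_simps)
  also have "\<dots> = 2 * exp (- (1 / N * \<bar>x\<bar>))"
    using assms by (simp add: exp_minus field_simps abs_divide)
  finally show ?thesis by (simp add: sech_def)
qed

text \<open>Keeps the norms of the cut off Bloch solutions above the one for
  \<open>N = 1\<close>.\<close>

lemma sech_mono: assumes "N \<ge> 1" shows "sech 1 x \<le> sech N x"
proof -
  have "\<bar>x / N\<bar> \<le> \<bar>x\<bar>" using assms by (simp add: abs_divide divide_le_eq mult_left_le mult_le_cancel_left1)
  then have "cosh \<bar>x / N\<bar> \<le> cosh \<bar>x\<bar>" using cosh_real_nonneg_le_iff[of "\<bar>x / N\<bar>" "\<bar>x\<bar>"] by (simp only: abs_ge_zero simp_thms)
  then have "cosh (x / N) \<le> cosh x" by (simp only: cosh_real_abs)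
  then show ?thesis using cosh_real_pos[of "x / N"] by (simp add: sech_def frac_le)
qed

text \<open>The squared norm grows at most linearly in \<open>N\<close>, while the squared
  derivative of the cutoff gains \<open>1 / N^2\<close>; the argument below lives on this
  difference.\<close>

lemma sech_L2:
  assumes N: "N > 0" and u: "u \<in> borel_measurable lebesgue" "\<And>x. norm (u x) \<le> B"
  defines "v \<equiv> (\<lambda>x. of_real (sech N x) * u x)"
  shows "v \<in> L2 lebesgue"
    and "(\<integral>x. (cmod (v x))\<^sup>2 \<partial>lebesgue) \<le> 4 * B\<^sup>2 * (\<integral>t. exp (- \<bar>t\<bar>) \<partial>lebesgue) * N"
proof -
  have B: "0 \<le> B" using u(2)[of 0] norm_ge_zero order_trans by blast
  let ?e = "\<lambda>x. exp (- (1 / N * \<bar>x\<bar>))"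
  have ei: "integrable lebesgue ?e" by (rule exp_abs_integrable) (use N in simp)
  have vm: "v \<in> borel_measurable lebesgue"
    unfolding v_def using ac_measurable[OF sech_ac[OF N]] u(1) by (rule borel_measurable_times)
  have e1: "?e x \<le> 1" for x using N by simp
  have b: "(cmod (v x))\<^sup>2 \<le> 4 * B\<^sup>2 * ?e x" for x
  proof -
    have "cmod (v x) \<le> (2 * ?e x) * B"
      unfolding v_def norm_mult using sech_le[OF N, of x] sech_pos[of N x] u(2)[of x]
      by (intro mult_mono) auto
    then have "(cmod (v x))\<^sup>2 \<le> ((2 * ?e x) * B)\<^sup>2" by (rule power_mono) simp
    also have "\<dots> = 4 * B\<^sup>2 * (?e x * ?e x)" by (simp add: power2_eq_square)
    also have "\<dots> \<le> 4 * B\<^sup>2 * (?e x * 1)" using e1[of x] by (intro mult_left_mono) auto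
    finally show ?thesis by simp
  qed
  have i: "integrable lebesgue (\<lambda>x. (cmod (v x))\<^sup>2)"
  proof (rule Bochner_Integration.integrable_bound[OF integrable_mult_right[OF ei]])
    show "(\<lambda>x. (cmod (v x))\<^sup>2) \<in> borel_measurable lebesgue" using vm by measurable
    show "AE x in lebesgue. norm ((cmod (v x))\<^sup>2) \<le> norm (4 * B\<^sup>2 * ?e x)"
      using b by (intro AE_I2) simp
  qed
  with vm show "v \<in> L2 lebesgue" by (simp add: L2_def)
  have "(\<integral>x. (cmod (v x))\<^sup>2 \<partial>lebesgue) \<le> (\<integral>x. 4 * B\<^sup>2 * ?e x \<partial>lebesgue)"
    by (rule integral_mono[OF i integrable_mult_right[OF ei] b])
  also have "\<dots> = 4 * B\<^sup>2 * (\<integral>x. ?e x \<partial>lebesgue)" by simp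
  also have "(\<integral>x. ?e x \<partial>lebesgue) = N * (\<integral>t. exp (- \<bar>t\<bar>) \<partial>lebesgue)"
    using lebesgue_integral_real_affine[of N ?e 0] N by (simp add: abs_mult)
  finally show "(\<integral>x. (cmod (v x))\<^sup>2 \<partial>lebesgue) \<le> 4 * B\<^sup>2 * (\<integral>t. exp (- \<bar>t\<bar>) \<partial>lebesgue) * N" by (simp add: mult_ac)
qed

text \<open>The parameter \<open>d\<close> makes the coefficient of \<open>s\<^sup>2\<close> small,
  so that this term can be absorbed later.\<close>

lemma weighted_AM_GM:
  fixes r s d :: real assumes "d > 0" shows "r * s \<le> r\<^sup>2 / (2 * d) + d / 2 * s\<^sup>2"
proof -
  have "0 \<le> (r - d * s)\<^sup>2 / (2 * d)" using assms by simp
  also have "(r - d * s)\<^sup>2 / (2 * d) = r\<^sup>2 / (2 * d) + d / 2 * s\<^sup>2 - r * s"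
    using assms by (simp add: power2_diff field_simps power2_eq_square)
  finally show ?thesis by simp
qed

context line_problem
begin

text \<open>Weyl-type argument: if \<open>\<lambda>\<close> were in the resolvent set, testing its solution \<open>v\<close> for the right-hand side
  \<open>u\<^sub>N\<close> (the Bloch solution at \<open>cnj \<lambda>\<close> times a slowly varying cutoff with \<open>\<bar>\<eta>'\<bar> \<le> \<eta> / N\<close>) against \<open>u\<^sub>N\<close> itself
  leaves only terms containing \<open>\<eta>'\<close>, so the norm of \<open>u\<^sub>N\<close> would tend to zero.\<close>

lemma bloch_not_resolvent:
  assumes d: "discr T lam = complex_of_real (2 * cos (2 * pi * \<theta>))"
  shows "\<not> form_resolvent lebesgue (L2 lebesgue) (H1 UNIV) (form_line a) lam"
proof
  assume "form_resolvent lebesgue (L2 lebesgue) (H1 UNIV) (form_line a) lam"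
  then obtain C0 where C0: "\<And>f. f \<in> L2 lebesgue \<Longrightarrow> \<exists>v \<in> H1 UNIV.
      (\<forall>\<phi> \<in> H1 UNIV. form_line a v \<phi> - lam * L2inner lebesgue v \<phi> = L2inner lebesgue f \<phi>) \<and> L2norm lebesgue v \<le> C0 * L2norm lebesgue f"
    unfolding form_resolvent_def by blast
  define y where "y = cis (2 * pi * \<theta>)"
  \<comment> \<open>The Bloch solution belongs to \<open>cnj lam\<close> because exchanging the
    arguments of the form conjugates the equation for \<open>v\<close>.\<close>
  have "discr T (cnj lam) = complex_of_real (2 * cos (2 * pi * \<theta>))"
    unfolding discr_cnj d by simp
  then have "y\<^sup>2 - discr T (cnj lam) * y + 1 = 0" by (simp add: y_def floquet_polynomial)
  from floquet[OF this per] obtain u w where P: "ode_sol q (cnj lam) u w" "u 0 \<noteq> 0 \<or> w 0 \<noteq> 0"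
    "\<And>x. u (x + T) = y * u x" "\<And>x. w (x + T) = y * w x" by blast
  have u: "has_ac_deriv u (\<lambda>x. of_real (q x) * w x)" and w: "has_ac_deriv w (\<lambda>x. - cnj lam * u x)"
    using P(1) by (auto simp: ode_sol_def)
  have "norm (u (x + T)) = norm (u x)" "norm (w (x + T)) = norm (w x)" for x
    by (simp_all add: P(3,4) norm_mult y_def)
  then obtain B1 B2 where B12: "\<And>x. norm (u x) \<le> B1" "\<And>x. norm (w x) \<le> B2"
    using periodic_bounded[OF ac_continuous[OF u] _ T] periodic_bounded[OF ac_continuous[OF w] _ T] by metis
  define B where "B = max B1 B2"
  have Bu: "norm (u x) \<le> B" and Bw: "norm (w x) \<le> B" for x
    using B12(1)[of x] B12(2)[of x] by (auto simp: B_def)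
  note um = ac_measurable[OF u] and wm = ac_measurable[OF w]
  have "\<not> (AE x in lebesgue. x \<in> {0<..<T} \<longrightarrow> q x = 0)"
  proof
    assume "AE x in lebesgue. x \<in> {0<..<T} \<longrightarrow> q x = 0"
    with aq have "AE x in lebesgue. x \<notin> {0<..<T}" by eventually_elim auto
    then have "{0<..<T} \<in> null_sets lebesgue" by (subst AE_iff_null_sets) auto
    then show False using T by (simp add: null_sets_def)
  qed
  then obtain x0 where x0: "u x0 \<noteq> 0" using ode_sol_nontrivial[OF P(1,2) T] by blast
  define cB where "cB = 4 * B\<^sup>2 * (\<integral>t. exp (- \<bar>t\<bar>) \<partial>lebesgue)"
  define uN where "uN N x = complex_of_real (sech N x) * u x" for N x
  define wN where "wN N x = complex_of_real (sech N x) * w x" for N x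
  define E where "E N = (\<integral>x. (cmod (uN N x))\<^sup>2 \<partial>lebesgue)" for N
  have uL: "uN N \<in> L2 lebesgue" "E N \<le> cB * N" if "N > 0" for N
    using sech_L2[OF that um Bu] by (simp_all add: uN_def[abs_def] E_def cB_def)
  have wL: "wN N \<in> L2 lebesgue" "(\<integral>x. (cmod (wN N x))\<^sup>2 \<partial>lebesgue) \<le> cB * N" if "N > 0" for N
    using sech_L2[OF that wm Bw] by (simp_all add: wN_def[abs_def] cB_def)
  have E1: "E 1 > 0"
  proof (rule ccontr)
    assume "\<not> E 1 > 0"
    moreover have "0 \<le> E 1" by (simp add: E_def)
    ultimately have "E 1 = 0" by linarith
    then have "L2inner lebesgue (uN 1) (uN 1) = 0" by (simp only: L2inner_self E_def of_real_0)
    from L2inner_self_eq_0[OF uL(1) this] have "AE x in lebesgue. uN 1 x = 0" by simp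
    then have "AE x in lebesgue. x \<in> {x0-1<..<x0+1} \<longrightarrow> u x = 0"
      using sech_pos by eventually_elim (auto simp: uN_def less_imp_neq[OF sech_pos, symmetric])
    from continuous_AE_eq[OF continuous_on_subset[OF ac_continuous[OF u]] _ _ this, of x0] x0 show False by auto
  qed
  have Emono: "E 1 \<le> E N" if "N \<ge> 1" for N
    unfolding E_def
  proof (rule integral_mono)
    show "integrable lebesgue (\<lambda>x. (cmod (uN 1 x))\<^sup>2)" "integrable lebesgue (\<lambda>x. (cmod (uN N x))\<^sup>2)"
      using uL(1)[of 1] uL(1)[of N] that by (simp_all add: L2_def)
    show "(cmod (uN 1 x))\<^sup>2 \<le> (cmod (uN N x))\<^sup>2" for x
      using sech_mono[OF that, of x] sech_pos[of 1 x]
      by (intro power_mono) (auto simp: uN_def norm_mult intro!: mult_right_mono)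
  qed
  \<comment> \<open>\<open>cY\<close> and \<open>cX\<close> bound the squared norms of
    \<open>v\<close> and of its derivative by multiples of \<open>E N\<close>: the first through the
    resolvent bound, the second by testing the equation with \<open>v\<close>.\<close>
  define cY where "cY = C0\<^sup>2"
  define cX where "cX = C * (norm lam * cY + (1 + cY) / 2)"
  have C: "0 \<le> C" using C1 by simp
  have cY0: "0 \<le> cY" by (simp add: cY_def)
  have cX0: "0 \<le> cX" using C cY0 by (simp add: cX_def)
  \<comment> \<open>Small enough for the terms in \<open>X\<close> and \<open>Y\<close> that
    \<open>weighted_AM_GM\<close> produces to add up to at most half of \<open>E N\<close>.\<close>
  define d where "d = 1 / (cX + cY + 1)"
  have d0: "d > 0" using cX0 cY0 by (simp add: d_def)
  have main: "E N \<le> (Ma\<^sup>2 + 1) * cB / (d * N)" if N1: "N \<ge> 1" for N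
  proof -
    have N: "N > 0" using N1 by simp
    define s' where "s' x = complex_of_real (sech' N x)" for x
    note eta = sech_ac[OF N]
    have sm: "s' \<in> borel_measurable lebesgue"
      unfolding s'_def[abs_def] by (rule loc_int_measurable[OF ac_loc_int[OF eta]])
    have sb: "norm (s' x * t) \<le> 1 / N * norm (of_real (sech N x) * t)" for x t
      using mult_right_mono[OF sech'_le[OF N, of x], of "norm t"] sech_pos[of N x]
      by (simp add: s'_def norm_mult)
    have vL: "(\<lambda>x. s' x * u x) \<in> L2 lebesgue"
      by (rule L2_bound[OF borel_measurable_times[OF sm um] uL(1)[OF N], of "1 / N"]) (simp only: uN_def sb)
    have yL: "(\<lambda>x. s' x * w x) \<in> L2 lebesgue"
      by (rule L2_bound[OF borel_measurable_times[OF sm wm] wL(1)[OF N], of "1 / N"]) (simp only: wN_def sb)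
    have uA: "has_ac_deriv (uN N) (\<lambda>x. s' x * u x + of_real (q x) * wN N x)"
      by (rule ac_cong[OF ac_mult[OF eta u]]) (simp_all add: uN_def wN_def s'_def)
    have wA: "has_ac_deriv (wN N) (\<lambda>x. s' x * w x - cnj lam * uN N x)"
      by (rule ac_cong[OF ac_mult[OF eta w]]) (simp_all add: uN_def wN_def s'_def)
    note H = ac_H1_UNIV[OF uA uL(1)[OF N] L2_add[OF vL L2_weight[OF q_weight wL(1)[OF N]]]]
    obtain v where v: "v \<in> H1 UNIV" "\<And>\<phi>. \<phi> \<in> H1 UNIV \<Longrightarrow> form_line a v \<phi> - lam * L2inner lebesgue v \<phi> = L2inner lebesgue (uN N) \<phi>"
      "L2norm lebesgue v \<le> C0 * L2norm lebesgue (uN N)" using C0[OF uL(1)[OF N]] by blast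
    define g where "g = weak_deriv UNIV v"
    obtain F where F: "has_ac_deriv F g" "AE x in lebesgue. v x = F x"
      "F \<in> L2 lebesgue" "v \<in> L2 lebesgue" "g \<in> L2 lebesgue"
      using H1_UNIV_ac[OF v(1)] unfolding g_def by blast
    define X where "X = (\<integral>x. (cmod (g x))\<^sup>2 \<partial>lebesgue)"
    define Y where "Y = (\<integral>x. (cmod (F x))\<^sup>2 \<partial>lebesgue)"
    have E0: "0 \<le> E N" by (simp add: E_def)
    have FY: "(\<integral>x. (cmod (v x))\<^sup>2 \<partial>lebesgue) = Y"
      unfolding Y_def
    proof (rule integral_cong_AE)
      show "(\<lambda>x. (cmod (v x))\<^sup>2) \<in> borel_measurable lebesgue" "(\<lambda>x. (cmod (F x))\<^sup>2) \<in> borel_measurable lebesgue"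
        using F(3,4) by (auto simp: L2_def)
      show "AE x in lebesgue. (cmod (v x))\<^sup>2 = (cmod (F x))\<^sup>2" using F(2) by eventually_elim simp
    qed
    have Yb: "Y \<le> cY * E N"
    proof -
      have Y0: "0 \<le> Y" by (simp add: Y_def)
      have "sqrt Y \<le> C0 * sqrt (E N)" using v(3) by (simp add: L2norm_def FY E_def)
      then have "(sqrt Y)\<^sup>2 \<le> (C0 * sqrt (E N))\<^sup>2" using Y0 by (intro power_mono) auto
      then show ?thesis using Y0 E0 by (simp add: power_mult_distrib cY_def)
    qed
    have gi: "integrable lebesgue (\<lambda>x. (cmod (g x))\<^sup>2)" and Fi: "integrable lebesgue (\<lambda>x. (cmod (F x))\<^sup>2)"
      and ui: "integrable lebesgue (\<lambda>x. (cmod (uN N x))\<^sup>2)" and wi: "integrable lebesgue (\<lambda>x. (cmod (wN N x))\<^sup>2)"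
      and vi: "integrable lebesgue (\<lambda>x. (cmod (v x))\<^sup>2)"
      using F(3-5) uL(1)[OF N] wL(1)[OF N] by (simp_all add: L2_def)
    have inner_b: "norm (L2inner lebesgue (uN N) v) \<le> (E N + Y) / 2"
    proof -
      have "norm (L2inner lebesgue (uN N) v) \<le> (\<integral>x. ((cmod (uN N x))\<^sup>2 + (cmod (v x))\<^sup>2) / 2 \<partial>lebesgue)"
        unfolding L2inner_def
      proof (rule Bochner_Integration.integral_norm_bound_integral[OF L2_mult_integrable[OF uL(1)[OF N] F(4)]])
        show "integrable lebesgue (\<lambda>x. ((cmod (uN N x))\<^sup>2 + (cmod (v x))\<^sup>2) / 2)" using ui vi by simp
        show "norm (uN N x * cnj (v x)) \<le> ((cmod (uN N x))\<^sup>2 + (cmod (v x))\<^sup>2) / 2" for x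
          using sum_squares_bound[of "cmod (uN N x)" "cmod (v x)"] by (simp add: norm_mult)
      qed
      also have "\<dots> = (E N + Y) / 2" using ui vi by (simp add: E_def FY)
      finally show ?thesis .
    qed
    \<comment> \<open>Energy estimate: \<open>a * q = 1\<close> and \<open>q \<le> C\<close> give
      \<open>1 \<le> C * a\<close> almost everywhere, so the form at \<open>v\<close> controls the
      derivative of \<open>v\<close>, and the equation tested with \<open>v\<close> evaluates the
      form.\<close>
    have Xb: "X \<le> cX * E N"
    proof -
      have gm: "g \<in> borel_measurable lebesgue" using F(5) by (simp add: L2_def)
      have agi: "integrable lebesgue (\<lambda>x. a x * (cmod (g x))\<^sup>2)"
      proof (rule Bochner_Integration.integrable_bound[OF integrable_mult_right[OF gi, of Ma]])
        show "(\<lambda>x. a x * (cmod (g x))\<^sup>2) \<in> borel_measurable lebesgue" using gm a_meas by measurable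
        show "AE x in lebesgue. norm (a x * (cmod (g x))\<^sup>2) \<le> norm (Ma * (cmod (g x))\<^sup>2)"
          using a_bd by eventually_elim (auto simp: abs_mult intro!: mult_right_mono)
      qed
      have "form_line a v v = (\<integral>x. complex_of_real (a x * (cmod (g x))\<^sup>2) \<partial>lebesgue)"
        unfolding form_line_def g_def[symmetric]
        by (rule arg_cong[where f = "integral\<^sup>L lebesgue"], rule ext)
           (simp only: of_real_mult complex_norm_square mult.assoc)
      then have fv: "form_line a v v = of_real (\<integral>x. a x * (cmod (g x))\<^sup>2 \<partial>lebesgue)"
        by (simp only: integral_complex_of_real)
      have "X \<le> (\<integral>x. C * (a x * (cmod (g x))\<^sup>2) \<partial>lebesgue)"
        unfolding X_def
      proof (rule integral_mono_AE[OF gi integrable_mult_right[OF agi]])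
        show "AE x in lebesgue. (cmod (g x))\<^sup>2 \<le> C * (a x * (cmod (g x))\<^sup>2)"
          using aq
        proof eventually_elim
          case (elim x)
          have "q x > 0" using q0[of x] elim by (cases "q x = 0") auto
          moreover from this have "a x > 0" using zero_less_mult_pos2[of "a x" "q x"] elim by simp
          moreover have "q x \<le> C" using q_weight by (simp add: bounded_weight_def abs_le_iff)
          ultimately have "1 \<le> C * a x" using elim mult_left_mono[of "q x" C "a x"] by (simp add: mult.commute)
          then have "1 * (cmod (g x))\<^sup>2 \<le> C * a x * (cmod (g x))\<^sup>2" by (rule mult_right_mono) simp
          then show ?case by (simp add: mult.assoc)
        qed
      qed
      also have "\<dots> = C * (\<integral>x. a x * (cmod (g x))\<^sup>2 \<partial>lebesgue)" by simp
      also have "\<dots> \<le> C * norm (form_line a v v)" unfolding fv using C by (intro mult_left_mono) auto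
      also have "form_line a v v = lam * of_real Y + L2inner lebesgue (uN N) v"
        using v(2)[OF v(1)] by (simp add: L2inner_self FY algebra_simps)
      also have "norm (lam * of_real Y + L2inner lebesgue (uN N) v) \<le> norm lam * Y + (E N + Y) / 2"
      proof -
        have "0 \<le> Y" by (simp add: Y_def)
        then have "norm (lam * of_real Y) = norm lam * Y" by (simp add: norm_mult)
        then show ?thesis
          using norm_triangle_ineq[of "lam * of_real Y" "L2inner lebesgue (uN N) v"] inner_b by linarith
      qed
      also have "\<dots> \<le> norm lam * (cY * E N) + (E N + cY * E N) / 2"
        using Yb by (intro add_mono mult_left_mono divide_right_mono) auto
      also have "C * \<dots> = cX * E N" by (simp add: cX_def algebra_simps add_divide_distrib)
      finally show ?thesis using C by (simp add: mult_left_mono)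
    qed
    \<comment> \<open>The equation for \<open>v\<close>, tested with \<open>uN N\<close>. The flux
      \<open>wN N\<close> is integrated by parts, after which the terms with \<open>cnj lam\<close>
      cancel and only those with the derivative \<open>s'\<close> of the cutoff remain.\<close>
    have key: "of_real (E N) = (\<integral>x. of_real (a x) * (s' x * u x) * cnj (g x) \<partial>lebesgue) - (\<integral>x. s' x * w x * cnj (F x) \<partial>lebesgue)"
    proof -
      have "of_real (E N) = cnj (form_line a v (uN N) - lam * L2inner lebesgue v (uN N))"
        using v(2)[OF H(1)] by (simp add: L2inner_self E_def)
      also have "\<dots> = form_line a (uN N) v - cnj lam * L2inner lebesgue (uN N) v"
        using form_line_cnj[of a "uN N" v] by (simp add: L2inner_cnj)
      also have "form_line a (uN N) v = (\<integral>x. of_real (a x) * (s' x * u x) * cnj (g x) \<partial>lebesgue) + (\<integral>x. wN N x * cnj (g x) \<partial>lebesgue)"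
        using form_line_left(2)[OF H vL wL(1)[OF N] v(1)] by (simp add: g_def)
      also have "(\<integral>x. wN N x * cnj (g x) \<partial>lebesgue) = - (\<integral>x. (s' x * w x - cnj lam * uN N x) * cnj (F x) \<partial>lebesgue)"
        by (rule ac_parts_UNIV[OF wA F(1) wL(1)[OF N] L2_diff[OF yL L2_cmult[OF uL(1)[OF N]]] F(3,5)])
      also have "(\<integral>x. (s' x * w x - cnj lam * uN N x) * cnj (F x) \<partial>lebesgue) =
        (\<integral>x. s' x * w x * cnj (F x) - cnj lam * (uN N x * cnj (F x)) \<partial>lebesgue)"
        by (simp add: algebra_simps)
      also have "\<dots> = (\<integral>x. s' x * w x * cnj (F x) \<partial>lebesgue) - cnj lam * (\<integral>x. uN N x * cnj (F x) \<partial>lebesgue)"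
        by (subst Bochner_Integration.integral_diff)
           (auto intro!: L2_mult_integrable[OF yL F(3)] L2_mult_integrable[OF uL(1)[OF N] F(3)])
      also have "(\<integral>x. uN N x * cnj (F x) \<partial>lebesgue) = L2inner lebesgue (uN N) v"
        unfolding L2inner_def
      proof (rule integral_cong_AE)
        show "AE x in lebesgue. uN N x * cnj (F x) = uN N x * cnj (v x)" using F(2) by eventually_elim simp
      qed (auto intro!: borel_measurable_integrable L2_mult_integrable[OF uL(1)[OF N] F(3)] L2_mult_integrable[OF uL(1)[OF N] F(4)])
      finally show ?thesis by simp
    qed
    \<comment> \<open>The factor \<open>1 / N^2\<close> is the square of the bound on the cutoff
      derivative; combined with \<open>E N \<le> cB * N\<close> it leaves a term of order
      \<open>1 / N\<close>.\<close>
    have t1: "norm (\<integral>x. of_real (a x) * (s' x * u x) * cnj (g x) \<partial>lebesgue) \<le> Ma\<^sup>2 / (2 * d * N\<^sup>2) * E N + d / 2 * X"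
    proof -
      have ig: "integrable lebesgue (\<lambda>x. of_real (a x) * (s' x * u x) * cnj (g x))"
        using form_line_left(1)[OF H vL wL(1)[OF N] v(1)] by (simp add: g_def)
      have i2: "integrable lebesgue (\<lambda>x. Ma\<^sup>2 / (2 * d * N\<^sup>2) * (cmod (uN N x))\<^sup>2 + d / 2 * (cmod (g x))\<^sup>2)"
        using ui gi by simp
      have "norm (\<integral>x. of_real (a x) * (s' x * u x) * cnj (g x) \<partial>lebesgue) \<le> (\<integral>x. norm (of_real (a x) * (s' x * u x) * cnj (g x)) \<partial>lebesgue)"
        by simp
      also have "\<dots> \<le> (\<integral>x. Ma\<^sup>2 / (2 * d * N\<^sup>2) * (cmod (uN N x))\<^sup>2 + d / 2 * (cmod (g x))\<^sup>2 \<partial>lebesgue)"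
      proof (rule integral_mono_AE[OF integrable_norm[OF ig] i2])
        show "AE x in lebesgue. norm (of_real (a x) * (s' x * u x) * cnj (g x)) \<le> Ma\<^sup>2 / (2 * d * N\<^sup>2) * (cmod (uN N x))\<^sup>2 + d / 2 * (cmod (g x))\<^sup>2"
          using a_bd
        proof eventually_elim
          case (elim x)
          have "norm (of_real (a x) * (s' x * u x) * cnj (g x)) = \<bar>a x\<bar> * norm (s' x * u x) * norm (g x)" by (simp add: norm_mult)
          also have "\<dots> \<le> (Ma * (1 / N * norm (uN N x))) * norm (g x)"
            using elim sb[of x "u x"] by (intro mult_right_mono mult_mono) (auto simp: uN_def)
          also have "\<dots> \<le> (Ma * (1 / N * norm (uN N x)))\<^sup>2 / (2 * d) + d / 2 * (norm (g x))\<^sup>2" by (rule weighted_AM_GM[OF d0])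
          also have "(Ma * (1 / N * norm (uN N x)))\<^sup>2 / (2 * d) = Ma\<^sup>2 / (2 * d * N\<^sup>2) * (cmod (uN N x))\<^sup>2"
            by (simp add: power_mult_distrib power_divide)
          finally show ?case .
        qed
      qed
      also have "\<dots> = Ma\<^sup>2 / (2 * d * N\<^sup>2) * E N + d / 2 * X" using ui gi by (simp add: E_def X_def)
      finally show ?thesis .
    qed
    have t2: "norm (\<integral>x. s' x * w x * cnj (F x) \<partial>lebesgue) \<le> 1 / (2 * d * N\<^sup>2) * (cB * N) + d / 2 * Y"
    proof -
      have i2: "integrable lebesgue (\<lambda>x. 1 / (2 * d * N\<^sup>2) * (cmod (wN N x))\<^sup>2 + d / 2 * (cmod (F x))\<^sup>2)"
        using wi Fi by simp
      have "norm (\<integral>x. s' x * w x * cnj (F x) \<partial>lebesgue) \<le> (\<integral>x. 1 / (2 * d * N\<^sup>2) * (cmod (wN N x))\<^sup>2 + d / 2 * (cmod (F x))\<^sup>2 \<partial>lebesgue)"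
      proof (rule Bochner_Integration.integral_norm_bound_integral[OF L2_mult_integrable[OF yL F(3)] i2])
        fix x
        have "norm (s' x * w x * cnj (F x)) = norm (s' x * w x) * norm (F x)" by (simp add: norm_mult)
        also have "\<dots> \<le> (1 / N * norm (wN N x)) * norm (F x)"
          using sb[of x "w x"] by (intro mult_right_mono) (auto simp: wN_def)
        also have "\<dots> \<le> (1 / N * norm (wN N x))\<^sup>2 / (2 * d) + d / 2 * (norm (F x))\<^sup>2" by (rule weighted_AM_GM[OF d0])
        also have "(1 / N * norm (wN N x))\<^sup>2 / (2 * d) = 1 / (2 * d * N\<^sup>2) * (cmod (wN N x))\<^sup>2"
          by (simp add: power_mult_distrib power_divide)
        finally show "norm (s' x * w x * cnj (F x)) \<le> 1 / (2 * d * N\<^sup>2) * (cmod (wN N x))\<^sup>2 + d / 2 * (cmod (F x))\<^sup>2" .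
      qed
      also have "\<dots> = 1 / (2 * d * N\<^sup>2) * (\<integral>x. (cmod (wN N x))\<^sup>2 \<partial>lebesgue) + d / 2 * Y" using wi Fi by (simp add: Y_def)
      also have "\<dots> \<le> 1 / (2 * d * N\<^sup>2) * (cB * N) + d / 2 * Y"
        using wL(2)[OF N] d0 by (intro add_right_mono mult_left_mono) auto
      finally show ?thesis .
    qed
    have "E N = norm (complex_of_real (E N))" using E0 by simp
    also have "\<dots> \<le> norm (\<integral>x. of_real (a x) * (s' x * u x) * cnj (g x) \<partial>lebesgue) + norm (\<integral>x. s' x * w x * cnj (F x) \<partial>lebesgue)"
      unfolding key by (rule norm_triangle_ineq4)
    also have "\<dots> \<le> (Ma\<^sup>2 / (2 * d * N\<^sup>2) * E N + d / 2 * X) + (1 / (2 * d * N\<^sup>2) * (cB * N) + d / 2 * Y)"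
      using t1 t2 by (rule add_mono)
    also have "\<dots> \<le> (Ma\<^sup>2 / (2 * d * N\<^sup>2) * (cB * N) + d / 2 * (cX * E N)) + (1 / (2 * d * N\<^sup>2) * (cB * N) + d / 2 * (cY * E N))"
      using Xb Yb d0 uL(2)[OF N] by (intro add_mono mult_left_mono order_refl) auto
    also have "\<dots> = (Ma\<^sup>2 + 1) * cB / (2 * d * N) + d / 2 * ((cX + cY) * E N)"
      using N d0 by (simp add: field_simps power2_eq_square)
    finally have EN: "E N \<le> (Ma\<^sup>2 + 1) * cB / (2 * d * N) + d / 2 * ((cX + cY) * E N)" .
    have "d / 2 * ((cX + cY) * E N) \<le> E N / 2"
    proof -
      have "d * (cX + cY) \<le> 1" using cX0 cY0 by (simp add: d_def)
      then have "d * (cX + cY) * E N \<le> 1 * E N" using E0 by (rule mult_right_mono)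
      then show ?thesis by simp
    qed
    with EN have "E N \<le> (Ma\<^sup>2 + 1) * cB / (2 * d * N) + E N / 2" by linarith
    moreover have "(Ma\<^sup>2 + 1) * cB / (2 * d * N) = (Ma\<^sup>2 + 1) * cB / (d * N) / 2" by simp
    moreover have "e \<le> t" if "e \<le> r + e / 2" "r = t / 2" for e r t :: real using that by linarith
    ultimately show ?thesis by blast
  qed
  \<comment> \<open>By \<open>main\<close> the norm \<open>E N\<close> tends to 0, while
    \<open>Emono\<close> keeps it above the positive \<open>E 1\<close>.\<close>
  obtain n where n: "(Ma\<^sup>2 + 1) * cB / d < real n * E 1" using reals_Archimedean3[OF E1] by blast
  define N where "N = real (Suc n)"
  have "E 1 \<le> (Ma\<^sup>2 + 1) * cB / (d * N)" using Emono[of N] main[of N] by (simp add: N_def)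
  then have "E 1 * N \<le> (Ma\<^sup>2 + 1) * cB / d" using d0 by (simp add: N_def field_simps del: of_nat_Suc)
  also have "\<dots> < real n * E 1" by (rule n)
  also have "\<dots> \<le> E 1 * N" using E1 by (simp add: N_def algebra_simps)
  finally show False by simp
qed

theorem line_spectrum_iff:
  "lam \<in> form_spectrum lebesgue (L2 lebesgue) (H1 UNIV) (form_line a)
     \<longleftrightarrow> (\<exists>\<theta>\<in>{0..<1}. discr T lam = complex_of_real (2 * cos (2 * pi * \<theta>)))"
proof
  show "lam \<in> form_spectrum lebesgue (L2 lebesgue) (H1 UNIV) (form_line a)"
    if "\<exists>\<theta>\<in>{0..<1}. discr T lam = complex_of_real (2 * cos (2 * pi * \<theta>))"
    using that bloch_not_resolvent by (auto simp: form_spectrum_def)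
next
  assume lam: "lam \<in> form_spectrum lebesgue (L2 lebesgue) (H1 UNIV) (form_line a)"
  show "\<exists>\<theta>\<in>{0..<1}. discr T lam = complex_of_real (2 * cos (2 * pi * \<theta>))"
  proof (rule ccontr)
    assume d: "\<not> (\<exists>\<theta>\<in>{0..<1}. discr T lam = complex_of_real (2 * cos (2 * pi * \<theta>)))"
    then have d': "\<not> (\<exists>\<theta>\<in>{0..<1}. discr T (cnj lam) = complex_of_real (2 * cos (2 * pi * \<theta>)))"
      unfolding discr_cnj by (metis complex_cnj_cnj complex_cnj_complex_of_real)
    have "form_resolvent lebesgue (L2 lebesgue) (H1 UNIV) (form_line a) lam"
    proof (rule form_resolventI[OF _ order_refl form_line_cnj solve_line[OF d]])
      show "H1 UNIV \<subseteq> L2 lebesgue" using H1_UNIV_ac by blast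
    qed (use solve_line[OF d'] in blast)
    with lam show False by (simp add: form_spectrum_def)
  qed
qed

end

section \<open>Convergence of the discriminants\<close>

lemma bounded_weight_scale:
  assumes "bounded_weight C g" "e > 0"
  shows "bounded_weight (C * \<bar>r\<bar>) (\<lambda>x. g (x / e) * r)"
proof -
  have "(\<lambda>x. g (0 + (1 / e) *\<^sub>R x)) \<in> borel_measurable lebesgue"
    by (rule borel_measurable_affine) (use assms in \<open>auto simp: bounded_weight_def\<close>)
  then have "(\<lambda>x. g (x / e)) \<in> borel_measurable lebesgue" by simp
  then have "(\<lambda>x. g (x / e) * r) \<in> borel_measurable lebesgue" by measurable
  then show ?thesis using assms(1) by (auto simp: bounded_weight_def abs_mult intro: mult_right_mono)
qed

text \<open>Substituting \<open>x = e * y\<close>, each integration against \<open>g\<close>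
  contributes \<open>r * e\<close> and each one against \<open>h\<close> contributes
  \<open>s * e\<close>. As \<open>r * s * e\<^sup>2 = 1\<close>, at most one factor is left
  over.\<close>

lemma iter_int_scale:
  assumes "bounded_weight C g" "bounded_weight C h" and e: "e > 0" and "r * s * e\<^sup>2 = 1"
  shows "iter_int (\<lambda>x. g (x / e) * r) (\<lambda>x. h (x / e) * s) k (e * y) = of_real (if even k then 1 else r * e) * iter_int g h k y"
  using assms(1,2,4)
proof (induction k arbitrary: g h r s y)
  case (Suc k)
  let ?g = "\<lambda>x. g (x / e) * r" and ?h = "\<lambda>x. h (x / e) * s"
  let ?c = "if even k then 1 else s * e"
  define D where "D = C * \<bar>r\<bar> + C * \<bar>s\<bar>"
  have C: "0 \<le> C" by (rule bounded_weight_nonneg[OF Suc.prems(1)])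
  have w: "bounded_weight D ?g" "bounded_weight D ?h"
    using bounded_weight_mono[OF bounded_weight_scale[OF Suc.prems(1) e, of r], of D]
      bounded_weight_mono[OF bounded_weight_scale[OF Suc.prems(2) e, of s], of D] C by (auto simp: D_def)
  have IH: "iter_int ?h ?g k (e * x) = of_real ?c * iter_int h g k x" for x
    by (rule Suc.IH) (use Suc.prems in \<open>auto simp: mult.commute\<close>)
  have 1: "has_ac_deriv (\<lambda>x. iter_int ?g ?h (Suc k) (0 + e * x)) (\<lambda>x. of_real e * (of_real (?g (0 + e * x)) * iter_int ?h ?g k (0 + e * x)))"
    by (rule ac_affine[OF iter_int_ac[OF w] e])
  have "has_ac_deriv (\<lambda>x. of_real (if even (Suc k) then 1 else r * e) * iter_int g h (Suc k) x)
    (\<lambda>x. of_real (if even (Suc k) then 1 else r * e) * (of_real (g x) * iter_int h g k x))"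
    by (rule ac_cmult[OF iter_int_ac[OF Suc.prems(1,2)]])
  then have 2: "has_ac_deriv (\<lambda>x. of_real (if even (Suc k) then 1 else r * e) * iter_int g h (Suc k) x)
    (\<lambda>x. of_real e * (of_real (?g (0 + e * x)) * iter_int ?h ?g k (0 + e * x)))"
  proof (rule ac_cong)
    fix x
    have "e * r * ?c = (if even (Suc k) then 1 else r * e)"
      using Suc.prems(3) by (auto simp: power2_eq_square mult_ac)
    then have "complex_of_real e * of_real r * of_real ?c = of_real (if even (Suc k) then 1 else r * e)"
      using arg_cong[of _ _ complex_of_real] by (simp only: of_real_mult[symmetric])
    then show "of_real (if even (Suc k) then 1 else r * e) * (of_real (g x) * iter_int h g k x) =
      of_real e * (of_real (?g (0 + e * x)) * iter_int ?h ?g k (0 + e * x))"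
      using e by (simp only: add_0 IH of_real_mult nonzero_mult_div_cancel_left less_imp_neq[OF e, symmetric] not_False_eq_True) (simp add: mult_ac)
  qed simp
  from ac_unique[OF 1 2, of y 0] show ?case by (simp add: iter_int_0 del: iter_int.simps)
qed simp

text \<open>Only even orders occur in the trace of the monodromy matrix, so no scaling factor
  remains.\<close>

lemma even_series_scale:
  assumes "bounded_weight C g" "bounded_weight C h" "e > 0" "r * s * e\<^sup>2 = 1"
  shows "even_series (\<lambda>x. g (x / e) * r) (\<lambda>x. h (x / e) * s) \<mu> e = even_series g h \<mu> 1"
  unfolding even_series_def using iter_int_scale[OF assms, of "2 * n" 1 for n] by simp

lemma primitive_diff:
  assumes "loc_int f" "loc_int g" shows "primitive (\<lambda>t. f t - g t) x = primitive f x - primitive g x"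
  using ac_unique[OF ac_primitive[OF loc_int_diff[OF assms]] ac_diff[OF ac_primitive[OF assms(1)] ac_primitive[OF assms(2)]], of x 0]
  by simp

text \<open>Replaces the weights one factor at a time: \<open>k\<close> replacements, each costing
  \<delta>. The hypothesis \<open>1 \<le> C\<close> lets the replaced factor be counted as
  \<open>C * \<delta>\<close>, which keeps the power of \<open>C\<close> uniform.\<close>

lemma iter_int_Lipschitz:
  assumes "bounded_weight C g" "bounded_weight C h" "bounded_weight C g'" "bounded_weight C h'" "1 \<le> C"
    "\<And>x. \<bar>g x - g' x\<bar> \<le> \<delta>" "\<And>x. \<bar>h x - h' x\<bar> \<le> \<delta>"
  shows "norm (iter_int g h k x - iter_int g' h' k x) \<le> \<delta> * real k * C ^ k * \<bar>x\<bar> ^ k / fact k"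
  using assms
proof (induction k arbitrary: g h g' h' x)
  case (Suc k)
  note w = Suc.prems
  have d: "0 \<le> \<delta>" using w(6)[of 0] by linarith
  have l: "loc_int (\<lambda>t. of_real (g t) * iter_int h g k t)" "loc_int (\<lambda>t. of_real (g' t) * iter_int h' g' k t)"
    by (rule loc_int_weight[OF w(1) iter_int_continuous[OF w(2,1)]], rule loc_int_weight[OF w(3) iter_int_continuous[OF w(4,3)]])
  have "norm (primitive (\<lambda>t. of_real (g t) * iter_int h g k t - of_real (g' t) * iter_int h' g' k t) x)
      \<le> (\<delta> * real (Suc k) * C ^ Suc k) * \<bar>x\<bar> ^ Suc k / fact (Suc k)"
  proof (rule norm_primitive_le[OF loc_int_diff[OF l]])
    fix t
    let ?X = "iter_int h g k t" and ?Y = "iter_int h' g' k t"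
    let ?b = "C ^ k * \<bar>t\<bar> ^ k / fact k"
    have b0: "0 \<le> ?b" using w(5) by simp
    have "norm (of_real (g t) * ?X - of_real (g' t) * ?Y) = norm (of_real (g t - g' t) * ?X + of_real (g' t) * (?X - ?Y))"
      by (simp add: algebra_simps)
    also have "\<dots> \<le> \<bar>g t - g' t\<bar> * norm ?X + \<bar>g' t\<bar> * norm (?X - ?Y)"
      by (rule order_trans[OF norm_triangle_ineq]) (simp only: norm_mult norm_of_real order_refl)
    also have "\<dots> \<le> \<delta> * ?b + C * (\<delta> * real k * C ^ k * \<bar>t\<bar> ^ k / fact k)"
      using w d by (intro add_mono mult_mono iter_int_bound Suc.IH) (auto simp: bounded_weight_def)
    also have "\<dots> \<le> C * (\<delta> * ?b) + C * (\<delta> * real k * C ^ k * \<bar>t\<bar> ^ k / fact k)"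
      using mult_right_mono[OF w(5) mult_nonneg_nonneg[OF d b0]] by (intro add_right_mono) simp
    also have "\<dots> = (\<delta> * real (Suc k) * C ^ Suc k) * \<bar>t\<bar> ^ k / fact k"
      by (simp add: algebra_simps add_divide_distrib)
    finally show "norm (of_real (g t) * ?X - of_real (g' t) * ?Y) \<le> (\<delta> * real (Suc k) * C ^ Suc k) * \<bar>t\<bar> ^ k / fact k" .
  qed
  then show ?case unfolding iter_int.simps primitive_diff[OF l] .
qed simp

lemma even_series_Lipschitz:
  assumes w: "bounded_weight C g" "bounded_weight C h" "bounded_weight C g'" "bounded_weight C h'" "1 \<le> C"
    "\<And>x. \<bar>g x - g' x\<bar> \<le> \<delta>" "\<And>x. \<bar>h x - h' x\<bar> \<le> \<delta>"
  shows "norm (even_series g h \<mu> 1 - even_series g' h' \<mu> 1) \<le> \<delta> * exp (norm \<mu> * C\<^sup>2)"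
proof -
  have d: "0 \<le> \<delta>" using w(6)[of 0] by linarith
  let ?t = "\<lambda>n. \<mu> ^ n * iter_int g h (2 * n) 1 - \<mu> ^ n * iter_int g' h' (2 * n) 1"
  note s = summable_series(1)[OF w(1,2), of \<mu> 1] summable_series(1)[OF w(3,4), of \<mu> 1]
  have e: "even_series g h \<mu> 1 - even_series g' h' \<mu> 1 = (\<Sum>n. ?t n)"
    unfolding even_series_def by (rule suminf_diff[OF s])
  have b: "norm (?t n) \<le> \<delta> * ((norm \<mu> * C\<^sup>2) ^ n / fact n)" for n
  proof -
    \<comment> \<open>Absorbs the number of replacements into the factorial, so that the sum becomes
      an exponential series.\<close>
    have f: "real (2 * n) / fact (2 * n) \<le> 1 / fact n"
    proof (cases n)
      case (Suc m)
      have "fact n * real (2 * n) \<le> fact (2 * n - 1) * real (2 * n)"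
        using Suc by (intro mult_right_mono fact_mono) auto
      also have "\<dots> = fact (2 * n)" using Suc by (subst (2) fact_reduce) (auto simp: mult.commute)
      finally show ?thesis by (simp add: field_simps)
    qed simp
    have "norm (?t n) = norm \<mu> ^ n * norm (iter_int g h (2 * n) 1 - iter_int g' h' (2 * n) 1)"
      by (simp only: right_diff_distrib[symmetric] norm_mult norm_power)
    also have "\<dots> \<le> norm \<mu> ^ n * (\<delta> * real (2 * n) * C ^ (2 * n) * \<bar>1\<bar> ^ (2 * n) / fact (2 * n))"
      by (intro mult_left_mono iter_int_Lipschitz w) auto
    also have "\<dots> = norm \<mu> ^ n * \<delta> * C ^ (2 * n) * (real (2 * n) / fact (2 * n))" by simp
    also have "\<dots> \<le> norm \<mu> ^ n * \<delta> * C ^ (2 * n) * (1 / fact n)"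
      using d w(5) by (intro mult_left_mono f) auto
    also have "\<dots> = \<delta> * ((norm \<mu> * C\<^sup>2) ^ n / fact n)" by (simp add: power_mult_distrib power_mult)
    finally show ?thesis .
  qed
  have es: "(\<lambda>n. (norm \<mu> * C\<^sup>2) ^ n / fact n) sums exp (norm \<mu> * C\<^sup>2)"
    using exp_converges[of "norm \<mu> * C\<^sup>2"] by (simp add: field_simps)
  have "norm (\<Sum>n. ?t n) \<le> (\<Sum>n. \<delta> * ((norm \<mu> * C\<^sup>2) ^ n / fact n))"
    by (rule norm_suminf_le[OF b summable_mult[OF sums_summable[OF es]]])
  also have "\<dots> = \<delta> * exp (norm \<mu> * C\<^sup>2)"
    using suminf_mult[OF sums_summable[OF es], of \<delta>] sums_unique[OF es] by simp
  finally show ?thesis unfolding e .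
qed

lemma even_series_holomorphic:
  assumes "bounded_weight C g" "bounded_weight C h"
  shows "(\<lambda>\<mu>. even_series g h \<mu> x) holomorphic_on UNIV"
  unfolding holomorphic_on_def
proof
  fix z :: complex
  have "(\<lambda>\<mu>. even_series g h \<mu> x) holomorphic_on ball 0 (norm z + 1)"
  proof (rule power_series_holomorphic)
    fix w :: complex
    have "(\<lambda>n. w ^ n * iter_int g h (2 * n) x) sums even_series g h w x"
      unfolding even_series_def by (rule summable_sums[OF summable_series(1)[OF assms]])
    then show "(\<lambda>n. iter_int g h (2 * n) x * (w - 0) ^ n) sums even_series g h w x" by (simp add: mult.commute)
  qed
  then show "(\<lambda>\<mu>. even_series g h \<mu> x) field_differentiable at z within UNIV"
    using holomorphic_on_imp_differentiable_at[of _ "ball 0 (norm z + 1)" z] by simp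
qed

lemma even_series_at_0: "even_series g h 0 x = 1"
  unfolding even_series_def by (subst suminf_finite[of "{0}"]) auto

text \<open>This form of the trace condition is visibly closed, as the passage to the limit
  requires.\<close>

lemma two_cos_range:
  "(\<exists>\<theta>\<in>{0..<1}. z = complex_of_real (2 * cos (2 * pi * \<theta>))) \<longleftrightarrow> Im z = 0 \<and> \<bar>Re z\<bar> \<le> 2"
proof
  assume "\<exists>\<theta>\<in>{0..<1}. z = complex_of_real (2 * cos (2 * pi * \<theta>))"
  then obtain \<theta> where "z = complex_of_real (2 * cos (2 * pi * \<theta>))" by blast
  moreover have "\<bar>2 * cos (2 * pi * \<theta>)\<bar> \<le> 2" using abs_cos_le_one[of "2 * pi * \<theta>"] by (simp only: abs_mult)
  ultimately show "Im z = 0 \<and> \<bar>Re z\<bar> \<le> 2" by (simp only: Im_complex_of_real Re_complex_of_real)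
next
  assume z: "Im z = 0 \<and> \<bar>Re z\<bar> \<le> 2"
  define \<theta> where "\<theta> = arccos (Re z / 2) / (2 * pi)"
  have b: "-1 \<le> Re z / 2" "Re z / 2 \<le> 1" using z by auto
  have "0 \<le> \<theta>" using arccos_lbound[OF b] by (simp add: \<theta>_def)
  moreover have "arccos (Re z / 2) \<le> pi" by (rule arccos_ubound[OF b])
  then have "arccos (Re z / 2) < 2 * pi" using pi_gt_zero by linarith
  then have "\<theta> < 1" by (simp add: \<theta>_def)
  moreover have "cos (2 * pi * \<theta>) = Re z / 2" using cos_arccos[OF b] by (simp add: \<theta>_def)
  ultimately show "\<exists>\<theta>\<in>{0..<1}. z = complex_of_real (2 * cos (2 * pi * \<theta>))"
    using z by (intro bexI[of _ \<theta>]) (auto simp: complex_eq_iff)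
qed

section \<open>Periodic properties almost everywhere and the indicators of the two phases\<close>

lemma AE_affine:
  assumes ae: "AE x in lebesgue. P (x::real)" and m: "m \<noteq> 0" shows "AE x in lebesgue. P (c + m * x)"
proof -
  obtain N where N: "{x \<in> space lebesgue. \<not> P x} \<subseteq> N" "N \<in> null_sets lebesgue"
    using ae unfolding eventually_ae_filter by blast
  let ?f = "\<lambda>x. (x - c) / m"
  have "negligible (?f ` N)"
    using N(2) m by (intro negligible_differentiable_image_negligible)
      (auto simp: negligible_iff_null_sets differentiable_on_def intro!: derivative_intros)
  moreover have "{x. \<not> P (c + m * x)} \<subseteq> ?f ` N"
  proof
    fix x assume "x \<in> {x. \<not> P (c + m * x)}"
    then have "c + m * x \<in> N" using N(1) by auto
    then show "x \<in> ?f ` N" using m by (intro image_eqI[of _ _ "c + m * x"]) auto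
  qed
  ultimately have "?f ` N \<in> null_sets lebesgue" "{x \<in> space lebesgue. \<not> P (c + m * x)} \<subseteq> ?f ` N"
    by (auto simp: negligible_iff_null_sets)
  then show ?thesis unfolding eventually_ae_filter by blast
qed

lemma AE_countable: "countable A \<Longrightarrow> AE x in lebesgue. (x::real) \<notin> A"
  by (intro AE_completion AE_not_in countable_imp_null_set_lborel)

lemma periodic_int:
  assumes "\<And>x::real. f (x + 1) = f x" shows "f (x + of_int n) = f x"
proof -
  have n: "f (y + real m) = f y" for y m
  proof (induction m)
    case (Suc m)
    have "y + real (Suc m) = (y + real m) + 1" by simp
    then show ?case using Suc assms by metis
  qed simp
  show ?thesis
  proof (cases "0 \<le> n")
    case True then show ?thesis using n[of x "nat n"] by simp
  next
    case False then show ?thesis using n[of "x + of_int n" "nat (- n)"] by simp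
  qed
qed

text \<open>Countably many integer translates of the exceptional set are null together, and every
  non-integer point has a translate in the open unit interval.\<close>

lemma AE_periodic:
  assumes ae: "AE x in lebesgue. x \<in> {0<..<1} \<longrightarrow> P x" and per: "\<And>x::real. P (x + 1) = P x"
  shows "AE x in lebesgue. P x"
proof -
  have "AE x in lebesgue. x + of_int n \<in> {0<..<1} \<longrightarrow> P x" for n
    using AE_affine[OF ae, of 1 "of_int n"]
    by (simp only: mult_1 add.commute[of "of_int n"] periodic_int[of P, OF per] one_neq_zero not_False_eq_True simp_thms)
  then have "AE x in lebesgue. \<forall>n::int. x + of_int n \<in> {0<..<1} \<longrightarrow> P x"
    unfolding AE_all_countable by blast
  moreover have "AE x in lebesgue. x \<notin> range (real_of_int)" by (rule AE_countable) simp
  ultimately show ?thesis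
  proof eventually_elim
    case (elim x)
    have "x + of_int (- \<lfloor>x\<rfloor>) \<in> {0<..<1}"
    proof -
      have "x \<noteq> of_int \<lfloor>x\<rfloor>" using elim(2) by (metis rangeI)
      then have "0 < x - of_int \<lfloor>x\<rfloor>" "x - of_int \<lfloor>x\<rfloor> < 1" using of_int_floor_le[of x] by linarith+
      then show ?thesis unfolding greaterThanLessThan_iff of_int_minus diff_conv_add_uminus by (rule conjI)
    qed
    with elim(1) show ?case by blast
  qed
qed

lemma chi_facts:
  assumes "\<alpha> < \<beta>" "\<beta> < \<alpha> + 1"
  shows "chi0 \<alpha> \<beta> x \<in> {0, 1}" "chi1 \<alpha> \<beta> x \<in> {0, 1}" "chi0 \<alpha> \<beta> x * chi1 \<alpha> \<beta> x = 0"
    "chi0 \<alpha> \<beta> (x + 1) = chi0 \<alpha> \<beta> x" "chi1 \<alpha> \<beta> (x + 1) = chi1 \<alpha> \<beta> x"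
proof -
  show "chi0 \<alpha> \<beta> x \<in> {0, 1}" "chi1 \<alpha> \<beta> x \<in> {0, 1}" by (auto simp: chi0_def chi1_def indicator_def)
  have "\<not> (x \<in> F0 \<alpha> \<beta> \<and> x \<in> F1 \<alpha> \<beta>)"
  proof
    assume "x \<in> F0 \<alpha> \<beta> \<and> x \<in> F1 \<alpha> \<beta>"
    then obtain n m :: int where nm: "\<alpha> + n < x" "x < \<beta> + n" "\<beta> + m < x" "x < \<alpha> + m + 1"
      by (auto simp: F0_def F1_def)
    then have "real_of_int m < real_of_int n" "real_of_int n < real_of_int (m + 1)" by auto
    then have "m < n" "n < m + 1" by (simp_all only: of_int_less_iff)
    then show False by linarith
  qed
  then show "chi0 \<alpha> \<beta> x * chi1 \<alpha> \<beta> x = 0" by (auto simp: chi0_def chi1_def indicator_def)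
  have "x + 1 \<in> F0 \<alpha> \<beta> \<longleftrightarrow> x \<in> F0 \<alpha> \<beta>"
  proof
    show "x \<in> F0 \<alpha> \<beta>" if "x + 1 \<in> F0 \<alpha> \<beta>"
    proof -
      from that obtain n :: int where "\<alpha> + n < x + 1" "x + 1 < \<beta> + n" by (auto simp: F0_def)
      then show ?thesis by (auto simp: F0_def intro!: exI[of _ "n - 1"])
    qed
    show "x + 1 \<in> F0 \<alpha> \<beta>" if "x \<in> F0 \<alpha> \<beta>"
    proof -
      from that obtain n :: int where "\<alpha> + n < x" "x < \<beta> + n" by (auto simp: F0_def)
      then show ?thesis by (auto simp: F0_def intro!: exI[of _ "n + 1"])
    qed
  qed
  then show "chi0 \<alpha> \<beta> (x + 1) = chi0 \<alpha> \<beta> x" by (simp add: chi0_def indicator_def)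
  have "x + 1 \<in> F1 \<alpha> \<beta> \<longleftrightarrow> x \<in> F1 \<alpha> \<beta>"
  proof
    show "x \<in> F1 \<alpha> \<beta>" if "x + 1 \<in> F1 \<alpha> \<beta>"
    proof -
      from that obtain n :: int where "\<beta> + n < x + 1" "x + 1 < \<alpha> + n + 1" by (auto simp: F1_def)
      then show ?thesis by (auto simp: F1_def intro!: exI[of _ "n - 1"])
    qed
    show "x + 1 \<in> F1 \<alpha> \<beta>" if "x \<in> F1 \<alpha> \<beta>"
    proof -
      from that obtain n :: int where "\<beta> + n < x" "x < \<alpha> + n + 1" by (auto simp: F1_def)
      then show ?thesis by (auto simp: F1_def intro!: exI[of _ "n + 1"])
    qed
  qed
  then show "chi1 \<alpha> \<beta> (x + 1) = chi1 \<alpha> \<beta> x" by (simp add: chi1_def indicator_def)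
qed

lemma chi_measurable: "chi0 \<alpha> \<beta> \<in> borel_measurable lebesgue" "chi1 \<alpha> \<beta> \<in> borel_measurable lebesgue"
proof -
  have "F0 \<alpha> \<beta> \<in> sets borel" "F1 \<alpha> \<beta> \<in> sets borel" by (auto simp: F0_def F1_def intro!: borel_open)
  then show "chi0 \<alpha> \<beta> \<in> borel_measurable lebesgue" "chi1 \<alpha> \<beta> \<in> borel_measurable lebesgue"
    unfolding chi0_def chi1_def by (auto intro!: borel_measurable_indicator)
qed

lemma chi_sum_AE: "AE x in lebesgue. x \<in> F0 \<alpha> \<beta> \<or> x \<in> F1 \<alpha> \<beta>"
proof -
  have "AE x in lebesgue. x \<notin> range (\<lambda>n::int. \<alpha> + of_int n) \<union> range (\<lambda>n::int. \<beta> + of_int n)"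
    by (rule AE_countable) auto
  then show ?thesis
  proof eventually_elim
    case (elim x)
    define n where "n = \<lfloor>x - \<alpha>\<rfloor>"
    have "x \<noteq> \<alpha> + of_int n" "x \<noteq> \<beta> + of_int n" using elim by auto
    moreover have "of_int n \<le> x - \<alpha>" "x - \<alpha> < of_int n + 1" unfolding n_def by linarith+
    ultimately have "\<alpha> + of_int n < x" "x < \<alpha> + of_int n + 1" "x < \<beta> + of_int n \<or> \<beta> + of_int n < x" by linarith+
    then show ?case unfolding F0_def F1_def by auto
  qed
qed

lemma chi0_unit:
  assumes "0 < \<alpha>" "\<beta> < 1" "x \<in> {0<..<1}" shows "chi0 \<alpha> \<beta> x = (if x \<in> {\<alpha><..<\<beta>} then 1 else 0)"
proof -
  have "x \<in> F0 \<alpha> \<beta> \<longleftrightarrow> x \<in> {\<alpha><..<\<beta>}"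
  proof
    assume "x \<in> F0 \<alpha> \<beta>"
    then obtain n :: int where n: "\<alpha> + n < x" "x < \<beta> + n" by (auto simp: F0_def)
    then have "real_of_int n < 1" "-1 < real_of_int n" using assms by auto
    then have "n = 0" by linarith
    with n show "x \<in> {\<alpha><..<\<beta>}" by simp
  next
    assume "x \<in> {\<alpha><..<\<beta>}"
    then show "x \<in> F0 \<alpha> \<beta>" by (auto simp: F0_def intro!: exI[of _ 0])
  qed
  then show ?thesis by (simp add: chi0_def indicator_def)
qed

section \<open>Explicit transfer over the cell for a constant coefficient\<close>

lemma ac_eq_on:
  assumes F: "has_ac_deriv F f" and z: "AE x in lebesgue. x \<in> {a<..<b} \<longrightarrow> f x = 0" and "a \<le> b"
  shows "F b = F a"
proof -
  have "AE x in lebesgue. indicat_real {a..b} x *\<^sub>R f x = 0"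
    using z AE_not_endpoint[of a] AE_not_endpoint[of b] by eventually_elim (auto simp: indicator_def)
  then have "(LINT x:{a..b}|lebesgue. f x) = 0"
    unfolding set_lebesgue_integral_def by (rule integral_eq_zero_AE)
  then show ?thesis using ac_integral[OF F \<open>a \<le> b\<close>] by simp
qed

lemma ac_trig:
  "has_ac_deriv (\<lambda>x. cos (s * of_real (x - c))) (\<lambda>x. - s * sin (s * of_real (x - c)))"
  "has_ac_deriv (\<lambda>x. sin (s * of_real (x - c))) (\<lambda>x. s * cos (s * of_real (x - c)))"
proof -
  have D: "((\<lambda>z. cos (s * (z - of_real c))) has_field_derivative - s * sin (s * (z - of_real c))) (at z)"
    "((\<lambda>z. sin (s * (z - of_real c))) has_field_derivative s * cos (s * (z - of_real c))) (at z)" for z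
    by (rule derivative_eq_intros refl | simp)+
  show "has_ac_deriv (\<lambda>x. cos (s * of_real (x - c))) (\<lambda>x. - s * sin (s * of_real (x - c)))"
    using has_vector_derivative_real_field[OF D(1)] by (intro ac_C1 continuous_intros) simp
  show "has_ac_deriv (\<lambda>x. sin (s * of_real (x - c))) (\<lambda>x. s * cos (s * of_real (x - c)))"
    using has_vector_derivative_real_field[OF D(2)] by (intro ac_C1 continuous_intros) simp
qed

lemma ac_of_real: "has_ac_deriv (\<lambda>x. of_real x) (\<lambda>_. 1)"
proof (rule ac_C1)
  show "(complex_of_real has_vector_derivative 1) (at x)" for x
    using has_vector_derivative_of_real[OF DERIV_ident, of "at x"] by simp
qed simp

text \<open>On the cell, \<open>u\<close> is constant and \<open>w\<close> affine where \<open>q = 0\<close>; where \<open>q = 1\<close> the solution rotates.\<close>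

lemma step_transfer:
  assumes sol: "ode_sol q lam u w" and ab: "0 < \<alpha>" "\<alpha> < \<beta>" "\<beta> < 1"
    and q: "\<And>x. x \<in> {0<..<1} \<Longrightarrow> q x = (if x \<in> {\<alpha><..<\<beta>} then 1 else 0)" and s: "s\<^sup>2 = lam"
  defines "c \<equiv> cos (s * of_real (\<beta> - \<alpha>))" and "S \<equiv> sin (s * of_real (\<beta> - \<alpha>))"
  shows "s * u 1 = s * u 0 * c + (w 0 - lam * of_real \<alpha> * u 0) * S"
    and "w 1 = (w 0 - lam * of_real \<alpha> * u 0) * c - s * u 0 * S - lam * of_real (1 - \<beta>) * u 1"
proof -
  have u: "has_ac_deriv u (\<lambda>x. of_real (q x) * w x)" and w: "has_ac_deriv w (\<lambda>x. - lam * u x)"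
    using sol by (auto simp: ode_sol_def)
  have q0: "q x = 0" if "x \<in> {0<..<\<alpha>} \<union> {\<beta><..<1}" for x using q[of x] that ab by auto
  have q1: "q x = 1" if "x \<in> {\<alpha><..<\<beta>}" for x using q[of x] that ab by auto
  \<comment> \<open>Where \<open>q = 0\<close>, \<open>u\<close> is constant and \<open>w\<close>
    has slope \<open>- lam * u\<close>, so adding \<open>lam * x * u\<close> yields a second
    conserved quantity.\<close>
  have lin: "has_ac_deriv (\<lambda>x. w x + lam * (of_real x * u x)) (\<lambda>x. - lam * u x + lam * (1 * u x + of_real x * (of_real (q x) * w x)))"
    by (intro ac_add w ac_cmult ac_mult ac_of_real u)
  have a1: "u \<alpha> = u 0" by (rule ac_eq_on[OF u]) (use ab q0 in auto)
  have a2: "w \<alpha> + lam * (of_real \<alpha> * u \<alpha>) = w 0 + lam * (of_real 0 * u 0)"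
    by (rule ac_eq_on[OF lin]) (use ab q0 in auto)
  have b1: "u 1 = u \<beta>" by (rule ac_eq_on[OF u]) (use ab q0 in auto)
  have b2: "w 1 + lam * (of_real 1 * u 1) = w \<beta> + lam * (of_real \<beta> * u \<beta>)"
    by (rule ac_eq_on[OF lin]) (use ab q0 in auto)
  let ?C = "\<lambda>x. cos (s * of_real (x - \<alpha>))" and ?S = "\<lambda>x. sin (s * of_real (x - \<alpha>))"
  \<comment> \<open>For \<open>q = 1\<close> the pair \<open>(s * u, w)\<close> rotates with
    frequency \<open>s\<close>. Rotating it back by the angle \<open>s * (x - \<alpha>)\<close>
    leaves two constants, evaluated in \<open>m1\<close> and \<open>m2\<close>.\<close>
  have i1: "has_ac_deriv (\<lambda>x. s * (u x * ?C x) - w x * ?S x)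
     (\<lambda>x. s * (of_real (q x) * w x * ?C x + u x * (- s * ?S x)) - (- lam * u x * ?S x + w x * (s * ?C x)))"
    by (intro ac_diff ac_cmult ac_mult u w ac_trig)
  have m1: "s * (u \<beta> * ?C \<beta>) - w \<beta> * ?S \<beta> = s * (u \<alpha> * ?C \<alpha>) - w \<alpha> * ?S \<alpha>"
  proof (rule ac_eq_on[OF i1 AE_I2])
    show "x \<in> {\<alpha><..<\<beta>} \<longrightarrow> s * (of_real (q x) * w x * ?C x + u x * (- s * ?S x)) - (- lam * u x * ?S x + w x * (s * ?C x)) = 0" for x
      using q1[of x] by (auto simp: s[symmetric] power2_eq_square algebra_simps)
  qed (use ab in simp)
  have i2: "has_ac_deriv (\<lambda>x. s * (u x * ?S x) + w x * ?C x)
     (\<lambda>x. s * (of_real (q x) * w x * ?S x + u x * (s * ?C x)) + (- lam * u x * ?C x + w x * (- s * ?S x)))"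
    by (intro ac_add ac_cmult ac_mult u w ac_trig)
  have m2: "s * (u \<beta> * ?S \<beta>) + w \<beta> * ?C \<beta> = s * (u \<alpha> * ?S \<alpha>) + w \<alpha> * ?C \<alpha>"
  proof (rule ac_eq_on[OF i2 AE_I2])
    show "x \<in> {\<alpha><..<\<beta>} \<longrightarrow> s * (of_real (q x) * w x * ?S x + u x * (s * ?C x)) + (- lam * u x * ?C x + w x * (- s * ?S x)) = 0" for x
      using q1[of x] by (auto simp: s[symmetric] power2_eq_square algebra_simps)
  qed (use ab in simp)
  have cs: "c * c + S * S = 1" unfolding c_def S_def using sin_cos_squared_add[of "s * of_real (\<beta> - \<alpha>)"] by (simp add: power2_eq_square add.commute)
  have m1': "s * (u \<beta> * c) - w \<beta> * S = s * u 0" using m1 a1 by (simp add: c_def S_def)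
  have m2': "s * (u \<beta> * S) + w \<beta> * c = w 0 - lam * of_real \<alpha> * u 0" using m2 a1 a2 by (simp add: c_def S_def algebra_simps)
  show "s * u 1 = s * u 0 * c + (w 0 - lam * of_real \<alpha> * u 0) * S"
    unfolding b1 using m1' m2' cs by algebra
  have wb: "w \<beta> = (w 0 - lam * of_real \<alpha> * u 0) * c - s * u 0 * S"
    using m1' m2' cs by algebra
  show "w 1 = (w 0 - lam * of_real \<alpha> * u 0) * c - s * u 0 * S - lam * of_real (1 - \<beta>) * u 1"
    using b2 wb b1 by (simp add: algebra_simps)
qed

section \<open>Rescaling to unit period and convergence of the spectra\<close>

locale homogenization =
  fixes \<alpha> \<beta> :: real and p :: "real \<Rightarrow> real" and M :: real
  assumes ab: "0 < \<alpha>" "\<alpha> < \<beta>" "\<beta> < 1"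
    and p_meas: "p \<in> borel_measurable lebesgue" and p_per: "\<And>x. p (x + 1) = p x" and p_pos: "\<And>x. p x > 0"
    and M: "1 \<le> M" and p_le: "AE x in lebesgue. p x \<le> M" and p_ge: "AE x in lebesgue. 1 / p x \<le> M"
begin

text \<open>The truncation \<open>p'\<close> equals \<open>p\<close> almost everywhere but is bounded below everywhere. Then \<open>weight \<epsilon>\<close> is the
  reciprocal of the coefficient of the operator rescaled to unit period; it makes sense at \<open>\<epsilon> = 0\<close>.\<close>

definition "p' x = max (1 / M) (p x)"
definition "weight \<epsilon> y = (chi0 \<alpha> \<beta> y + \<epsilon>\<^sup>2 * chi1 \<alpha> \<beta> y) / p' y"

lemma chi: "chi0 \<alpha> \<beta> x \<in> {0, 1}" "chi1 \<alpha> \<beta> x \<in> {0, 1}" "chi0 \<alpha> \<beta> x * chi1 \<alpha> \<beta> x = 0"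
    "chi0 \<alpha> \<beta> (x + 1) = chi0 \<alpha> \<beta> x" "chi1 \<alpha> \<beta> (x + 1) = chi1 \<alpha> \<beta> x"
proof -
  have "\<beta> < \<alpha> + 1" using ab by simp
  note c = chi_facts[OF ab(2) this, of x]
  show "chi0 \<alpha> \<beta> x \<in> {0, 1}" "chi1 \<alpha> \<beta> x \<in> {0, 1}" "chi0 \<alpha> \<beta> x * chi1 \<alpha> \<beta> x = 0"
    "chi0 \<alpha> \<beta> (x + 1) = chi0 \<alpha> \<beta> x" "chi1 \<alpha> \<beta> (x + 1) = chi1 \<alpha> \<beta> x"
    by (fact c)+
qed

lemma p'_bounds: "0 < p' x" "1 / p' x \<le> M"
proof -
  have "1 / M \<le> p' x" "0 < 1 / M" using M by (auto simp: p'_def)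
  then show "0 < p' x" by linarith
  then show "1 / p' x \<le> M" using \<open>1 / M \<le> p' x\<close> M by (simp add: field_simps)
qed

lemma p'_AE: "AE x in lebesgue. p' x = p x"
  using p_ge
proof eventually_elim
  case (elim x)
  then have "1 / M \<le> p x" using p_pos[of x] M by (simp add: field_simps)
  then show ?case by (simp add: p'_def)
qed

lemma p'_meas: "p' \<in> borel_measurable lebesgue"
  using p_meas unfolding p'_def[abs_def] by measurable

lemma weight_nonneg: "0 \<le> weight \<epsilon> y"
  using chi(1,2)[of y] p'_bounds(1)[of y] unfolding weight_def by (intro divide_nonneg_pos) auto

lemma weight_periodic: "weight \<epsilon> (y + 1) = weight \<epsilon> y"
  by (simp add: weight_def chi p'_def p_per)

lemma weight_bounded: "bounded_weight (M * (1 + \<epsilon>\<^sup>2)) (weight \<epsilon>)"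
proof -
  have "(\<lambda>y. (chi0 \<alpha> \<beta> y + \<epsilon>\<^sup>2 * chi1 \<alpha> \<beta> y) / p' y) \<in> borel_measurable lebesgue"
    using chi_measurable[of \<alpha> \<beta>] p'_meas by measurable
  moreover have "\<bar>weight \<epsilon> y\<bar> \<le> M * (1 + \<epsilon>\<^sup>2)" for y
  proof -
    have "\<bar>weight \<epsilon> y\<bar> = (1 / p' y) * (chi0 \<alpha> \<beta> y + \<epsilon>\<^sup>2 * chi1 \<alpha> \<beta> y)"
      unfolding abs_of_nonneg[OF weight_nonneg] by (simp add: weight_def)
    also have "\<dots> \<le> M * (1 + \<epsilon>\<^sup>2)"
      using chi(1,2)[of y] p'_bounds[of y] M by (intro mult_mono) auto
    finally show ?thesis .
  qed
  ultimately show ?thesis by (simp add: bounded_weight_def weight_def[abs_def])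
qed

text \<open>One constant for all small \<epsilon>, so that the Lipschitz estimate compares every
  \<open>weight \<epsilon>\<close> with \<open>weight 0\<close> uniformly.\<close>

lemma weight_bounded': "\<bar>\<epsilon>\<bar> \<le> 1 \<Longrightarrow> bounded_weight (2 * M) (weight \<epsilon>)"
proof (rule bounded_weight_mono[OF weight_bounded])
  assume "\<bar>\<epsilon>\<bar> \<le> 1"
  then have "1 + \<epsilon>\<^sup>2 \<le> 2" using abs_square_le_1[of \<epsilon>] by simp
  then have "M * (1 + \<epsilon>\<^sup>2) \<le> M * 2" using M by (intro mult_left_mono) auto
  then show "M * (1 + \<epsilon>\<^sup>2) \<le> 2 * M" by simp
qed

lemma one_bounded: "bounded_weight (2 * M) (\<lambda>_. 1)"
  using M by (intro bounded_weight_const) auto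

lemma weight_diff: "\<bar>weight \<epsilon> y - weight 0 y\<bar> \<le> \<epsilon>\<^sup>2 * M"
proof -
  have "weight \<epsilon> y - weight 0 y = \<epsilon>\<^sup>2 * chi1 \<alpha> \<beta> y * (1 / p' y)"
    by (simp add: weight_def diff_divide_distrib[symmetric])
  also have "\<bar>\<dots>\<bar> \<le> \<epsilon>\<^sup>2 * M"
    unfolding abs_mult using chi(2)[of y] p'_bounds[of y] by (intro mult_mono) auto
  finally show ?thesis .
qed

text \<open>The trace of the monodromy matrix over the unit period, written as series so that it
  makes sense for every \<epsilon> including 0 and can be compared over one fixed interval.\<close>

definition "Discr \<epsilon> lam = even_series (weight \<epsilon>) (\<lambda>_. 1) (- lam) 1 + even_series (\<lambda>_. 1) (weight \<epsilon>) (- lam) 1"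

lemma Discr_0: "Discr \<epsilon> 0 = 2"
  by (simp add: Discr_def even_series_at_0)

lemma Discr_holomorphic: assumes "\<bar>\<epsilon>\<bar> \<le> 1" shows "Discr \<epsilon> holomorphic_on S"
proof -
  note w = weight_bounded'[OF assms]
  have um: "(\<lambda>x::complex. - x) holomorphic_on S" by (rule holomorphic_on_minus[OF holomorphic_on_ident])
  have "(\<lambda>lam. even_series (weight \<epsilon>) (\<lambda>_. 1) (- lam) 1) holomorphic_on S"
    "(\<lambda>lam. even_series (\<lambda>_. 1) (weight \<epsilon>) (- lam) 1) holomorphic_on S"
    using holomorphic_on_compose_gen[OF um even_series_holomorphic[OF w one_bounded, of 1]]
      holomorphic_on_compose_gen[OF um even_series_holomorphic[OF one_bounded w, of 1]]
    by (auto simp: o_def)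
  then show ?thesis unfolding Discr_def[abs_def] by (rule holomorphic_on_add)
qed

lemma Discr_close:
  assumes "\<bar>\<epsilon>\<bar> \<le> 1" shows "norm (Discr \<epsilon> lam - Discr 0 lam) \<le> 2 * (\<epsilon>\<^sup>2 * M) * exp (norm lam * (2 * M)\<^sup>2)"
proof -
  note w = weight_bounded'[OF assms] weight_bounded'[of 0, simplified]
  have d: "0 \<le> \<epsilon>\<^sup>2 * M" using M by simp
  have "1 \<le> 2 * M" using M by simp
  note L = even_series_Lipschitz[OF w(1) one_bounded w(2) one_bounded this weight_diff, of "- lam"]
    even_series_Lipschitz[OF one_bounded w(1) one_bounded w(2) this _ weight_diff, of "- lam"]
  have "norm (Discr \<epsilon> lam - Discr 0 lam) =
    norm ((even_series (weight \<epsilon>) (\<lambda>_. 1) (- lam) 1 - even_series (weight 0) (\<lambda>_. 1) (- lam) 1)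
      + (even_series (\<lambda>_. 1) (weight \<epsilon>) (- lam) 1 - even_series (\<lambda>_. 1) (weight 0) (- lam) 1))"
    by (simp add: Discr_def algebra_simps)
  also have "\<dots> \<le> \<epsilon>\<^sup>2 * M * exp (norm lam * (2 * M)\<^sup>2) + \<epsilon>\<^sup>2 * M * exp (norm lam * (2 * M)\<^sup>2)"
    using L d by (intro order_trans[OF norm_triangle_ineq] add_mono) auto
  also have "\<dots> = 2 * (\<epsilon>\<^sup>2 * M) * exp (norm lam * (2 * M)\<^sup>2)" by simp
  finally show ?thesis .
qed

sublocale limit: limit_problem "weight 0" "2 * M" \<alpha> \<beta> p
proof
  show "bounded_weight (2 * M) (weight 0)" by (rule weight_bounded') simp
  show "1 \<le> 2 * M" using M by simp
  show "AE x in lebesgue. x \<in> {\<alpha><..<\<beta>} \<longrightarrow> p x * weight 0 x = 1"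
    using p'_AE
  proof eventually_elim
    case (elim x)
    then show ?case using p_pos[of x] chi0_unit[of \<alpha> \<beta> x] ab by (auto simp: weight_def)
  qed
  show "AE x in lebesgue. x \<in> {0<..<1} - {\<alpha><..<\<beta>} \<longrightarrow> weight 0 x = 0"
    using chi0_unit[of \<alpha> \<beta>] ab by (auto simp: weight_def)
qed (use ab p_meas p_pos in auto)

lemma Lambda_iff: "lam \<in> Lambda_set \<alpha> \<beta> p \<longleftrightarrow> (\<exists>\<theta>\<in>{0..<1}. Discr 0 lam = complex_of_real (2 * cos (2 * pi * \<theta>)))"
proof -
  have "limit.discr 1 lam = Discr 0 lam"
    by (simp add: limit.discr_def limit.u1_def limit.w2_def Discr_def)
  then show ?thesis by (simp add: Lambda_set_def limit.spec_A_theta_iff)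
qed

lemma Lambda_real: "lam \<in> Lambda_set \<alpha> \<beta> p \<Longrightarrow> Im lam = 0"
  by (auto simp: Lambda_set_def limit.spec_A_theta_iff intro: limit.eigenvalue_real)

lemma S_eps_iff:
  assumes e: "\<epsilon> > 0"
  shows "lam \<in> S_eps \<alpha> \<beta> p \<epsilon> \<longleftrightarrow> (\<exists>\<theta>\<in>{0..<1}. Discr \<epsilon> lam = complex_of_real (2 * cos (2 * pi * \<theta>)))"
proof -
  \<comment> \<open>The reciprocal of \<open>a\<close> almost everywhere: the phases are disjoint,
    so dividing the factor \<open>chi0 + \<epsilon>\<^sup>2 * chi1\<close> by
    \<open>\<epsilon>\<^sup>2\<close> inverts \<open>\<epsilon>\<^sup>2 * chi0 + chi1\<close> on
    either phase.\<close>
  define q where "q x = weight \<epsilon> (x / \<epsilon>) * (1 / \<epsilon>\<^sup>2)" for x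
  define a where "a x = p (x / \<epsilon>) * (\<epsilon>\<^sup>2 * chi0 \<alpha> \<beta> (x / \<epsilon>) + chi1 \<alpha> \<beta> (x / \<epsilon>))" for x
  define C where "C = M * (1 + \<epsilon>\<^sup>2) * \<bar>1 / \<epsilon>\<^sup>2\<bar> + 1"
  have C: "0 \<le> M * (1 + \<epsilon>\<^sup>2) * \<bar>1 / \<epsilon>\<^sup>2\<bar>" using M by simp
  have rescale: "AE x in lebesgue. P (x / \<epsilon>)" if "AE x in lebesgue. P x" for P
    using AE_affine[OF that, of "1 / \<epsilon>" 0] e by simp
  have p_scaled: "(\<lambda>x. p (x / \<epsilon>)) \<in> borel_measurable lebesgue" "(\<lambda>x. chi0 \<alpha> \<beta> (x / \<epsilon>)) \<in> borel_measurable lebesgue"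
    "(\<lambda>x. chi1 \<alpha> \<beta> (x / \<epsilon>)) \<in> borel_measurable lebesgue"
    using borel_measurable_affine[OF p_meas, of "1 / \<epsilon>" 0] borel_measurable_affine[OF chi_measurable(1), of "1 / \<epsilon>" \<alpha> \<beta> 0]
      borel_measurable_affine[OF chi_measurable(2), of "1 / \<epsilon>" \<alpha> \<beta> 0] e by simp_all
  interpret line: line_problem q C a "M * (\<epsilon>\<^sup>2 + 1)" \<epsilon>
  proof
    show "bounded_weight C q"
      unfolding q_def[abs_def] by (rule bounded_weight_mono[OF bounded_weight_scale[OF weight_bounded e]]) (simp add: C_def)
    show "1 \<le> C" using C by (simp add: C_def)
    show "0 < \<epsilon>" by (rule e)
    show "q (x + \<epsilon>) = q x" for x
      using weight_periodic[of \<epsilon> "x / \<epsilon>"] e by (simp add: q_def add_divide_distrib)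
    show "0 \<le> q x" for x unfolding q_def using weight_nonneg by (intro mult_nonneg_nonneg) auto
    show "a \<in> borel_measurable lebesgue" unfolding a_def[abs_def] using p_scaled by measurable
    show "AE x in lebesgue. a x * q x = 1"
      using rescale[OF p'_AE] rescale[OF chi_sum_AE[of \<alpha> \<beta>]]
    proof eventually_elim
      case (elim x)
      let ?y = "x / \<epsilon>"
      have "chi0 \<alpha> \<beta> ?y = 1 \<and> chi1 \<alpha> \<beta> ?y = 0 \<or> chi0 \<alpha> \<beta> ?y = 0 \<and> chi1 \<alpha> \<beta> ?y = 1"
        using elim(2) chi(1-3)[of ?y] by (auto simp: chi0_def chi1_def)
      then show ?case
        using e p_pos[of ?y] elim(1) by (auto simp: a_def q_def weight_def)
    qed
    show "AE x in lebesgue. \<bar>a x\<bar> \<le> M * (\<epsilon>\<^sup>2 + 1)"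
      using rescale[OF p_le]
    proof eventually_elim
      case (elim x)
      have "\<bar>a x\<bar> = \<bar>p (x / \<epsilon>)\<bar> * \<bar>\<epsilon>\<^sup>2 * chi0 \<alpha> \<beta> (x / \<epsilon>) + chi1 \<alpha> \<beta> (x / \<epsilon>)\<bar>" by (simp add: a_def abs_mult)
      also have "\<dots> \<le> M * (\<epsilon>\<^sup>2 + 1)"
        using elim p_pos[of "x / \<epsilon>"] chi(1,2)[of "x / \<epsilon>"] M by (intro mult_mono) auto
      finally show ?case .
    qed
  qed
  have "form_eps \<alpha> \<beta> p \<epsilon> = form_line a"
    by (intro ext) (simp add: form_eps_def form_line_def a_def)
  then have "S_eps \<alpha> \<beta> p \<epsilon> = form_spectrum lebesgue (L2 lebesgue) (H1 UNIV) (form_line a)"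
    by (simp add: S_eps_def lebesgue_on_UNIV_eq)
  \<comment> \<open>The monodromy over the small period \<epsilon> has the same trace as the
    rescaled one over the unit period; the \<open>1 / \<epsilon>\<^sup>2\<close> in \<open>q\<close>
    balances the two integrations over length \<epsilon>, as \<open>even_series_scale\<close>
    requires.\<close>
  moreover have "line.discr \<epsilon> lam = Discr \<epsilon> lam"
  proof -
    have w: "bounded_weight (M * (1 + \<epsilon>\<^sup>2) + 1) (weight \<epsilon>)" "bounded_weight (M * (1 + \<epsilon>\<^sup>2) + 1) (\<lambda>_. 1)"
      using weight_bounded[of \<epsilon>] M by (auto intro: bounded_weight_mono bounded_weight_const)
    have "even_series q (\<lambda>_. 1) (- lam) \<epsilon> = even_series (weight \<epsilon>) (\<lambda>_. 1) (- lam) 1"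
      using even_series_scale[OF w e, of "1 / \<epsilon>\<^sup>2" 1] e by (simp add: q_def[abs_def])
    moreover have "even_series (\<lambda>_. 1) q (- lam) \<epsilon> = even_series (\<lambda>_. 1) (weight \<epsilon>) (- lam) 1"
      using even_series_scale[OF w(2,1) e, of 1 "1 / \<epsilon>\<^sup>2"] e by (simp add: q_def[abs_def])
    ultimately show ?thesis by (simp add: line.discr_def line.u1_def line.w2_def Discr_def)
  qed
  ultimately show ?thesis using line.line_spectrum_iff[of lam] by simp
qed

text \<open>The error bound of \<open>Discr_close\<close> stays bounded along the convergent
  \<open>l\<close>, so the traces converge to \<open>Discr 0 lam\<close>, and the segment from -2 to
  2 is closed.\<close>

lemma limit_closed:
  assumes e: "\<And>n::nat. e n > 0" "e \<longlonglongrightarrow> 0" and l: "\<And>n. l n \<in> S_eps \<alpha> \<beta> p (e n)" "l \<longlonglongrightarrow> lam"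
  shows "lam \<in> Lambda_set \<alpha> \<beta> p"
proof -
  have "\<forall>\<^sub>F n in sequentially. dist (e n) 0 < 1" using tendstoD[OF e(2), of 1] by simp
  then have e1: "\<forall>\<^sub>F n in sequentially. \<bar>e n\<bar> \<le> 1"
    by eventually_elim (simp add: dist_real_def)
  have "(\<lambda>n. 2 * ((e n)\<^sup>2 * M) * exp (norm (l n) * (2 * M)\<^sup>2)) \<longlonglongrightarrow> 2 * (0\<^sup>2 * M) * exp (norm lam * (2 * M)\<^sup>2)"
    by (intro tendsto_intros e l)
  then have g0: "(\<lambda>n. 2 * ((e n)\<^sup>2 * M) * exp (norm (l n) * (2 * M)\<^sup>2)) \<longlonglongrightarrow> 0" by simp
  have "\<forall>\<^sub>F n in sequentially. norm (Discr (e n) (l n) - Discr 0 (l n)) \<le> 2 * ((e n)\<^sup>2 * M) * exp (norm (l n) * (2 * M)\<^sup>2)"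
    using e1 by eventually_elim (rule Discr_close)
  then have "(\<lambda>n. Discr (e n) (l n) - Discr 0 (l n)) \<longlonglongrightarrow> 0"
    by (rule Lim_null_comparison[OF _ g0])
  moreover have "isCont (Discr 0) lam"
    using holomorphic_on_imp_continuous_on[OF Discr_holomorphic[of 0 UNIV]] by (simp add: continuous_on_eq_continuous_at)
  then have "(\<lambda>n. Discr 0 (l n)) \<longlonglongrightarrow> Discr 0 lam" by (rule isCont_tendsto_compose[OF _ l(2)])
  ultimately have "(\<lambda>n. (Discr (e n) (l n) - Discr 0 (l n)) + Discr 0 (l n)) \<longlonglongrightarrow> 0 + Discr 0 lam"
    by (rule tendsto_add)
  then have t: "(\<lambda>n. Discr (e n) (l n)) \<longlonglongrightarrow> Discr 0 lam" by simp
  have r: "Im (Discr (e n) (l n)) = 0" "\<bar>Re (Discr (e n) (l n))\<bar> \<le> 2" for n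
    using l(1)[of n] unfolding S_eps_iff[OF e(1)] two_cos_range by simp_all
  have "(\<lambda>n. Im (Discr (e n) (l n))) \<longlonglongrightarrow> Im (Discr 0 lam)" by (rule tendsto_Im[OF t])
  from LIMSEQ_unique[OF this[unfolded r] tendsto_const] have "Im (Discr 0 lam) = 0" .
  moreover have "\<bar>Re (Discr 0 lam)\<bar> \<le> 2"
    by (rule LIMSEQ_le_const2[OF tendsto_rabs[OF tendsto_Re[OF t]]]) (use r in auto)
  ultimately show ?thesis unfolding Lambda_iff two_cos_range by blast
qed

text \<open>Nonemptiness for every positive \<epsilon>, so that a spectral point can be selected
  also where \<epsilon> is not small.\<close>

lemma zero_in_S_eps: "\<epsilon> > 0 \<Longrightarrow> 0 \<in> S_eps \<alpha> \<beta> p \<epsilon>"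
  unfolding S_eps_iff Discr_0 two_cos_range by simp

text \<open>Otherwise some sequence tending to 0 would give functions
  \<open>Discr (e k) - Discr 0 lam\<close> without zeros in the ball; by Hurwitz's theorem their
  nonconstant limit could not vanish at the centre, but it does.\<close>

lemma limit_approx:
  assumes lam: "lam \<in> Lambda_set \<alpha> \<beta> p" and r: "r > 0"
  shows "\<forall>\<^sub>F \<epsilon> in at_right 0. \<exists>x \<in> S_eps \<alpha> \<beta> p \<epsilon>. dist x lam < r"
proof (rule ccontr)
  assume n: "\<not> ?thesis"
  have "\<exists>\<epsilon>>0. \<epsilon> < 1 / real (Suc k) \<and> (\<forall>x \<in> S_eps \<alpha> \<beta> p \<epsilon>. \<not> dist x lam < r)" for k
  proof (rule ccontr)
    assume "\<not> ?thesis"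
    then have "\<forall>\<^sub>F \<epsilon> in at_right 0. \<exists>x \<in> S_eps \<alpha> \<beta> p \<epsilon>. dist x lam < r"
      unfolding eventually_at_right_field by (intro exI[of _ "1 / real (Suc k)"]) auto
    with n show False by blast
  qed
  then obtain e where e: "\<And>k. e k > 0" "\<And>k. e k < 1 / real (Suc k)" "\<And>k x. x \<in> S_eps \<alpha> \<beta> p (e k) \<Longrightarrow> \<not> dist x lam < r"
    by metis
  have e1: "\<bar>e k\<bar> \<le> 1" for k
  proof -
    have "1 / real (Suc k) \<le> 1" by simp
    then show ?thesis using e(1,2)[of k] by linarith
  qed
  have "(\<lambda>k. 1 / real (Suc k)) \<longlonglongrightarrow> 0" using LIMSEQ_inverse_real_of_nat by (simp add: inverse_eq_divide)
  then have e0: "e \<longlonglongrightarrow> 0"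
    by (rule tendsto_sandwich[of "\<lambda>_. 0" e sequentially "\<lambda>k. 1 / real (Suc k)" 0, rotated 3])
       (use e in \<open>auto intro!: always_eventually less_imp_le simp del: of_nat_Suc\<close>)
  let ?d = "Discr 0 lam"
  obtain \<theta> where \<theta>: "\<theta> \<in> {0..<1}" "?d = complex_of_real (2 * cos (2 * pi * \<theta>))" using lam Lambda_iff by auto
  have "Discr 0 lam - ?d \<noteq> 0"
  proof (rule Hurwitz_no_zeros[of "ball lam r" "\<lambda>k x. Discr (e k) x - ?d" "\<lambda>x. Discr 0 x - ?d" lam])
    show "(\<lambda>x. Discr (e k) x - ?d) holomorphic_on ball lam r" for k
      by (intro holomorphic_intros Discr_holomorphic e1)
    show "(\<lambda>x. Discr 0 x - ?d) holomorphic_on ball lam r"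
      by (intro holomorphic_intros Discr_holomorphic) simp
    show "uniform_limit K (\<lambda>k x. Discr (e k) x - ?d) (\<lambda>x. Discr 0 x - ?d) sequentially" if "compact K" "K \<subseteq> ball lam r" for K
    proof (rule uniform_limitI)
      fix s :: real assume s: "s > 0"
      define B where "B = exp ((norm lam + r) * (2 * M)\<^sup>2)"
      have "(\<lambda>k. 2 * ((e k)\<^sup>2 * M) * B) \<longlonglongrightarrow> 2 * (0\<^sup>2 * M) * B" by (intro tendsto_intros e0)
      then have "\<forall>\<^sub>F k in sequentially. 2 * ((e k)\<^sup>2 * M) * B < s" using order_tendstoD(2)[of _ _ _ s] s by simp
      then show "\<forall>\<^sub>F k in sequentially. \<forall>x\<in>K. dist (Discr (e k) x - ?d) (Discr 0 x - ?d) < s"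
      proof eventually_elim
        case (elim k)
        show ?case
        proof
          fix x assume "x \<in> K"
          then have "norm x \<le> norm lam + r"
            using that(2) norm_triangle_ineq2[of x lam] by (force simp: dist_norm norm_minus_commute)
          then have B: "exp (norm x * (2 * M)\<^sup>2) \<le> B" unfolding B_def by (simp add: mult_right_mono)
          have "dist (Discr (e k) x - ?d) (Discr 0 x - ?d) \<le> 2 * ((e k)\<^sup>2 * M) * exp (norm x * (2 * M)\<^sup>2)"
            using Discr_close[OF e1, of k x] by (simp add: dist_norm)
          also have "\<dots> \<le> 2 * ((e k)\<^sup>2 * M) * B" using B M by (intro mult_left_mono) auto
          finally show "dist (Discr (e k) x - ?d) (Discr 0 x - ?d) < s" using elim by simp
        qed
      qed
    qed
    show "\<not> (\<lambda>x. Discr 0 x - ?d) constant_on ball lam r"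
    proof
      assume "(\<lambda>x. Discr 0 x - ?d) constant_on ball lam r"
      then obtain c where c: "\<And>x. x \<in> ball lam r \<Longrightarrow> Discr 0 x - ?d = c" by (auto simp: constant_on_def)
      \<comment> \<open>A non-real point of the ball: if the limit were constant there, this point
        would belong to \<Lambda>, whose elements are real.\<close>
      define x where "x = lam + of_real (r / 2) * \<i>"
      have "x \<in> ball lam r" using r by (simp add: x_def dist_norm norm_mult)
      then have "Discr 0 x = ?d" using c[of x] c[of lam] r by simp
      then have "x \<in> Lambda_set \<alpha> \<beta> p" using \<theta> by (auto simp: Lambda_iff)
      from Lambda_real[OF this] Lambda_real[OF lam] r show False by (simp add: x_def)
    qed
    show "Discr (e k) x - ?d \<noteq> 0" if "x \<in> ball lam r" for k x
    proof
      assume "Discr (e k) x - ?d = 0"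
      then have "Discr (e k) x = complex_of_real (2 * cos (2 * pi * \<theta>))" using \<theta>(2) by simp
      then have "x \<in> S_eps \<alpha> \<beta> p (e k)" unfolding S_eps_iff[OF e(1)] using \<theta>(1) by blast
      from e(3)[OF this] that show False by (simp add: dist_commute)
    qed
  qed (use r in auto)
  then show False by simp
qed

text \<open>One function of \<epsilon> has to serve all neighbourhoods of \<open>lam\<close> at
  once. It picks spectral points nearest to \<open>lam\<close> up to a slack of \<epsilon>, and
  \<open>limit_approx\<close> makes the distance tend to 0.\<close>

lemma limit_attained:
  assumes lam: "lam \<in> Lambda_set \<alpha> \<beta> p"
  shows "\<exists>l :: real \<Rightarrow> complex. (\<forall>\<epsilon>>0. l \<epsilon> \<in> S_eps \<alpha> \<beta> p \<epsilon>) \<and> (l \<longlongrightarrow> lam) (at_right 0)"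
proof -
  have "\<forall>\<epsilon>. \<epsilon> > 0 \<longrightarrow> (\<exists>x. x \<in> S_eps \<alpha> \<beta> p \<epsilon> \<and> dist lam x < infdist lam (S_eps \<alpha> \<beta> p \<epsilon>) + \<epsilon>)"
  proof (intro allI impI)
    fix \<epsilon> :: real assume e: "\<epsilon> > 0"
    then have ne: "S_eps \<alpha> \<beta> p \<epsilon> \<noteq> {}" using zero_in_S_eps by blast
    have "(INF x\<in>S_eps \<alpha> \<beta> p \<epsilon>. dist lam x) < infdist lam (S_eps \<alpha> \<beta> p \<epsilon>) + \<epsilon>"
      using ne e by (simp add: infdist_notempty)
    then show "\<exists>x. x \<in> S_eps \<alpha> \<beta> p \<epsilon> \<and> dist lam x < infdist lam (S_eps \<alpha> \<beta> p \<epsilon>) + \<epsilon>"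
      using cINF_less_iff[OF ne, of "dist lam"] by (auto intro: bdd_belowI2[of _ 0])
  qed
  then obtain l where l: "\<And>\<epsilon>. \<epsilon> > 0 \<Longrightarrow> l \<epsilon> \<in> S_eps \<alpha> \<beta> p \<epsilon>"
    "\<And>\<epsilon>. \<epsilon> > 0 \<Longrightarrow> dist lam (l \<epsilon>) < infdist lam (S_eps \<alpha> \<beta> p \<epsilon>) + \<epsilon>" by metis
  have "(l \<longlongrightarrow> lam) (at_right 0)"
  proof (rule tendstoI)
    fix r :: real assume r: "r > 0"
    have "\<forall>\<^sub>F \<epsilon> in at_right 0. 0 < \<epsilon> \<and> \<epsilon> < r / 2"
      unfolding eventually_at_right_field using r by (intro exI[of _ "r / 2"]) auto
    moreover have "\<forall>\<^sub>F \<epsilon> in at_right 0. \<exists>x \<in> S_eps \<alpha> \<beta> p \<epsilon>. dist x lam < r / 2"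
      by (rule limit_approx[OF lam]) (use r in simp)
    ultimately show "\<forall>\<^sub>F \<epsilon> in at_right 0. dist (l \<epsilon>) lam < r"
    proof eventually_elim
      case (elim \<epsilon>)
      then obtain x where x: "x \<in> S_eps \<alpha> \<beta> p \<epsilon>" "dist x lam < r / 2" by blast
      have "infdist lam (S_eps \<alpha> \<beta> p \<epsilon>) \<le> dist lam x" by (rule infdist_le[OF x(1)])
      with l(2)[of \<epsilon>] elim x(2) show ?case by (simp add: dist_commute)
    qed
  qed
  with l(1) show ?thesis by blast
qed

end

text \<open>For \<open>p = 1\<close> the weight is the indicator of the soft interval, so the
  monodromy matrix is explicit: stiff pieces shear the data and the soft piece rotates them.\<close>

lemma Lambda_constant_coefficient:
  assumes ab: "0 < \<alpha>" "\<alpha> < \<beta>" "\<beta> < 1"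
  shows "Lambda_set \<alpha> \<beta> (\<lambda>_. 1) = {lam. \<exists>\<theta> \<in> {0..<1}. let s = csqrt lam in
     of_real ((\<alpha> - \<beta> + 1) / 2) * s * sin (s * of_real (\<alpha> - \<beta>)) + cos (s * of_real (\<alpha> - \<beta>)) = of_real (cos (2 * pi * \<theta>))}"
proof -
  interpret homogenization \<alpha> \<beta> "\<lambda>_. 1" 1 by unfold_locales (use ab in auto)
  have q: "weight 0 x = (if x \<in> {\<alpha><..<\<beta>} then 1 else 0)" if "x \<in> {0<..<1}" for x
    using chi0_unit[OF ab(1,3) that] by (simp add: weight_def p'_def)
  have D: "Discr 0 lam = 2 * (of_real ((\<alpha> - \<beta> + 1) / 2) * s * sin (s * of_real (\<alpha> - \<beta>)) + cos (s * of_real (\<alpha> - \<beta>)))"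
    if s: "s = csqrt lam" for s lam
  proof (cases "s = 0")
    case True
    then have "lam = 0" using s by simp
    then show ?thesis using True by (simp add: Discr_0)
  next
    case False
    define c S where "c = cos (s * of_real (\<beta> - \<alpha>))" and "S = sin (s * of_real (\<beta> - \<alpha>))"
    have s2: "s\<^sup>2 = lam" using s by simp
    note t1 = step_transfer[OF limit.fundamental_sols(1) ab q s2, folded c_def S_def]
    note t2 = step_transfer[OF limit.fundamental_sols(2) ab q s2, folded c_def S_def]
    have "s * of_real (\<alpha> - \<beta>) = - (s * of_real (\<beta> - \<alpha>))" by (simp add: algebra_simps)
    then have m: "cos (s * of_real (\<alpha> - \<beta>)) = c" "sin (s * of_real (\<alpha> - \<beta>)) = - S"
      by (simp_all only: cos_minus sin_minus c_def S_def)
    \<comment> \<open>\<open>step_transfer\<close> gives \<open>u 1\<close> only after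
      multiplication by \<open>s\<close>; this is why \<open>s = 0\<close> is handled apart, through
      the value of the trace at 0.\<close>
    have "s * limit.discr 1 lam = s * (2 * c - s * of_real (\<alpha> - \<beta> + 1) * S)"
    proof -
      have 1: "s * limit.u1 lam 1 = s * c - lam * of_real \<alpha> * S" using t1(1) by simp
      have 2: "s * limit.u2 lam 1 = S" and 3: "limit.w2 lam 1 = c - lam * of_real (1 - \<beta>) * limit.u2 lam 1"
        using t2 by simp_all
      have "s * limit.w2 lam 1 = s * c - lam * of_real (1 - \<beta>) * (s * limit.u2 lam 1)"
        unfolding 3 by (simp add: algebra_simps)
      then have 4: "s * limit.w2 lam 1 = s * c - lam * of_real (1 - \<beta>) * S" unfolding 2 .
      have 5: "complex_of_real (\<alpha> - \<beta> + 1) = of_real \<alpha> + of_real (1 - \<beta>)" by simp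
      show ?thesis unfolding limit.discr_def 5 using 1 4 s2 by algebra
    qed
    then have "limit.discr 1 lam = 2 * c - s * of_real (\<alpha> - \<beta> + 1) * S" using False by simp
    moreover have "limit.discr 1 lam = Discr 0 lam"
      by (simp add: limit.discr_def limit.u1_def limit.w2_def Discr_def)
    ultimately show ?thesis unfolding m of_real_divide by simp
  qed
  show ?thesis
  proof (intro set_eqI)
    fix lam
    have half: "(2 * y = complex_of_real (2 * r)) = (y = of_real r)" for y r by simp
    show "lam \<in> Lambda_set \<alpha> \<beta> (\<lambda>_. 1) \<longleftrightarrow> lam \<in> {lam. \<exists>\<theta> \<in> {0..<1}. let s = csqrt lam in
     of_real ((\<alpha> - \<beta> + 1) / 2) * s * sin (s * of_real (\<alpha> - \<beta>)) + cos (s * of_real (\<alpha> - \<beta>)) = of_real (cos (2 * pi * \<theta>))}"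
      unfolding Lambda_iff D[OF refl] mem_Collect_eq Let_def half by (rule refl)
  qed
qed

theorem theorem2p1:
  fixes \<alpha> \<beta> :: real and p :: "real \<Rightarrow> real"
  assumes "0 < \<alpha>" "\<alpha> < \<beta>" "\<beta> < 1"
    and "p \<in> borel_measurable lebesgue"
    and "\<forall>x. p (x + 1) = p x"
    and "\<forall>x. p x > 0"
    and "\<exists>M. AE x in lebesgue_on {0<..<1}. \<bar>p x\<bar> \<le> M"
    and "\<exists>M. AE x in lebesgue_on {0<..<1}. \<bar>1 / p x\<bar> \<le> M"
  shows "(\<forall>lam \<in> Lambda_set \<alpha> \<beta> p. \<exists>l :: real \<Rightarrow> complex.
            (\<forall>\<epsilon>>0. l \<epsilon> \<in> S_eps \<alpha> \<beta> p \<epsilon>) \<and> (l \<longlongrightarrow> lam) (at_right 0))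
       \<and> (\<forall>(e :: nat \<Rightarrow> real) (l :: nat \<Rightarrow> complex) lam.
            (\<forall>n. e n > 0) \<and> e \<longlonglongrightarrow> 0 \<and> (\<forall>n. l n \<in> S_eps \<alpha> \<beta> p (e n)) \<and> l \<longlonglongrightarrow> lam
            \<longrightarrow> lam \<in> Lambda_set \<alpha> \<beta> p)
       \<and> Lambda_set \<alpha> \<beta> (\<lambda>_. 1) =
           {lam. \<exists>\<theta> \<in> {0..<1}.
              let s = csqrt lam in
              of_real ((\<alpha> - \<beta> + 1) / 2) * s * sin (s * of_real (\<alpha> - \<beta>)) + cos (s * of_real (\<alpha> - \<beta>))
                = of_real (cos (2 * pi * \<theta>))}"
proof -
  obtain M1 M2 where M1: "AE x in lebesgue_on {0<..<1}. \<bar>p x\<bar> \<le> M1" and M2: "AE x in lebesgue_on {0<..<1}. \<bar>1 / p x\<bar> \<le> M2"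
    using assms(7,8) by blast
  define M where "M = max 1 (max M1 M2)"
  have "AE x in lebesgue. x \<in> {0<..<1} \<longrightarrow> \<bar>p x\<bar> \<le> M1" "AE x in lebesgue. x \<in> {0<..<1} \<longrightarrow> \<bar>1 / p x\<bar> \<le> M2"
    using M1 M2 by (simp_all add: AE_lebesgue_on)
  then have "AE x in lebesgue. x \<in> {0<..<1} \<longrightarrow> p x \<le> M \<and> 1 / p x \<le> M"
  proof eventually_elim
    case (elim x)
    have "p x \<le> M1" "1 / p x \<le> M2" if "x \<in> {0<..<1}"
      using elim that abs_ge_self[of "p x"] abs_ge_self[of "1 / p x"] by linarith+
    then show ?case unfolding M_def by (auto simp: le_max_iff_disj)
  qed
  \<comment> \<open>The bounds are assumed on one period only; periodicity of \<open>p\<close>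
    carries them to the line.\<close>
  then have b: "AE x in lebesgue. p x \<le> M \<and> 1 / p x \<le> M"
    by (rule AE_periodic) (use assms(5) in simp)
  interpret homogenization \<alpha> \<beta> p M
  proof
    show "AE x in lebesgue. p x \<le> M" using b by eventually_elim simp
    show "AE x in lebesgue. 1 / p x \<le> M" using b by eventually_elim simp
    show "1 \<le> M" by (simp add: M_def)
  qed (use assms in auto)
  show ?thesis
    using limit_attained limit_closed Lambda_constant_coefficient[OF assms(1-3)] by blast
qed

end
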